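(* Let $b$ be a locally finite graph over a discrete measure space $(X,m)$ satisfying the ellipticity condition (EC): there is a constant $C>0$ such that $b(x,y)\le C\,m(x)m(y)$ for all $x,y\in X$. Let $n\in(0,\infty]$ (with $1/n:=0$ if $n=\infty$) and $K\in\mathbb{R}$. Then the following statements are equivalent (all inequalities are understood pointwise on $X$): (i) $CD(-K,n)$ holds. (ii) For all $f\in C_c^+(X)$ and $t\ge 0$, $$\Gamma(P_tf)\le e^{2Kt}P_t(\Gamma(f))-\frac{2}{n}\int_0^t e^{2Ks}P_s\big[(P_{t-s}\Delta f)^2\big]\,ds.$$ (iii) For all $f\in C_c^+(X)$ and $t\ge 0$, $$\Gamma(P_tf)\le e^{2Kt}P_t(\Gamma(f))-\frac{e^{2Kt}-1}{Kn}(P_t\Delta f)^2.$$ (iv) For all $f\in C_c^+(X)$ and $t\ge 0$, $$P_t(f^2)-(P_tf)^2\le \frac{e^{2Kt}-1}{K}P_t(\Gamma(f))-\frac{e^{2Kt}-1-2Kt}{K^2n}(P_t\Delta f)^2.$$ (v) For all $f\in C_c^+(X)$ and $t\ge 0$, $$P_t(f^2)-(P_tf)^2\ge \frac{1-e^{-2Kt}}{K}\Gamma(P_tf)+\frac{e^{-2Kt}-1+2Kt}{K^2n}(P_t\Delta f)^2.$$ Here for $K=0$ one sets $(1-e^{\pm 2Kt})/K:=\mp 2t$ and $(e^{\pm 2Kt}-1\mp 2Kt)/K^2:=2t^2$.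
   Context: $X$ is a countable discrete set and $m:X\to(0,\infty)$, extended to a measure by $m(A)=\sum_{x\in A}m(x)$; $(X,m)$ is called a discrete measure space. A locally finite graph over $(X,m)$ is a symmetric function $b:X\times X\to[0,\infty)$ with zero diagonal such that $\{y\in X: b(x,y)>0\}$ is finite for every $x\in X$. $C(X)$ denotes all real-valued functions on $X$, $C_c(X)$ the finitely supported ones, and $C_c^+(X)=\{f\in C_c(X): f\ge 0\}$. The Laplacian on $C(X)$ is $\Delta f(x)=\frac{1}{m(x)}\sum_{y\in X}b(x,y)(f(y)-f(x))$. Set $\Gamma_0(f,g)=fg$ and iteratively $2\Gamma_{k+1}(f,g)=\Delta\Gamma_k(f,g)-\Gamma_k(f,\Delta g)-\Gamma_k(\Delta f,g)$ for $f,g\in C(X)$, $k\ge 0$; write $\Gamma_k(f)=\Gamma_k(f,f)$ and $\Gamma=\Gamma_1$. The graph satisfies $CD(K,n)$, $K\in\mathbb{R}$, $n\in(0,\infty]$, if $\Gamma_2(f)\ge\frac1n(\Delta f)^2+K\,\Gamma(f)$ pointwise on $X$ for all $f\in C(X)$, where $1/\infty=0$. $L$ denotes the Friedrichs extension in $\ell^2(X,m)$ of the symmetric positive operator $-\Delta|_{C_c(X)}$, and $P_t=e^{-tL}$, $t\ge0$, is the heat semigroup. It extends to a positive contraction semigroup on every $\ell^p(X,m)$, $p\in[1,\infty]$, given by $P_tf(x)=\sum_{y\in X}p_t(x,y)f(y)m(y)$ with $p_t(x,y)=(P_t1_y)(x)/m(y)$, where $1_y$ is the characteristic function of $\{y\}$.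 *)

theory Defs
  imports "HOL-Analysis.Analysis"
begin

text \<open>
  The vertex set is an arbitrary nonempty countable type. Since the measure \<open>m\<close> is strictly
  positive, elements of \<open>\<ell>\<^sup>2(X,m)\<close> are genuine functions and no quotient is needed.
\<close>

section \<open>Graphs, Laplacian, and curvature dimension condition\<close>

definition locally_finite_graph :: "('a \<Rightarrow> 'a \<Rightarrow> real) \<Rightarrow> bool" where
  "locally_finite_graph b \<longleftrightarrow>
     (\<forall>x y. 0 \<le> b x y) \<and> (\<forall>x y. b x y = b y x) \<and> (\<forall>x. b x x = 0) \<and>
     (\<forall>x. finite {y. 0 < b x y})"

definition ellipticity :: "('a \<Rightarrow> 'a \<Rightarrow> real) \<Rightarrow> ('a \<Rightarrow> real) \<Rightarrow> bool" where
  "ellipticity b m \<longleftrightarrow> (\<exists>C>0. \<forall>x y. b x y \<le> C * m x * m y)"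

definition Cc :: "('a \<Rightarrow> real) set" where
  "Cc = {f. finite {x. f x \<noteq> 0}}"

definition Cc_plus :: "('a \<Rightarrow> real) set" where
  "Cc_plus = {f \<in> Cc. \<forall>x. 0 \<le> f x}"

definition laplacian ::
    "('a \<Rightarrow> 'a \<Rightarrow> real) \<Rightarrow> ('a \<Rightarrow> real) \<Rightarrow> ('a \<Rightarrow> real) \<Rightarrow> 'a \<Rightarrow> real" where
  "laplacian b m f x = 1 / m x * (\<Sum>y | 0 < b x y. b x y * (f y - f x))"

primrec Gam ::
    "('a \<Rightarrow> 'a \<Rightarrow> real) \<Rightarrow> ('a \<Rightarrow> real) \<Rightarrow> nat \<Rightarrow> ('a \<Rightarrow> real) \<Rightarrow> ('a \<Rightarrow> real) \<Rightarrow> 'a \<Rightarrow> real" where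
  "Gam b m 0 = (\<lambda>f g x. f x * g x)"
| "Gam b m (Suc k) = (\<lambda>f g x.
     (laplacian b m (Gam b m k f g) x
       - Gam b m k f (laplacian b m g) x
       - Gam b m k (laplacian b m f) g x) / 2)"

abbreviation Gamma ::
    "('a \<Rightarrow> 'a \<Rightarrow> real) \<Rightarrow> ('a \<Rightarrow> real) \<Rightarrow> ('a \<Rightarrow> real) \<Rightarrow> 'a \<Rightarrow> real" where
  "Gamma b m f \<equiv> Gam b m 1 f f"

text \<open>The number \<open>1/n\<close> for \<open>n \<in> (0,\<infinity>]\<close>; on \<^typ>\<open>ereal\<close> one has \<open>1/\<infinity> = 0\<close>.\<close>

definition inv_dim :: "ereal \<Rightarrow> real" where
  "inv_dim n = real_of_ereal (1 / n)"

definition CD ::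
    "('a \<Rightarrow> 'a \<Rightarrow> real) \<Rightarrow> ('a \<Rightarrow> real) \<Rightarrow> real \<Rightarrow> ereal \<Rightarrow> bool" where
  "CD b m K n \<longleftrightarrow>
     (\<forall>f x. Gam b m 2 f f x \<ge> inv_dim n * (laplacian b m f x)\<^sup>2 + K * Gamma b m f x)"


section \<open>The Hilbert space and the Friedrichs extension\<close>

definition l2 :: "('a \<Rightarrow> real) \<Rightarrow> ('a \<Rightarrow> real) set" where
  "l2 m = {f. (\<lambda>x. (f x)\<^sup>2 * m x) summable_on UNIV}"

definition l2_inner :: "('a \<Rightarrow> real) \<Rightarrow> ('a \<Rightarrow> real) \<Rightarrow> ('a \<Rightarrow> real) \<Rightarrow> real" where
  "l2_inner m f g = (\<Sum>\<^sub>\<infinity>x. f x * g x * m x)"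

definition l2_norm :: "('a \<Rightarrow> real) \<Rightarrow> ('a \<Rightarrow> real) \<Rightarrow> real" where
  "l2_norm m f = sqrt (l2_inner m f f)"

text \<open>
  Let \<open>S\<close> be a symmetric positive operator in \<open>\<ell>\<^sup>2(X,m)\<close> with domain \<open>D\<close>, and let
  \<open>q(u,v) = \<langle>S u, v\<rangle>\<close> for \<open>u, v \<in> D\<close>. The following says that \<open>\<phi>\<close> is a sequence in \<open>D\<close> which
  converges to \<open>f\<close> in \<open>\<ell>\<^sup>2(X,m)\<close> and is Cauchy with respect to \<open>q\<close>. Such sequences define the
  closure of \<open>q\<close>.
\<close>

definition form_approx ::
    "('a \<Rightarrow> real) \<Rightarrow> ('a \<Rightarrow> real) set \<Rightarrow> (('a \<Rightarrow> real) \<Rightarrow> ('a \<Rightarrow> real))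
      \<Rightarrow> (nat \<Rightarrow> 'a \<Rightarrow> real) \<Rightarrow> ('a \<Rightarrow> real) \<Rightarrow> bool" where
  "form_approx m D S \<phi> f \<longleftrightarrow>
     (\<forall>k. \<phi> k \<in> D) \<and> f \<in> l2 m \<and>
     (\<lambda>k. l2_norm m (\<lambda>x. \<phi> k x - f x)) \<longlonglongrightarrow> 0 \<and>
     (\<forall>e>0. \<exists>N. \<forall>j\<ge>N. \<forall>k\<ge>N.
        l2_inner m (S (\<lambda>x. \<phi> j x - \<phi> k x)) (\<lambda>x. \<phi> j x - \<phi> k x) < e)"

definition closed_form_dom ::
    "('a \<Rightarrow> real) \<Rightarrow> ('a \<Rightarrow> real) set \<Rightarrow> (('a \<Rightarrow> real) \<Rightarrow> ('a \<Rightarrow> real)) \<Rightarrow> ('a \<Rightarrow> real) set" where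
  "closed_form_dom m D S = {f. \<exists>\<phi>. form_approx m D S \<phi> f}"

definition closed_form ::
    "('a \<Rightarrow> real) \<Rightarrow> ('a \<Rightarrow> real) set \<Rightarrow> (('a \<Rightarrow> real) \<Rightarrow> ('a \<Rightarrow> real))
      \<Rightarrow> ('a \<Rightarrow> real) \<Rightarrow> ('a \<Rightarrow> real) \<Rightarrow> real" where
  "closed_form m D S f g =
     (THE c. \<forall>\<phi> \<psi>. form_approx m D S \<phi> f \<longrightarrow> form_approx m D S \<psi> g \<longrightarrow>
        (\<lambda>k. l2_inner m (S (\<phi> k)) (\<psi> k)) \<longlonglongrightarrow> c)"

text \<open>
  The Friedrichs extension of \<open>S\<close>, the self-adjoint operator associated with the closure of
  \<open>q\<close>, given by its graph.
\<close>

definition friedrichs_extension ::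
    "('a \<Rightarrow> real) \<Rightarrow> ('a \<Rightarrow> real) set \<Rightarrow> (('a \<Rightarrow> real) \<Rightarrow> ('a \<Rightarrow> real))
      \<Rightarrow> (('a \<Rightarrow> real) \<times> ('a \<Rightarrow> real)) set" where
  "friedrichs_extension m D S =
     {(f, h). f \<in> closed_form_dom m D S \<and> h \<in> l2 m \<and>
        (\<forall>g \<in> closed_form_dom m D S. closed_form m D S f g = l2_inner m h g)}"

definition graph_operator ::
    "('a \<Rightarrow> 'a \<Rightarrow> real) \<Rightarrow> ('a \<Rightarrow> real) \<Rightarrow> (('a \<Rightarrow> real) \<times> ('a \<Rightarrow> real)) set" where
  "graph_operator b m = friedrichs_extension m Cc (\<lambda>f x. - laplacian b m f x)"


section \<open>The heat semigroup\<close>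

definition C0_semigroup ::
    "('a \<Rightarrow> real) \<Rightarrow> (real \<Rightarrow> ('a \<Rightarrow> real) \<Rightarrow> ('a \<Rightarrow> real)) \<Rightarrow> bool" where
  "C0_semigroup m T \<longleftrightarrow>
     (\<forall>t\<ge>0. \<forall>f\<in>l2 m. T t f \<in> l2 m) \<and>
     (\<forall>t\<ge>0. \<forall>f\<in>l2 m. \<forall>g\<in>l2 m. \<forall>\<alpha> \<beta>.
        T t (\<lambda>x. \<alpha> * f x + \<beta> * g x) = (\<lambda>x. \<alpha> * T t f x + \<beta> * T t g x)) \<and>
     (\<forall>t\<ge>0. \<exists>M. \<forall>f\<in>l2 m. l2_norm m (T t f) \<le> M * l2_norm m f) \<and>
     (\<forall>f\<in>l2 m. T 0 f = f) \<and>
     (\<forall>s\<ge>0. \<forall>t\<ge>0. \<forall>f\<in>l2 m. T (s + t) f = T s (T t f)) \<and>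
     (\<forall>f\<in>l2 m. ((\<lambda>t. l2_norm m (\<lambda>x. T t f x - f x)) \<longlongrightarrow> 0) (at_right 0))"

definition semigroup_generator ::
    "('a \<Rightarrow> real) \<Rightarrow> (real \<Rightarrow> ('a \<Rightarrow> real) \<Rightarrow> ('a \<Rightarrow> real))
      \<Rightarrow> (('a \<Rightarrow> real) \<times> ('a \<Rightarrow> real)) set" where
  "semigroup_generator m T =
     {(f, h). f \<in> l2 m \<and> h \<in> l2 m \<and>
        ((\<lambda>t. l2_norm m (\<lambda>x. (T t f x - f x) / t - h x)) \<longlongrightarrow> 0) (at_right 0)}"

text \<open>
  The semigroup \<open>e\<^bsup>-tL\<^esup>\<close> is the strongly continuous semigroup on \<open>\<ell>\<^sup>2(X,m)\<close> with generator
  \<open>-L\<close>. A strongly continuous semigroup is determined by its generator, so the choice below is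
  unique for \<open>t \<ge> 0\<close> on \<open>\<ell>\<^sup>2(X,m)\<close>; its values elsewhere are never used.
\<close>

definition heat_l2 ::
    "('a \<Rightarrow> 'a \<Rightarrow> real) \<Rightarrow> ('a \<Rightarrow> real) \<Rightarrow> real \<Rightarrow> ('a \<Rightarrow> real) \<Rightarrow> ('a \<Rightarrow> real)" where
  "heat_l2 b m =
     (SOME T. C0_semigroup m T \<and>
        semigroup_generator m T = {(f, \<lambda>x. - h x) | f h. (f, h) \<in> graph_operator b m})"

definition heat_kernel ::
    "('a \<Rightarrow> 'a \<Rightarrow> real) \<Rightarrow> ('a \<Rightarrow> real) \<Rightarrow> real \<Rightarrow> 'a \<Rightarrow> 'a \<Rightarrow> real" where
  "heat_kernel b m t x y = heat_l2 b m t (indicator {y}) x / m y"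

definition heat ::
    "('a \<Rightarrow> 'a \<Rightarrow> real) \<Rightarrow> ('a \<Rightarrow> real) \<Rightarrow> real \<Rightarrow> ('a \<Rightarrow> real) \<Rightarrow> 'a \<Rightarrow> real" where
  "heat b m t f x = (\<Sum>\<^sub>\<infinity>y. heat_kernel b m t x y * f y * m y)"

end

(*
  By ellipticity every function of finite energy is a limit of finitely supported ones in the form
  norm, so the Friedrichs extension is minus the Laplacian on the functions f of finite energy with
  Laplacian in l2. Its semigroup is the minimal heat semigroup: exponentials of the Laplacian with
  absorption outside finite sets increase to a kernel p, which defines a contraction semigroup T.
  Fatou's lemma for <f - T_h f, f> / h and a mean value inequality identify its generator, and a
  strongly continuous semigroup is determined by a symmetric generator. Hence heat = T.

  Ellipticity also bounds p_s(x,y) times the weighted degree of y, uniformly in s and y. Therefore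
  T_s g_s (x) can be differentiated in s, for summable g_s and in integrated form, with derivative
  T_s (Delta g_s + dg_s/ds)(x). With u_s = T_(t-s) f this gives derivative 2 T_s Gamma(u_s) for
  T_s (u_s^2) and 2 exp(2Ks) T_s (Gamma_2(u_s) + K Gamma(u_s)) for exp(2Ks) T_s Gamma(u_s). Under
  CD(-K,n) the estimates follow by integration. Conversely, CD(-K,n) is read off from the first or
  second derivative of the estimates at t = 0, as it is local and invariant under adding constants.
*)
theory Submission imports Defs begin

section \<open>Weighted square summable functions\<close>

text \<open>The weighted degree may be unbounded. Then the Laplacian is unbounded on l2, the product
  rule along the semigroup has to be justified, and Gamma_2(u_s) is not known to be summable by
  itself. Two facts replace boundedness. For finitely supported f the energy of T_t f stays below
  the product of the norms of L f and f, which bounds the total mass of Gamma(T_t f) for all times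
  at once. And the Laplacian of p_s(x,.) is, up to the factor m(x), the function T_s(L 1_x), which
  is bounded because L 1_x has finite support; ellipticity bounds its neighbour part, and what
  remains is degree times kernel. So L of a summable function can be paired with p_s(x,.), and
  Gamma_2 enters only through L Gamma(u) - 2 Gamma(u, L u). Differentiation takes place on finite
  partial sums, which are integrated in time before passing to the limit. The choice operator in
  \<open>heat_l2\<close> reveals nothing but the generator, so existence and uniqueness of such a
  semigroup come first. The coefficients of the estimates are iterated integrals of 2
  exp(2Ks).\<close>

lemma infsum_dominated_convergence:
  fixes f :: "nat \<Rightarrow> 'a \<Rightarrow> real"
  assumes "g summable_on UNIV" "\<And>k x. \<bar>f k x\<bar> \<le> g x" "\<And>x. (\<lambda>k. f k x) \<longlonglongrightarrow> h x"
  shows "h summable_on UNIV" "(\<lambda>k. infsum (f k) UNIV) \<longlonglongrightarrow> infsum h UNIV"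
proof -
  have g0: "0 \<le> g x" for x using assms(2)[of 0 x] by linarith
  have gabs: "(\<lambda>x. norm (g x)) summable_on UNIV" using assms(1) g0 by simp
  have fabs: "(\<lambda>x. norm (f k x)) summable_on UNIV" for k
    using Infinite_Sum.abs_summable_on_comparison_test[OF gabs, of "f k"] assms(2) g0 by auto
  have hle: "\<bar>h x\<bar> \<le> g x" for x
    using assms(2,3) by (intro LIMSEQ_le_const2[OF tendsto_rabs[OF assms(3)]]) auto
  have habs: "(\<lambda>x. norm (h x)) summable_on UNIV"
    using Infinite_Sum.abs_summable_on_comparison_test[OF gabs, of h] hle g0 by auto
  \<comment> \<open>Absolute summability is integrability for the counting measure, so Lebesgue's
    theorem applies and is translated back.\<close>
  have ig: "integrable (count_space UNIV) g"
    using gabs unfolding abs_summable_equivalent abs_summable_on_def .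
  from habs show "h summable_on UNIV" by (rule abs_summable_summable)
  have "(\<lambda>k. integral\<^sup>L (count_space UNIV) (f k)) \<longlonglongrightarrow> integral\<^sup>L (count_space UNIV) h"
    using ig assms(2,3) by (intro integral_dominated_convergence[where w=g]) auto
  moreover have "integral\<^sup>L (count_space UNIV) h = infsum h UNIV"
    using infsetsum_infsum[of h UNIV] habs unfolding abs_summable_equivalent infsetsum_def by simp
  moreover have "integral\<^sup>L (count_space UNIV) (f k) = infsum (f k) UNIV" for k
    using infsetsum_infsum[of "f k" UNIV] fabs[of k] unfolding abs_summable_equivalent infsetsum_def by simp
  ultimately show "(\<lambda>k. infsum (f k) UNIV) \<longlonglongrightarrow> infsum h UNIV" by simp
qed

text \<open>The weight may vanish, so \<open>l2_norm\<close> is only a seminorm here. One calculus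
  then serves functions with weight \<open>m\<close>, gradients with weight
  \<open>case_prod b\<close> on ordered pairs, and functions against a row \<open>q t x\<close> of
  transition probabilities.\<close>

locale weight =
  fixes w :: "'b \<Rightarrow> real"
  assumes w_nonneg: "0 \<le> w x"
begin

lemma l2_prod_abs_summable:
  assumes "f \<in> l2 w" "g \<in> l2 w"
  shows "(\<lambda>x. \<bar>f x\<bar> * \<bar>g x\<bar> * w x) summable_on UNIV"
proof (rule summable_on_comparison_test)
  show "(\<lambda>x. (f x)\<^sup>2 * w x + (g x)\<^sup>2 * w x) summable_on UNIV"
    using assms by (auto simp: l2_def intro: summable_on_add)
  show "\<bar>f x\<bar> * \<bar>g x\<bar> * w x \<le> (f x)\<^sup>2 * w x + (g x)\<^sup>2 * w x" for x
  proof -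
    have "2 * (\<bar>f x\<bar> * \<bar>g x\<bar>) \<le> (f x)\<^sup>2 + (g x)\<^sup>2"
      using sum_squares_bound[of "\<bar>f x\<bar>" "\<bar>g x\<bar>"] by (simp add: mult.assoc)
    moreover have "0 \<le> \<bar>f x\<bar> * \<bar>g x\<bar>" by simp
    ultimately have "\<bar>f x\<bar> * \<bar>g x\<bar> \<le> (f x)\<^sup>2 + (g x)\<^sup>2" by linarith
    then show ?thesis using w_nonneg[of x] by (metis distrib_right mult_right_mono)
  qed
qed (use w_nonneg in auto)

lemma l2_prod_summable:
  assumes "f \<in> l2 w" "g \<in> l2 w"
  shows "(\<lambda>x. f x * g x * w x) summable_on UNIV"
  using abs_summable_summable[of "\<lambda>x. f x * g x * w x" UNIV] l2_prod_abs_summable[OF assms]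
  by (simp add: abs_mult w_nonneg)

lemma l2_dominated:
  assumes "g \<in> l2 w" "\<And>x. \<bar>f x\<bar> \<le> \<bar>g x\<bar>"
  shows "f \<in> l2 w"
  unfolding l2_def mem_Collect_eq
proof (rule summable_on_comparison_test)
  show "(\<lambda>x. (g x)\<^sup>2 * w x) summable_on UNIV" using assms by (auto simp: l2_def)
  show "(f x)\<^sup>2 * w x \<le> (g x)\<^sup>2 * w x" for x
    using assms(2)[of x] w_nonneg by (intro mult_right_mono) (simp_all add: abs_le_square_iff)
qed (use w_nonneg in auto)

lemma l2_scale: "f \<in> l2 w \<Longrightarrow> (\<lambda>x. c * f x) \<in> l2 w"
  unfolding l2_def by (auto simp: power_mult_distrib mult.assoc intro: summable_on_cmult_right)

lemma l2_add:
  assumes "f \<in> l2 w" "g \<in> l2 w"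
  shows "(\<lambda>x. f x + g x) \<in> l2 w"
proof -
  have "(\<lambda>x. (f x)\<^sup>2 * w x + (g x)\<^sup>2 * w x + 2 * (f x * g x * w x)) summable_on UNIV"
    using assms l2_prod_summable[OF assms]
    by (intro summable_on_add summable_on_cmult_right) (auto simp: l2_def)
  then show ?thesis by (simp add: l2_def power2_sum algebra_simps)
qed

lemma l2_minus: "f \<in> l2 w \<Longrightarrow> (\<lambda>x. - f x) \<in> l2 w"
  using l2_scale[of f "-1"] by simp

lemma l2_diff: "f \<in> l2 w \<Longrightarrow> g \<in> l2 w \<Longrightarrow> (\<lambda>x. f x - g x) \<in> l2 w"
  using l2_add[OF _ l2_minus, of f g] by simp

lemma l2_zero: "(\<lambda>x. 0) \<in> l2 w" by (simp add: l2_def)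

lemma l2_inner_commute: "l2_inner w f g = l2_inner w g f"
  by (simp add: l2_inner_def mult.commute mult.left_commute)

lemma l2_inner_add_left:
  assumes "f \<in> l2 w" "g \<in> l2 w" "h \<in> l2 w"
  shows "l2_inner w (\<lambda>x. f x + g x) h = l2_inner w f h + l2_inner w g h"
  unfolding l2_inner_def distrib_right
  using assms by (intro infsum_add l2_prod_summable)

lemma l2_inner_scale_left: "l2_inner w (\<lambda>x. c * f x) h = c * l2_inner w f h"
  unfolding l2_inner_def mult.assoc by (rule infsum_cmult_right')

lemma l2_inner_minus_left: "l2_inner w (\<lambda>x. - f x) h = - l2_inner w f h"
  using l2_inner_scale_left[of "-1"] by simp

lemma l2_inner_diff_left:
  assumes "f \<in> l2 w" "g \<in> l2 w" "h \<in> l2 w"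
  shows "l2_inner w (\<lambda>x. f x - g x) h = l2_inner w f h - l2_inner w g h"
  using l2_inner_add_left[OF assms(1) l2_minus[OF assms(2)] assms(3)]
  by (simp add: l2_inner_minus_left)

lemma l2_inner_add_right:
  assumes "f \<in> l2 w" "g \<in> l2 w" "h \<in> l2 w"
  shows "l2_inner w h (\<lambda>x. f x + g x) = l2_inner w h f + l2_inner w h g"
  using l2_inner_add_left[OF assms] by (simp add: l2_inner_commute[of h])

lemma l2_inner_scale_right: "l2_inner w h (\<lambda>x. c * f x) = c * l2_inner w h f"
  using l2_inner_scale_left[of c f h] by (simp add: l2_inner_commute[of h])

lemma l2_inner_diff_right:
  assumes "f \<in> l2 w" "g \<in> l2 w" "h \<in> l2 w"
  shows "l2_inner w h (\<lambda>x. f x - g x) = l2_inner w h f - l2_inner w h g"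
  using l2_inner_diff_left[OF assms] by (simp add: l2_inner_commute[of h])

lemma l2_inner_self_nonneg: "0 \<le> l2_inner w f f"
  unfolding l2_inner_def by (rule infsum_nonneg) (simp add: w_nonneg)

lemma l2_norm_nonneg: "0 \<le> l2_norm w f"
  by (simp add: l2_norm_def l2_inner_self_nonneg)

lemma l2_norm_sq: "(l2_norm w f)\<^sup>2 = l2_inner w f f"
  by (simp add: l2_norm_def l2_inner_self_nonneg)

lemma l2_norm_scale: "l2_norm w (\<lambda>x. c * f x) = \<bar>c\<bar> * l2_norm w f"
proof -
  have "l2_inner w (\<lambda>x. c * f x) (\<lambda>x. c * f x) = c\<^sup>2 * l2_inner w f f"
    by (simp add: l2_inner_scale_left l2_inner_scale_right power2_eq_square)
  then show ?thesis by (simp add: l2_norm_def real_sqrt_mult)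
qed

lemma l2_norm_minus: "l2_norm w (\<lambda>x. - f x) = l2_norm w f"
  using l2_norm_scale[of "-1" f] by simp

lemma l2_norm_diff_commute: "l2_norm w (\<lambda>x. f x - g x) = l2_norm w (\<lambda>x. g x - f x)"
  using l2_norm_minus[of "\<lambda>x. f x - g x"] by simp

lemma l2_norm_zero: "l2_norm w (\<lambda>x. 0) = 0"
  by (simp add: l2_norm_def l2_inner_def)

lemma l2_cauchy_schwarz:
  assumes "f \<in> l2 w" "g \<in> l2 w"
  shows "\<bar>l2_inner w f g\<bar> \<le> l2_norm w f * l2_norm w g"
proof -
  have q: "0 \<le> l2_inner w f f + 2 * t * l2_inner w f g + t\<^sup>2 * l2_inner w g g" for t
  proof -
    have "l2_inner w (\<lambda>x. f x + t * g x) (\<lambda>x. f x + t * g x)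
      = l2_inner w f f + 2 * t * l2_inner w f g + t\<^sup>2 * l2_inner w g g"
      using assms l2_scale[OF assms(2), of t] l2_add[OF assms(1) l2_scale[OF assms(2), of t]]
      by (simp add: l2_inner_add_left l2_inner_add_right l2_inner_scale_left l2_inner_scale_right
          power2_eq_square l2_inner_commute[of g f] algebra_simps)
    then show ?thesis using l2_inner_self_nonneg[of "\<lambda>x. f x + t * g x"] by simp
  qed
  let ?a = "l2_inner w f f" and ?b = "l2_inner w f g" and ?c = "l2_inner w g g"
  have "?b\<^sup>2 \<le> ?a * ?c"
  proof (cases "?c = 0")
    case True
    have "?b = 0"
    proof (rule ccontr)
      assume "?b \<noteq> 0"
      \<comment> \<open>With \<open>?c = 0\<close> the quadratic is affine in t, and this t gives it
        the value -1.\<close>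
      then have "?a + 2 * (- (?a + 1) / (2 * ?b)) * ?b = - 1" by (simp add: field_simps)
      then show False using q[of "- (?a + 1) / (2 * ?b)"] True by simp
    qed
    then show ?thesis using True by simp
  next
    case False
    then have c: "?c > 0" using l2_inner_self_nonneg[of g] by simp
    have "0 \<le> ?a - ?b\<^sup>2 / ?c"
      using q[of "- ?b / ?c"] c by (simp add: field_simps power2_eq_square)
    then show ?thesis using c by (simp add: field_simps)
  qed
  then have "\<bar>?b\<bar> \<le> sqrt (?a * ?c)" by (metis real_sqrt_abs real_sqrt_le_iff)
  then show ?thesis by (simp add: l2_norm_def real_sqrt_mult)
qed

lemma l2_norm_triangle:
  assumes "f \<in> l2 w" "g \<in> l2 w"
  shows "l2_norm w (\<lambda>x. f x + g x) \<le> l2_norm w f + l2_norm w g"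
proof -
  have "(l2_norm w (\<lambda>x. f x + g x))\<^sup>2 = l2_inner w f f + 2 * l2_inner w f g + l2_inner w g g"
    using assms l2_add[OF assms] by (simp add: l2_norm_sq l2_inner_add_left l2_inner_add_right
          l2_inner_commute[of g f])
  also have "\<dots> \<le> (l2_norm w f)\<^sup>2 + 2 * (l2_norm w f * l2_norm w g) + (l2_norm w g)\<^sup>2"
    using l2_cauchy_schwarz[OF assms] by (simp add: l2_norm_sq)
  also have "\<dots> = (l2_norm w f + l2_norm w g)\<^sup>2" by (simp add: power2_sum)
  finally show ?thesis by (rule power2_le_imp_le) (intro add_nonneg_nonneg l2_norm_nonneg)
qed

lemma l2_norm_triangle_diff:
  assumes "f \<in> l2 w" "g \<in> l2 w"
  shows "l2_norm w (\<lambda>x. f x - g x) \<le> l2_norm w f + l2_norm w g"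
  using l2_norm_triangle[OF assms(1) l2_minus[OF assms(2)]] by (simp add: l2_norm_minus)

lemma l2_norm_diff_trans:
  assumes "f \<in> l2 w" "g \<in> l2 w" "h \<in> l2 w"
  shows "l2_norm w (\<lambda>x. f x - h x) \<le> l2_norm w (\<lambda>x. f x - g x) + l2_norm w (\<lambda>x. g x - h x)"
  using l2_norm_triangle[OF l2_diff[OF assms(1,2)] l2_diff[OF assms(2,3)]] by simp

lemma l2_finite_support: "finite {x. f x \<noteq> 0} \<Longrightarrow> f \<in> l2 w"
  unfolding l2_def mem_Collect_eq
  by (rule finite_nonzero_values_imp_summable_on) (auto elim: finite_subset[rotated])

lemma l2_inner_finite_support:
  assumes "finite G" "\<And>x. x \<notin> G \<Longrightarrow> f x = 0"
  shows "l2_inner w f g = (\<Sum>x\<in>G. f x * g x * w x)"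
proof -
  have "l2_inner w f g = infsum (\<lambda>x. f x * g x * w x) G"
    unfolding l2_inner_def using assms by (intro infsum_cong_neutral) auto
  then show ?thesis using assms by simp
qed

lemma l2_sum_le:
  assumes "f \<in> l2 w" "finite G"
  shows "(\<Sum>x\<in>G. (f x)\<^sup>2 * w x) \<le> (l2_norm w f)\<^sup>2"
  unfolding l2_norm_sq l2_inner_def power2_eq_square[symmetric]
  using assms w_nonneg by (intro finite_sum_le_infsum) (auto simp: l2_def)

lemma l2_boundI:
  assumes "\<And>G. finite G \<Longrightarrow> (\<Sum>x\<in>G. (f x)\<^sup>2 * w x) \<le> B\<^sup>2" "0 \<le> B"
  shows "f \<in> l2 w" "l2_norm w f \<le> B"
proof -
  have s: "(\<lambda>x. (f x)\<^sup>2 * w x) summable_on UNIV"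
    using assms w_nonneg by (intro nonneg_bdd_above_summable_on bdd_aboveI2[where M="B\<^sup>2"]) auto
  then show "f \<in> l2 w" by (simp add: l2_def)
  have "l2_inner w f f \<le> B\<^sup>2"
    unfolding l2_inner_def power2_eq_square[symmetric]
    using s assms by (intro infsum_le_finite_sums) auto
  then show "l2_norm w f \<le> B" using assms(2)
    by (metis l2_norm_sq power2_le_imp_le)
qed

text \<open>Finite partial sums are continuous under pointwise convergence, so a common bound
  survives. This is how limits acquire finite norm or finite energy.\<close>

lemma l2_fatou:
  assumes "\<And>k. f k \<in> l2 w" "\<And>x. (\<lambda>k. f k x) \<longlonglongrightarrow> g x" "\<And>k. l2_norm w (f k) \<le> B"
  shows "g \<in> l2 w" "l2_norm w g \<le> B"
proof -
  have B: "0 \<le> B" using assms(3)[of 0] l2_norm_nonneg[of "f 0"] by linarith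
  have "(\<Sum>x\<in>G. (g x)\<^sup>2 * w x) \<le> B\<^sup>2" if "finite G" for G
  proof (rule LIMSEQ_le_const2)
    show "(\<lambda>k. \<Sum>x\<in>G. (f k x)\<^sup>2 * w x) \<longlonglongrightarrow> (\<Sum>x\<in>G. (g x)\<^sup>2 * w x)"
      by (intro tendsto_intros assms)
    show "\<exists>N. \<forall>n\<ge>N. (\<Sum>x\<in>G. (f n x)\<^sup>2 * w x) \<le> B\<^sup>2"
      using order_trans[OF l2_sum_le[OF assms(1) that] power_mono[OF assms(3) l2_norm_nonneg]] by blast
  qed
  from l2_boundI[OF this B] show "g \<in> l2 w" "l2_norm w g \<le> B" by auto
qed

lemma l2_dominated_convergence:
  assumes "g \<in> l2 w" "\<And>k x. \<bar>f k x\<bar> \<le> \<bar>g x\<bar>" "\<And>x. (\<lambda>k. f k x) \<longlonglongrightarrow> 0"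
  shows "(\<lambda>k. l2_norm w (f k)) \<longlonglongrightarrow> 0"
proof -
  have "(\<lambda>k. infsum (\<lambda>x. (f k x)\<^sup>2 * w x) UNIV) \<longlonglongrightarrow> infsum (\<lambda>x. 0\<^sup>2 * w x) UNIV"
  proof (rule infsum_dominated_convergence(2))
    show "(\<lambda>x. (g x)\<^sup>2 * w x) summable_on UNIV" using assms by (simp add: l2_def)
    show "\<bar>(f k x)\<^sup>2 * w x\<bar> \<le> (g x)\<^sup>2 * w x" for k x
      using assms(2)[of k x] w_nonneg by (simp add: abs_mult mult_right_mono abs_le_square_iff)
    show "(\<lambda>k. (f k x)\<^sup>2 * w x) \<longlonglongrightarrow> 0\<^sup>2 * w x" for x by (intro tendsto_intros assms)
  qed
  then have "(\<lambda>k. l2_inner w (f k) (f k)) \<longlonglongrightarrow> 0"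
    by (simp add: l2_inner_def power2_eq_square)
  from tendsto_real_sqrt[OF this] show ?thesis by (simp add: l2_norm_def)
qed

text \<open>A mean value inequality for curves that are differentiable pointwise: it suffices to test
  against the increment itself, cut off to a finite set.\<close>

lemma l2_mean_value:
  assumes d: "\<And>s x. 0 \<le> s \<Longrightarrow> s \<le> t \<Longrightarrow> ((\<lambda>s. v s x) has_real_derivative v' s x) (at s within {0..t})"
    and l: "\<And>s. 0 \<le> s \<Longrightarrow> s \<le> t \<Longrightarrow> v' s \<in> l2 w"
    and B: "\<And>s. 0 \<le> s \<Longrightarrow> s \<le> t \<Longrightarrow> l2_norm w (v' s) \<le> B"
    and t: "0 \<le> t"
  shows "(\<lambda>x. v t x - v 0 x) \<in> l2 w" "l2_norm w (\<lambda>x. v t x - v 0 x) \<le> t * B"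
proof -
  have B0: "0 \<le> B" using B[of 0] t l2_norm_nonneg[of "v' 0"] by linarith
  have "(\<Sum>x\<in>G. (v t x - v 0 x)\<^sup>2 * w x) \<le> (t * B)\<^sup>2" if "finite G" for G
  proof -
    define \<psi> where "\<psi> x = (if x \<in> G then v t x - v 0 x else 0)" for x
    have \<psi>: "\<psi> \<in> l2 w" using that by (intro l2_finite_support) (auto simp: \<psi>_def)
    let ?\<phi> = "\<lambda>s. \<Sum>x\<in>G. \<psi> x * v s x * w x"
    have N: "(l2_norm w \<psi>)\<^sup>2 = (\<Sum>x\<in>G. (v t x - v 0 x)\<^sup>2 * w x)"
      unfolding l2_norm_sq using that
      by (subst l2_inner_finite_support[of G]) (auto simp: \<psi>_def power2_eq_square)
    have "\<bar>?\<phi> t - ?\<phi> 0\<bar> \<le> (l2_norm w \<psi> * B) * \<bar>t - 0\<bar>"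
      unfolding real_norm_def[symmetric]
    proof (rule field_differentiable_bound[where S="{0..t}" and f'="\<lambda>s. \<Sum>x\<in>G. \<psi> x * v' s x * w x"])
      fix s assume s: "s \<in> {0..t}"
      then show "(?\<phi> has_field_derivative (\<Sum>x\<in>G. \<psi> x * v' s x * w x)) (at s within {0..t})"
        by (intro DERIV_sum) (auto intro!: derivative_eq_intros d)
      have "(\<Sum>x\<in>G. \<psi> x * v' s x * w x) = l2_inner w \<psi> (v' s)"
        using that by (subst l2_inner_finite_support[of G]) (auto simp: \<psi>_def)
      moreover have "\<bar>l2_inner w \<psi> (v' s)\<bar> \<le> l2_norm w \<psi> * l2_norm w (v' s)"
        using s by (intro l2_cauchy_schwarz \<psi> l) auto
      moreover have "l2_norm w \<psi> * l2_norm w (v' s) \<le> l2_norm w \<psi> * B"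
        using s by (intro mult_left_mono B l2_norm_nonneg) auto
      ultimately show "norm (\<Sum>x\<in>G. \<psi> x * v' s x * w x) \<le> l2_norm w \<psi> * B" by simp
    qed (use t in auto)
    moreover have "?\<phi> t - ?\<phi> 0 = (l2_norm w \<psi>)\<^sup>2"
      unfolding N sum_subtractf[symmetric] by (rule sum.cong) (auto simp: \<psi>_def power2_eq_square algebra_simps)
    ultimately have "l2_norm w \<psi> * l2_norm w \<psi> \<le> l2_norm w \<psi> * (t * B)"
      using t by (simp add: power2_eq_square mult_ac)
    then have "l2_norm w \<psi> \<le> t * B"
      using B0 t l2_norm_nonneg[of \<psi>] by (cases "l2_norm w \<psi> = 0") simp_all
    then show ?thesis unfolding N[symmetric] by (simp add: power_mono l2_norm_nonneg)
  qed
  from l2_boundI[OF this] show "(\<lambda>x. v t x - v 0 x) \<in> l2 w" "l2_norm w (\<lambda>x. v t x - v 0 x) \<le> t * B"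
    using t B0 by auto
qed

lemma l2_inner_tendsto:
  fixes f g :: "nat \<Rightarrow> 'b \<Rightarrow> real"
  assumes "\<And>k. f k \<in> l2 w" "f' \<in> l2 w" "(\<lambda>k. l2_norm w (\<lambda>x. f k x - f' x)) \<longlonglongrightarrow> 0"
    and "\<And>k. g k \<in> l2 w" "g' \<in> l2 w" "(\<lambda>k. l2_norm w (\<lambda>x. g k x - g' x)) \<longlonglongrightarrow> 0"
  shows "(\<lambda>k. l2_inner w (f k) (g k)) \<longlonglongrightarrow> l2_inner w f' g'"
proof (rule LIM_zero_cancel, rule Lim_null_comparison)
  let ?a = "\<lambda>k. l2_norm w (\<lambda>x. f k x - f' x)" and ?b = "\<lambda>k. l2_norm w (\<lambda>x. g k x - g' x)"
  show "(\<lambda>k. ?a k * ?b k + ?a k * l2_norm w g' + l2_norm w f' * ?b k) \<longlonglongrightarrow> 0"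
    by (rule tendsto_eq_intros assms refl | simp)+
  have "\<bar>l2_inner w (f k) (g k) - l2_inner w f' g'\<bar>
      \<le> ?a k * ?b k + ?a k * l2_norm w g' + l2_norm w f' * ?b k" for k
  proof -
    let ?u = "\<lambda>x. f k x - f' x" and ?v = "\<lambda>x. g k x - g' x"
    have l: "?u \<in> l2 w" "?v \<in> l2 w" using assms by (auto intro: l2_diff)
    have "l2_inner w (f k) (g k) - l2_inner w f' g'
        = l2_inner w ?u ?v + l2_inner w ?u g' + l2_inner w f' ?v"
      using assms l by (simp add: l2_inner_diff_left l2_inner_diff_right)
    then show ?thesis
      using l2_cauchy_schwarz[OF l] l2_cauchy_schwarz[OF l(1) assms(5)] l2_cauchy_schwarz[OF assms(2) l(2)]
      by linarith
  qed
  then show "\<forall>\<^sub>F k in sequentially. norm (l2_inner w (f k) (g k) - l2_inner w f' g')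
      \<le> ?a k * ?b k + ?a k * l2_norm w g' + l2_norm w f' * ?b k" by simp
qed

end

section \<open>Strictly positive weights: point evaluation and completeness\<close>

locale pos_weight = weight w for w :: "'b \<Rightarrow> real" +
  assumes w_pos: "0 < w x"
begin

text \<open>A single term of the norm sum controls the value at x; hence norm limits are pointwise
  limits.\<close>

lemma l2_pointwise_bound:
  assumes "f \<in> l2 w" shows "\<bar>f x\<bar> \<le> l2_norm w f / sqrt (w x)"
proof -
  have "(f x)\<^sup>2 * w x \<le> (l2_norm w f)\<^sup>2" using l2_sum_le[OF assms, of "{x}"] by simp
  then have "sqrt ((f x)\<^sup>2 * w x) \<le> l2_norm w f"
    using real_sqrt_le_mono[of _ "(l2_norm w f)\<^sup>2"] l2_norm_nonneg[of f] by simp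
  then show ?thesis using w_pos[of x] by (simp add: real_sqrt_mult field_simps)
qed

lemma l2_tendsto_pointwise:
  assumes "\<And>k. f k \<in> l2 w" "g \<in> l2 w" "(\<lambda>k. l2_norm w (\<lambda>x. f k x - g x)) \<longlonglongrightarrow> 0"
  shows "(\<lambda>k. f k x) \<longlonglongrightarrow> g x"
proof (rule LIM_zero_cancel, rule Lim_null_comparison)
  show "\<forall>\<^sub>F k in sequentially. norm (f k x - g x) \<le> l2_norm w (\<lambda>x. f k x - g x) / sqrt (w x)"
    using l2_pointwise_bound[OF l2_diff[OF assms(1,2)]] by auto
  show "(\<lambda>k. l2_norm w (\<lambda>x. f k x - g x) / sqrt (w x)) \<longlonglongrightarrow> 0"
    using tendsto_divide[OF assms(3) tendsto_const, of "sqrt (w x)"] w_pos[of x] by simp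
qed

text \<open>The limit is taken pointwise. Fatou, applied to \<open>f k - f j\<close> as j grows,
  turns the Cauchy bound into norm convergence.\<close>

lemma l2_complete:
  fixes f :: "nat \<Rightarrow> 'b \<Rightarrow> real"
  assumes "\<And>k. f k \<in> l2 w"
    and "\<And>e. 0 < e \<Longrightarrow> \<exists>N. \<forall>j\<ge>N. \<forall>k\<ge>N. l2_norm w (\<lambda>x. f j x - f k x) \<le> e"
  obtains g where "g \<in> l2 w" "\<And>e. 0 < e \<Longrightarrow> \<exists>N. \<forall>k\<ge>N. l2_norm w (\<lambda>x. f k x - g x) \<le> e"
proof -
  have "Cauchy (\<lambda>k. f k x)" for x
  proof (rule metric_CauchyI)
    fix e :: real assume e: "0 < e"
    obtain N where N: "\<forall>j\<ge>N. \<forall>k\<ge>N. l2_norm w (\<lambda>x. f j x - f k x) \<le> e / 2 * sqrt (w x)"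
      using assms(2)[of "e / 2 * sqrt (w x)"] e w_pos[of x] by auto
    have "dist (f j x) (f k x) < e" if "N \<le> j" "N \<le> k" for j k
    proof -
      have "\<bar>f j x - f k x\<bar> \<le> l2_norm w (\<lambda>x. f j x - f k x) / sqrt (w x)"
        by (rule l2_pointwise_bound) (intro l2_diff assms)
      also have "\<dots> \<le> e / 2" using N that w_pos[of x] by (simp add: field_simps)
      finally show ?thesis using e by (simp add: dist_real_def)
    qed
    then show "\<exists>M. \<forall>m\<ge>M. \<forall>n\<ge>M. dist (f m x) (f n x) < e" by blast
  qed
  then have "\<forall>x. \<exists>l. (\<lambda>k. f k x) \<longlonglongrightarrow> l" using Cauchy_convergent convergent_def by blast
  then obtain g where g: "\<And>x. (\<lambda>k. f k x) \<longlonglongrightarrow> g x" by metis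
  have est: "(\<lambda>x. f k x - g x) \<in> l2 w \<and> l2_norm w (\<lambda>x. f k x - g x) \<le> e"
    if "\<forall>j\<ge>N. \<forall>k\<ge>N. l2_norm w (\<lambda>x. f j x - f k x) \<le> e" "N \<le> k" for N e k
  proof -
    have "(\<lambda>j. f k x - f (j + N) x) \<longlonglongrightarrow> f k x - g x" for x
      by (intro tendsto_intros LIMSEQ_ignore_initial_segment g)
    from l2_fatou[of "\<lambda>j x. f k x - f (j + N) x", OF _ this, of e] show ?thesis
      using that assms(1) by (auto intro: l2_diff)
  qed
  obtain N where "\<forall>j\<ge>N. \<forall>k\<ge>N. l2_norm w (\<lambda>x. f j x - f k x) \<le> 1" using assms(2)[of 1] by auto
  from est[OF this order_refl] have "(\<lambda>x. f N x - g x) \<in> l2 w" by simp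
  from l2_diff[OF assms(1)[of N] this] have "g \<in> l2 w" by simp
  moreover have "\<exists>N. \<forall>k\<ge>N. l2_norm w (\<lambda>x. f k x - g x) \<le> e" if "0 < e" for e
    using assms(2)[OF that] est by blast
  ultimately show ?thesis using that by blast
qed

end

text \<open>A finite set of pairs lies in the rectangle spanned by its projections, where the sum
  factors.\<close>

lemma summable_on_product:
  fixes u :: "'a \<Rightarrow> real" and v :: "'b \<Rightarrow> real"
  assumes "u summable_on UNIV" "v summable_on UNIV" "\<And>x. 0 \<le> u x" "\<And>y. 0 \<le> v y"
  shows "(\<lambda>(x, y). u x * v y) summable_on UNIV"
proof (rule nonneg_bdd_above_summable_on)
  show "bdd_above (sum (\<lambda>(x, y). u x * v y) ` {F. F \<subseteq> UNIV \<and> finite F})"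
  proof (rule bdd_aboveI2[where M="infsum u UNIV * infsum v UNIV"])
    fix F :: "('a \<times> 'b) set" assume "F \<in> {F. F \<subseteq> UNIV \<and> finite F}"
    then have F: "finite F" by simp
    have "(\<Sum>(x, y)\<in>F. u x * v y) \<le> (\<Sum>(x, y)\<in>fst ` F \<times> snd ` F. u x * v y)"
      using F assms by (intro sum_mono2) (auto simp: rev_image_eqI)
    also have "\<dots> = sum u (fst ` F) * sum v (snd ` F)"
      by (simp add: sum_product sum.cartesian_product)
    also have "\<dots> \<le> infsum u UNIV * infsum v UNIV"
      using F assms by (intro mult_mono finite_sum_le_infsum sum_nonneg infsum_nonneg) auto
    finally show "(\<Sum>(x, y)\<in>F. u x * v y) \<le> infsum u UNIV * infsum v UNIV" .
  qed
qed (use assms in auto)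

section \<open>The energy form of an elliptic graph\<close>

text \<open>Differences over ordered pairs, so every edge occurs twice; the factor 1/2 in
  \<open>energy\<close> compensates.\<close>

definition grad :: "('a \<Rightarrow> real) \<Rightarrow> 'a \<times> 'a \<Rightarrow> real" where
  "grad f = (\<lambda>(x, y). f x - f y)"

lemma grad_lin: "grad (\<lambda>x. f x + g x) = (\<lambda>p. grad f p + grad g p)"
    "grad (\<lambda>x. f x - g x) = (\<lambda>p. grad f p - grad g p)"
    "grad (\<lambda>x. c * f x) = (\<lambda>p. c * grad f p)"
  by (auto simp: grad_def algebra_simps)

locale elliptic_graph =
  fixes b :: "'a::countable \<Rightarrow> 'a \<Rightarrow> real" and m :: "'a \<Rightarrow> real" and C :: real
  assumes m_pos: "0 < m x"
    and b_nonneg: "0 \<le> b x y" and b_sym: "b x y = b y x" and b_diag: "b x x = 0"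
    and b_finite: "finite {y. 0 < b x y}"
    and C_pos: "0 < C" and b_le: "b x y \<le> C * m x * m y"
begin

sublocale M: pos_weight m
  by unfold_locales (use m_pos in \<open>auto simp: less_imp_le\<close>)

sublocale W: weight "case_prod b"
  by unfold_locales (auto simp: b_nonneg)

abbreviation L :: "('a \<Rightarrow> real) \<Rightarrow> 'a \<Rightarrow> real" where "L \<equiv> laplacian b m"

abbreviation nbh :: "'a \<Rightarrow> 'a set" where "nbh x \<equiv> {y. 0 < b x y}"

text \<open>The maximal form domain. That it equals the form closure of \<open>Cc\<close> rests on
  \<open>Cc_dense\<close>.\<close>

definition form_dom :: "('a \<Rightarrow> real) set" where
  "form_dom = {f. f \<in> l2 m \<and> grad f \<in> l2 (case_prod b)}"

definition energy :: "('a \<Rightarrow> real) \<Rightarrow> ('a \<Rightarrow> real) \<Rightarrow> real" where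
  "energy f g = l2_inner (case_prod b) (grad f) (grad g) / 2"

abbreviation grad_norm :: "('a \<Rightarrow> real) \<Rightarrow> real" where
  "grad_norm f \<equiv> l2_norm (case_prod b) (grad f)"

lemma energy_self: "energy f f = (grad_norm f)\<^sup>2 / 2"
  by (simp add: energy_def W.l2_norm_sq)

lemma energy_commute: "energy f g = energy g f"
  by (simp add: energy_def W.l2_inner_commute)

lemma form_dom_l2: "f \<in> form_dom \<Longrightarrow> f \<in> l2 m"
  and form_dom_grad: "f \<in> form_dom \<Longrightarrow> grad f \<in> l2 (case_prod b)"
  by (auto simp: form_dom_def)

lemma form_dom_diff: "f \<in> form_dom \<Longrightarrow> g \<in> form_dom \<Longrightarrow> (\<lambda>x. f x - g x) \<in> form_dom"
  by (auto simp: form_dom_def grad_lin intro: M.l2_diff W.l2_diff)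

lemma b_zero_iff: "b x y = 0 \<longleftrightarrow> y \<notin> nbh x"
  using b_nonneg[of x y] by auto

lemma laplacian_sum:
  assumes "finite S" "nbh x \<subseteq> S"
  shows "L f x = 1 / m x * (\<Sum>y\<in>S. b x y * (f y - f x))"
proof -
  have "(\<Sum>y\<in>nbh x. b x y * (f y - f x)) = (\<Sum>y\<in>S. b x y * (f y - f x))"
    using assms b_zero_iff by (intro sum.mono_neutral_left) auto
  then show ?thesis by (simp add: laplacian_def)
qed

lemma laplacian_add: "L (\<lambda>y. f y + g y) x = L f x + L g x"
  and laplacian_diff: "L (\<lambda>y. f y - g y) x = L f x - L g x"
  and laplacian_scale: "L (\<lambda>y. c * f y) x = c * L f x"
  and laplacian_const: "L (\<lambda>y. c) x = 0"
  by (simp_all add: laplacian_def sum.distrib[symmetric] sum_subtractf[symmetric] sum_distrib_left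
      algebra_simps add_divide_distrib[symmetric] diff_divide_distrib[symmetric] sum_divide_distrib)

lemma Cc_l2: "f \<in> Cc \<Longrightarrow> f \<in> l2 m"
  by (simp add: Cc_def M.l2_finite_support)

lemma Cc_diff: "f \<in> Cc \<Longrightarrow> g \<in> Cc \<Longrightarrow> (\<lambda>x. f x - g x) \<in> Cc"
  unfolding Cc_def mem_Collect_eq
  by (rule finite_subset[where B="{x. f x \<noteq> 0} \<union> {x. g x \<noteq> 0}"]) auto

lemma Cc_indicator: "indicator {x} \<in> Cc"
  by (simp add: Cc_def indicator_def)

lemma laplacian_Cc:
  assumes "f \<in> Cc" shows "L f \<in> Cc"
proof -
  let ?S = "{x. f x \<noteq> 0} \<union> (\<Union>x\<in>{x. f x \<noteq> 0}. nbh x)"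
  have "L f x = 0" if "x \<notin> ?S" for x
  proof -
    have "b x y * (f y - f x) = 0" if "y \<in> nbh x" for y
      using \<open>x \<notin> ?S\<close> that b_sym[of x y] by auto
    then show ?thesis by (simp add: laplacian_def)
  qed
  then have "{x. L f x \<noteq> 0} \<subseteq> ?S" by blast
  moreover have "finite ?S" using assms b_finite by (auto simp: Cc_def)
  ultimately show ?thesis unfolding Cc_def mem_Collect_eq by (rule finite_subset)
qed

text \<open>The support together with its neighbours gives a finite box \<open>G \<times> G\<close>
  that contains every edge along which \<open>\<phi>\<close> varies; sums over edges become finite
  double sums.\<close>

lemma edge_sum_finite:
  assumes "\<phi> \<in> Cc"
  obtains G where "finite G" "\<And>x. x \<notin> G \<Longrightarrow> \<phi> x = 0" "\<And>x. \<phi> x \<noteq> 0 \<Longrightarrow> nbh x \<subseteq> G"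
    "\<And>x y. (x, y) \<notin> G \<times> G \<Longrightarrow> (\<phi> x - \<phi> y) * b x y = 0"
proof
  let ?S = "{x. \<phi> x \<noteq> 0}" let ?G = "?S \<union> (\<Union>x\<in>?S. nbh x)"
  show "finite ?G" using assms b_finite by (auto simp: Cc_def)
  show "x \<notin> ?G \<Longrightarrow> \<phi> x = 0" for x by auto
  show "\<phi> x \<noteq> 0 \<Longrightarrow> nbh x \<subseteq> ?G" for x by auto
  show "(\<phi> x - \<phi> y) * b x y = 0" if "(x, y) \<notin> ?G \<times> ?G" for x y
  proof (rule ccontr)
    assume n: "(\<phi> x - \<phi> y) * b x y \<noteq> 0"
    then have "0 < b x y" "0 < b y x" using b_nonneg[of x y] b_sym[of x y] by auto
    moreover have "x \<in> ?S \<or> y \<in> ?S" using n by auto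
    ultimately show False using that by auto
  qed
qed

lemma Cc_form_dom:
  assumes "f \<in> Cc" shows "f \<in> form_dom"
proof -
  obtain G where G: "finite G" "\<And>x y. (x, y) \<notin> G \<times> G \<Longrightarrow> (f x - f y) * b x y = 0"
    using edge_sum_finite[OF assms] by metis
  have "finite {p. (grad f p)\<^sup>2 * case_prod b p \<noteq> 0}"
  proof (rule finite_subset)
    show "{p. (grad f p)\<^sup>2 * case_prod b p \<noteq> 0} \<subseteq> G \<times> G"
    proof clarify
      fix x y assume "(grad f (x, y))\<^sup>2 * b x y \<noteq> 0"
      then have "(f x - f y) * b x y \<noteq> 0" by (auto simp: grad_def)
      then show "x \<in> G \<and> y \<in> G" using G(2)[of x y] by blast
    qed
  qed (use G in simp)
  then show ?thesis
    using Cc_l2[OF assms] by (auto simp: form_dom_def l2_def[of "case_prod b"] intro: finite_nonzero_values_imp_summable_on)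
qed

text \<open>The sum over ordered pairs splits into two parts that the symmetry of \<open>b\<close>
  exchanges, which cancels the factor 1/2. Since all sums live on a finite box, \<open>f\<close> can
  be any function.\<close>

lemma green_Cc:
  assumes "\<phi> \<in> Cc"
  shows "energy f \<phi> = - l2_inner m (L f) \<phi>"
proof -
  obtain G where G: "finite G" "\<And>x. x \<notin> G \<Longrightarrow> \<phi> x = 0" "\<And>x. \<phi> x \<noteq> 0 \<Longrightarrow> nbh x \<subseteq> G"
    "\<And>x y. (x, y) \<notin> G \<times> G \<Longrightarrow> (\<phi> x - \<phi> y) * b x y = 0"
    using edge_sum_finite[OF assms] by metis
  have "l2_inner (case_prod b) (grad f) (grad \<phi>)
      = (\<Sum>\<^sub>\<infinity>p\<in>G \<times> G. grad f p * grad \<phi> p * case_prod b p)"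
    unfolding l2_inner_def
  proof (rule infsum_cong_neutral)
    fix p assume "p \<in> UNIV - G \<times> G"
    then have "(\<phi> (fst p) - \<phi> (snd p)) * b (fst p) (snd p) = 0"
      using G(4)[of "fst p" "snd p"] by (cases p) auto
    then show "grad f p * grad \<phi> p * case_prod b p = 0" by (auto simp: grad_def split_def)
  qed auto
  also have "\<dots> = (\<Sum>x\<in>G. \<Sum>y\<in>G. (f x - f y) * (\<phi> x - \<phi> y) * b x y)"
    using G(1) by (simp add: grad_def sum.cartesian_product split_def)
  also have "\<dots> = (\<Sum>x\<in>G. \<Sum>y\<in>G. (f x - f y) * \<phi> x * b x y) + (\<Sum>x\<in>G. \<Sum>y\<in>G. (f y - f x) * \<phi> y * b x y)"
    unfolding sum.distrib[symmetric] by (intro sum.cong refl) (simp add: algebra_simps)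
  also have "(\<Sum>x\<in>G. \<Sum>y\<in>G. (f y - f x) * \<phi> y * b x y) = (\<Sum>x\<in>G. \<Sum>y\<in>G. (f x - f y) * \<phi> x * b x y)"
    by (subst sum.swap) (simp add: b_sym)
  finally have 1: "energy f \<phi> = (\<Sum>x\<in>G. \<Sum>y\<in>G. (f x - f y) * \<phi> x * b x y)"
    by (simp add: energy_def)
  have 2: "(\<Sum>y\<in>G. (f x - f y) * \<phi> x * b x y) = - (\<phi> x * L f x * m x)" for x
  proof (cases "\<phi> x = 0")
    case False
    have "(\<Sum>y\<in>G. (f x - f y) * \<phi> x * b x y) = - (\<phi> x * (\<Sum>y\<in>G. b x y * (f y - f x)))"
      unfolding sum_distrib_left sum_negf[symmetric] by (intro sum.cong refl) (simp add: algebra_simps)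
    then show ?thesis using laplacian_sum[OF G(1) G(3)[OF False], of f] m_pos[of x] by simp
  qed simp
  have "l2_inner m \<phi> (L f) = (\<Sum>x\<in>G. \<phi> x * L f x * m x)"
    using G by (intro M.l2_inner_finite_support) auto
  then show ?thesis by (simp add: 1 2 sum_negf M.l2_inner_commute)
qed

text \<open>This is closability. By \<open>green_Cc\<close> the Cauchy condition is one on gradient
  norms; pointwise convergence identifies the limit gradient as \<open>grad f\<close>, and Fatou
  turns Cauchy into convergent.\<close>

lemma form_approx_grad:
  assumes "form_approx m Cc (\<lambda>f x. - L f x) \<phi> f"
  shows "f \<in> form_dom" "(\<lambda>k. grad_norm (\<lambda>x. \<phi> k x - f x)) \<longlonglongrightarrow> 0"
proof -
  note A = assms[unfolded form_approx_def]
  have C: "\<phi> k \<in> Cc" for k using A by blast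
  have f: "f \<in> l2 m" using A by blast
  have pt: "(\<lambda>k. \<phi> k x) \<longlonglongrightarrow> f x" for x
    by (rule M.l2_tendsto_pointwise[OF Cc_l2[OF C] f]) (use A in blast)
  have *: "\<exists>N. \<forall>k\<ge>N. grad (\<lambda>x. \<phi> k x - f x) \<in> l2 (case_prod b) \<and> grad_norm (\<lambda>x. \<phi> k x - f x) \<le> e"
    if e: "0 < e" for e
  proof -
    have "0 < e\<^sup>2 / 2" using e by simp
    then obtain N where N: "\<And>j k. j \<ge> N \<Longrightarrow> k \<ge> N \<Longrightarrow>
        l2_inner m (\<lambda>x. - L (\<lambda>x. \<phi> j x - \<phi> k x) x) (\<lambda>x. \<phi> j x - \<phi> k x) < e\<^sup>2 / 2"
      using A by meson
    have g: "grad_norm (\<lambda>x. \<phi> j x - \<phi> k x) \<le> e" if "j \<ge> N" "k \<ge> N" for j k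
    proof -
      have "(grad_norm (\<lambda>x. \<phi> j x - \<phi> k x))\<^sup>2 / 2 < e\<^sup>2 / 2"
        using N[OF that] green_Cc[OF Cc_diff[OF C C], of "\<lambda>x. \<phi> j x - \<phi> k x" j k]
        by (simp add: energy_self M.l2_inner_minus_left)
      then have "(grad_norm (\<lambda>x. \<phi> j x - \<phi> k x))\<^sup>2 \<le> e\<^sup>2" by simp
      then show ?thesis using e by (rule power2_le_imp_le[OF _ less_imp_le])
    qed
    have "grad (\<lambda>x. \<phi> k x - f x) \<in> l2 (case_prod b) \<and> grad_norm (\<lambda>x. \<phi> k x - f x) \<le> e" if k: "k \<ge> N" for k
    proof -
      let ?u = "\<lambda>j. grad (\<lambda>x. \<phi> k x - \<phi> (j + N) x)"
      have "(\<lambda>j. ?u j p) \<longlonglongrightarrow> grad (\<lambda>x. \<phi> k x - f x) p" for p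
        unfolding grad_def split_def by (intro tendsto_intros LIMSEQ_ignore_initial_segment pt)
      moreover have "?u j \<in> l2 (case_prod b)" for j
        using Cc_form_dom[OF Cc_diff[OF C C]] form_dom_grad by blast
      moreover have "l2_norm (case_prod b) (?u j) \<le> e" for j using g k by simp
      ultimately show ?thesis using W.l2_fatou[of ?u] by blast
    qed
    then show ?thesis by blast
  qed
  obtain N where "grad (\<lambda>x. \<phi> N x - f x) \<in> l2 (case_prod b)" using *[of 1] by auto
  from W.l2_diff[OF form_dom_grad[OF Cc_form_dom[OF C[of N]]] this]
  have "grad f \<in> l2 (case_prod b)" by (simp add: grad_def split_def)
  then show "f \<in> form_dom" using f by (simp add: form_dom_def)
  show "(\<lambda>k. grad_norm (\<lambda>x. \<phi> k x - f x)) \<longlonglongrightarrow> 0"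
  proof (rule LIMSEQ_I)
    fix r :: real assume "0 < r"
    then obtain N where "\<forall>k\<ge>N. grad_norm (\<lambda>x. \<phi> k x - f x) \<le> r / 2" using *[of "r/2"] by auto
    then show "\<exists>no. \<forall>n\<ge>no. norm (grad_norm (\<lambda>x. \<phi> n x - f x) - 0) < r"
      using \<open>0 < r\<close> W.l2_norm_nonneg by (intro exI[of _ N]) force
  qed
qed

text \<open>Ellipticity enters here: a function of finite energy is first shifted towards zero, so that
  it lives on a set of finite measure, and the cut-off to finite sets is then dominated by means of
  \<open>b(x,y) \<le> C m(x) m(y)\<close> on that set.\<close>

lemma Cc_dense:
  assumes f: "f \<in> form_dom" and e: "0 < e"
  obtains \<phi> where "\<phi> \<in> Cc" "l2_norm m (\<lambda>x. \<phi> x - f x) \<le> e" "grad_norm (\<lambda>x. \<phi> x - f x) \<le> e"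
proof -
  have ev: "\<exists>k. u k \<le> e / 2 \<and> v k \<le> e / 2" if "u \<longlonglongrightarrow> 0" "v \<longlonglongrightarrow> 0" for u v :: "nat \<Rightarrow> real"
  proof -
    have "\<forall>\<^sub>F k in sequentially. u k < e / 2" "\<forall>\<^sub>F k in sequentially. v k < e / 2"
      using order_tendstoD(2)[OF that(1), of "e / 2"] order_tendstoD(2)[OF that(2), of "e / 2"] e by simp_all
    then have "\<forall>\<^sub>F k in sequentially. u k < e / 2 \<and> v k < e / 2" by (rule eventually_conj)
    then obtain k where "u k < e / 2 \<and> v k < e / 2"
      using eventually_happens' sequentially_bot by blast
    then show ?thesis by (intro exI[of _ k]) simp
  qed
  \<comment> \<open>\<open>cl d\<close> truncates to the interval from -d to d, so subtracting it
    shifts values towards zero by d and kills those of modulus at most d. Truncation is a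
    contraction, hence controls gradients too.\<close>
  define cl where "cl d r = max (- d) (min r d)" for d r :: real
  have cl_lip: "\<bar>cl d r - cl d s\<bar> \<le> \<bar>r - s\<bar>" for d r s by (auto simp: cl_def)
  have cl_le: "\<bar>cl d r\<bar> \<le> d" if "0 < d" for d r using that by (auto simp: cl_def)
  have cl_le': "\<bar>cl d r\<bar> \<le> \<bar>r\<bar>" if "0 < d" for d r using that by (auto simp: cl_def)
  let ?d = "\<lambda>k. 1 / real (Suc k)"
  have cl0: "(\<lambda>k. cl (?d k) r) \<longlonglongrightarrow> 0" for r
  proof (rule Lim_null_comparison)
    show "\<forall>\<^sub>F k in sequentially. norm (cl (?d k) r) \<le> ?d k" using cl_le by simp
    show "?d \<longlonglongrightarrow> 0" using LIMSEQ_inverse_real_of_nat by (simp add: inverse_eq_divide)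
  qed
  have "(\<lambda>k. l2_norm m (\<lambda>x. cl (?d k) (f x))) \<longlonglongrightarrow> 0"
    by (rule M.l2_dominated_convergence[OF form_dom_l2[OF f]]) (use cl_le' cl0 in auto)
  moreover have "(\<lambda>k. grad_norm (\<lambda>x. cl (?d k) (f x))) \<longlonglongrightarrow> 0"
  proof (rule W.l2_dominated_convergence[OF form_dom_grad[OF f]])
    show "\<bar>grad (\<lambda>x. cl (?d k) (f x)) p\<bar> \<le> \<bar>grad f p\<bar>" for k p
      using cl_lip by (simp add: grad_def split_def)
    show "(\<lambda>k. grad (\<lambda>x. cl (?d k) (f x)) p) \<longlonglongrightarrow> 0" for p
      using tendsto_diff[OF cl0[of "f (fst p)"] cl0[of "f (snd p)"]] by (simp add: grad_def split_def)
  qed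
  ultimately obtain k where k: "l2_norm m (\<lambda>x. cl (?d k) (f x)) \<le> e / 2"
      "grad_norm (\<lambda>x. cl (?d k) (f x)) \<le> e / 2" using ev by blast
  define d where "d = ?d k"
  define c where "c x = cl d (f x)" for x
  define g where "g x = f x - c x" for x
  define S where "S = {x. g x \<noteq> 0}"
  have d: "0 < d" by (simp add: d_def)
  have c: "c \<in> form_dom"
    unfolding form_dom_def mem_Collect_eq
  proof
    show "c \<in> l2 m" by (rule M.l2_dominated[OF form_dom_l2[OF f]]) (use cl_le' d in \<open>auto simp: c_def\<close>)
    show "grad c \<in> l2 (case_prod b)"
      by (rule W.l2_dominated[OF form_dom_grad[OF f]]) (use cl_lip in \<open>auto simp: c_def grad_def\<close>)
  qed
  have g: "g \<in> form_dom" unfolding g_def by (rule form_dom_diff[OF f c])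
  have gl: "(\<lambda>x. (g x)\<^sup>2 * m x) summable_on UNIV" using form_dom_l2[OF g] by (simp add: l2_def)
  have S: "d \<le> \<bar>f x\<bar>" if "x \<in> S" for x
    using that d by (auto simp: S_def g_def c_def cl_def)
  \<comment> \<open>Chebyshev's inequality: \<open>f\<close> has modulus at least d on
    \<open>S\<close>, so \<open>S\<close> has finite measure.\<close>
  have mS: "(\<lambda>x. indicator S x * m x) summable_on UNIV"
  proof (rule summable_on_comparison_test)
    show "(\<lambda>x. (1 / d\<^sup>2) * ((f x)\<^sup>2 * m x)) summable_on UNIV"
      using form_dom_l2[OF f] by (intro summable_on_cmult_right) (simp add: l2_def)
    show "indicator S x * m x \<le> (1 / d\<^sup>2) * ((f x)\<^sup>2 * m x)" for x
    proof (cases "x \<in> S")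
      case True
      have "d\<^sup>2 \<le> (f x)\<^sup>2" using power_mono[OF S[OF True], of 2] d by simp
      then show ?thesis using d m_pos[of x] True by (simp add: field_simps)
    qed (use m_pos[of x] in auto)
  qed (simp add: less_imp_le[OF m_pos])
  define r where "r k x = (if to_nat x < k then 0 else g x)" for k x
  have r0: "(\<lambda>k. r k x) \<longlonglongrightarrow> 0" for x
    by (rule tendsto_eventually) (auto simp: r_def eventually_sequentially intro!: exI[of _ "Suc (to_nat x)"])
  have "(\<lambda>k. l2_norm m (r k)) \<longlonglongrightarrow> 0"
    by (rule M.l2_dominated_convergence[OF form_dom_l2[OF g]]) (use r0 in \<open>auto simp: r_def\<close>)
  moreover have "(\<lambda>k. grad_norm (r k)) \<longlonglongrightarrow> 0"
  proof -
    let ?i = "\<lambda>x. indicator S x * m x" and ?q = "\<lambda>x. (g x)\<^sup>2 * m x"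
    \<comment> \<open>The first term covers edges with at most one end in \<open>S\<close>. The
      other two cover edges inside \<open>S\<close>, where \<open>b\<close> is replaced by C m(x)
      m(y) and one factor is paired with the finite measure of \<open>S\<close>.\<close>
    let ?H = "\<lambda>p. (grad g p)\<^sup>2 * case_prod b p + 2 * C * (case p of (x, y) \<Rightarrow> ?q x * ?i y) + 2 * C * (case p of (x, y) \<Rightarrow> ?i x * ?q y)"
    have i0: "0 \<le> ?i x" and q0: "0 \<le> ?q x" for x using m_pos[of x] by auto
    have "?H summable_on UNIV"
      using form_dom_grad[OF g] summable_on_product[OF gl mS q0 i0] summable_on_product[OF mS gl i0 q0]
      by (intro summable_on_add summable_on_cmult_right) (auto simp: l2_def)
    moreover have "\<bar>(grad (r k) p)\<^sup>2 * case_prod b p\<bar> \<le> ?H p" for k p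
    proof -
      obtain x y where p: "p = (x, y)" by fastforce
      have t: "(r k x - r k y)\<^sup>2 * b x y
          \<le> (g x - g y)\<^sup>2 * b x y + 2 * C * (?q x * ?i y) + 2 * C * (?i x * ?q y)"
      proof (cases "x \<in> S \<and> y \<in> S")
        case True
        have "(r k x - r k y)\<^sup>2 \<le> 2 * (g x)\<^sup>2 + 2 * (g y)\<^sup>2"
        proof -
          have "(r k x - r k y)\<^sup>2 \<le> 2 * (r k x)\<^sup>2 + 2 * (r k y)\<^sup>2"
            using zero_le_power2[of "r k x + r k y"] by (simp add: power2_eq_square algebra_simps)
          moreover have "(r k x)\<^sup>2 \<le> (g x)\<^sup>2" "(r k y)\<^sup>2 \<le> (g y)\<^sup>2" by (auto simp: r_def)
          ultimately show ?thesis by linarith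
        qed
        then have "(r k x - r k y)\<^sup>2 * b x y \<le> (2 * (g x)\<^sup>2 + 2 * (g y)\<^sup>2) * (C * m x * m y)"
          using b_le b_nonneg by (intro mult_mono) auto
        also have "\<dots> = 2 * C * (?q x * ?i y) + 2 * C * (?i x * ?q y)"
          using True by (simp add: algebra_simps)
        finally have "(r k x - r k y)\<^sup>2 * b x y \<le> 2 * C * (?q x * ?i y) + 2 * C * (?i x * ?q y)" .
        moreover have "0 \<le> (g x - g y)\<^sup>2 * b x y" using b_nonneg[of x y] by simp
        ultimately show ?thesis by linarith
      next
        case False
        \<comment> \<open>One of \<open>g x\<close> and \<open>g y\<close> is zero, so cutting off
          cannot enlarge the difference.\<close>
        then have "(r k x - r k y)\<^sup>2 \<le> (g x - g y)\<^sup>2" by (auto simp: r_def S_def)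
        then have "(r k x - r k y)\<^sup>2 * b x y \<le> (g x - g y)\<^sup>2 * b x y"
          using b_nonneg by (rule mult_right_mono)
        moreover have "0 \<le> 2 * C * (?q x * ?i y)" "0 \<le> 2 * C * (?i x * ?q y)"
          using C_pos i0 q0 by (auto intro!: mult_nonneg_nonneg simp: less_imp_le)
        ultimately show ?thesis by linarith
      qed
      then show ?thesis using b_nonneg[of x y] by (simp add: p grad_def)
    qed
    moreover have "(\<lambda>k. (grad (r k) p)\<^sup>2 * case_prod b p) \<longlonglongrightarrow> (0 - 0)\<^sup>2 * case_prod b p" for p
      unfolding grad_def split_def by (intro tendsto_intros r0)
    ultimately have "(\<lambda>k. \<Sum>\<^sub>\<infinity>p. (grad (r k) p)\<^sup>2 * case_prod b p) \<longlonglongrightarrow> (\<Sum>\<^sub>\<infinity>p. (0 - 0)\<^sup>2 * case_prod b p)"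
      by (rule infsum_dominated_convergence(2))
    then have "(\<lambda>k. l2_inner (case_prod b) (grad (r k)) (grad (r k))) \<longlonglongrightarrow> 0"
      by (simp add: l2_inner_def power2_eq_square)
    from tendsto_real_sqrt[OF this] show ?thesis by (simp add: l2_norm_def)
  qed
  ultimately obtain j where j: "l2_norm m (r j) \<le> e / 2" "grad_norm (r j) \<le> e / 2" using ev by blast
  define \<phi> where "\<phi> x = g x - r j x" for x
  have "{x. \<phi> x \<noteq> 0} \<subseteq> to_nat -` {..<j}" by (auto simp: \<phi>_def r_def)
  then have "\<phi> \<in> Cc" unfolding Cc_def mem_Collect_eq
    by (rule finite_subset) (intro finite_vimageI finite_lessThan inj_to_nat)
  have rf: "r j \<in> form_dom"
    using form_dom_diff[OF g Cc_form_dom[OF \<open>\<phi> \<in> Cc\<close>]] by (simp add: \<phi>_def)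
  have eq: "(\<lambda>x. \<phi> x - f x) = (\<lambda>x. - (r j x + c x))" by (auto simp: \<phi>_def g_def)
  have eq': "grad (\<lambda>x. \<phi> x - f x) = (\<lambda>p. - (grad (r j) p + grad c p))"
    by (auto simp: \<phi>_def g_def grad_def)
  have kk: "l2_norm m c \<le> e / 2" "grad_norm c \<le> e / 2" using k by (simp_all add: c_def[abs_def] d_def)
  have "l2_norm m (\<lambda>x. \<phi> x - f x) \<le> e"
    unfolding eq M.l2_norm_minus
    using M.l2_norm_triangle[OF form_dom_l2[OF rf] form_dom_l2[OF c]] kk j by linarith
  moreover have "grad_norm (\<lambda>x. \<phi> x - f x) \<le> e"
    unfolding eq' W.l2_norm_minus
    using W.l2_norm_triangle[OF form_dom_grad[OF rf] form_dom_grad[OF c]] kk j by linarith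
  ultimately show ?thesis using that \<open>\<phi> \<in> Cc\<close> by blast
qed

lemma form_approx_exists:
  assumes f: "f \<in> form_dom"
  shows "\<exists>\<phi>. form_approx m Cc (\<lambda>f x. - L f x) \<phi> f"
proof -
  have "\<exists>\<phi>. \<phi> \<in> Cc \<and> l2_norm m (\<lambda>x. \<phi> x - f x) \<le> 1 / real (Suc k) \<and> grad_norm (\<lambda>x. \<phi> x - f x) \<le> 1 / real (Suc k)" for k
    by (rule Cc_dense[OF f, of "1 / real (Suc k)"]) auto
  then obtain \<phi> where \<phi>: "\<And>k. \<phi> k \<in> Cc" "\<And>k. l2_norm m (\<lambda>x. \<phi> k x - f x) \<le> 1 / real (Suc k)"
      "\<And>k. grad_norm (\<lambda>x. \<phi> k x - f x) \<le> 1 / real (Suc k)" by metis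
  have lim: "(\<lambda>k. 1 / real (Suc k)) \<longlonglongrightarrow> 0"
    using LIMSEQ_inverse_real_of_nat by (simp add: inverse_eq_divide)
  have "form_approx m Cc (\<lambda>f x. - L f x) \<phi> f"
    unfolding form_approx_def
  proof (intro conjI allI impI)
    show "(\<lambda>k. l2_norm m (\<lambda>x. \<phi> k x - f x)) \<longlonglongrightarrow> 0"
      by (rule Lim_null_comparison[OF _ lim]) (use \<phi>(2) M.l2_norm_nonneg in simp)
    fix e :: real assume "0 < e"
    then have "0 < sqrt e / 2" by simp
    then have "\<forall>\<^sub>F k in sequentially. 1 / real (Suc k) < sqrt e / 2" using lim by (rule order_tendstoD(2)[rotated])
    then obtain N where N: "\<And>k. k \<ge> N \<Longrightarrow> 1 / real (Suc k) < sqrt e / 2"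
      by (auto simp: eventually_sequentially)
    have "l2_inner m (\<lambda>x. - L (\<lambda>x. \<phi> j x - \<phi> k x) x) (\<lambda>x. \<phi> j x - \<phi> k x) < e" if "j \<ge> N" "k \<ge> N" for j k
    proof -
      have gd: "grad (\<phi> i) \<in> l2 (case_prod b)" for i by (rule form_dom_grad[OF Cc_form_dom[OF \<phi>(1)]])
      have "grad_norm (\<lambda>x. \<phi> j x - \<phi> k x) \<le> grad_norm (\<lambda>x. \<phi> j x - f x) + grad_norm (\<lambda>x. f x - \<phi> k x)"
        unfolding grad_lin by (rule W.l2_norm_diff_trans[OF gd form_dom_grad[OF f] gd])
      also have "grad_norm (\<lambda>x. f x - \<phi> k x) = grad_norm (\<lambda>x. \<phi> k x - f x)"
        unfolding grad_lin by (rule W.l2_norm_diff_commute)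
      finally have "grad_norm (\<lambda>x. \<phi> j x - \<phi> k x) < sqrt e"
        using \<phi>(3)[of j] \<phi>(3)[of k] N[OF that(1)] N[OF that(2)] by linarith
      then have "(grad_norm (\<lambda>x. \<phi> j x - \<phi> k x))\<^sup>2 < (sqrt e)\<^sup>2"
        using W.l2_norm_nonneg by (intro power_strict_mono) auto
      then have "(grad_norm (\<lambda>x. \<phi> j x - \<phi> k x))\<^sup>2 < e" using \<open>0 < e\<close> by simp
      then show ?thesis
        using green_Cc[OF Cc_diff[OF \<phi>(1) \<phi>(1)], of "\<lambda>x. \<phi> j x - \<phi> k x" j k] \<open>0 < e\<close>
        by (simp add: energy_self M.l2_inner_minus_left)
    qed
    then show "\<exists>N. \<forall>j\<ge>N. \<forall>k\<ge>N. l2_inner m (\<lambda>x. - L (\<lambda>x. \<phi> j x - \<phi> k x) x) (\<lambda>x. \<phi> j x - \<phi> k x) < e"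
      by blast
  qed (use \<phi>(1) form_dom_l2[OF f] in auto)
  then show ?thesis by blast
qed

section \<open>Identification of the closed form and of the Friedrichs extension\<close>

lemma closed_form_dom_eq: "closed_form_dom m Cc (\<lambda>f x. - L f x) = form_dom"
  using form_approx_grad(1) form_approx_exists by (auto simp: closed_form_dom_def)

lemma form_approx_energy:
  assumes "form_approx m Cc (\<lambda>f x. - L f x) \<phi> f" "form_approx m Cc (\<lambda>f x. - L f x) \<psi> g"
  shows "(\<lambda>k. l2_inner m (\<lambda>x. - L (\<phi> k) x) (\<psi> k)) \<longlonglongrightarrow> energy f g"
proof -
  have C: "\<phi> k \<in> Cc" "\<psi> k \<in> Cc" for k using assms by (auto simp: form_approx_def)
  have "(\<lambda>k. l2_inner (case_prod b) (grad (\<phi> k)) (grad (\<psi> k))) \<longlonglongrightarrow> l2_inner (case_prod b) (grad f) (grad g)"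
    using form_approx_grad[OF assms(1)] form_approx_grad[OF assms(2)] C
    by (intro W.l2_inner_tendsto) (auto simp: grad_lin intro: form_dom_grad Cc_form_dom)
  then have "(\<lambda>k. energy (\<phi> k) (\<psi> k)) \<longlonglongrightarrow> energy f g"
    unfolding energy_def by (intro tendsto_intros) auto
  moreover have "energy (\<phi> k) (\<psi> k) = l2_inner m (\<lambda>x. - L (\<phi> k) x) (\<psi> k)" for k
    by (simp add: green_Cc[OF C(2)] M.l2_inner_minus_left)
  ultimately show ?thesis by simp
qed

text \<open>The definite description is legitimate because all approximating sequences yield the
  same limit and at least one pair of them exists.\<close>

lemma closed_form_eq:
  assumes "f \<in> form_dom" "g \<in> form_dom"
  shows "closed_form m Cc (\<lambda>f x. - L f x) f g = energy f g"
  unfolding closed_form_def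
proof (rule the_equality)
  fix c assume c: "\<forall>\<phi> \<psi>. form_approx m Cc (\<lambda>f x. - L f x) \<phi> f \<longrightarrow>
    form_approx m Cc (\<lambda>f x. - L f x) \<psi> g \<longrightarrow> (\<lambda>k. l2_inner m (\<lambda>x. - L (\<phi> k) x) (\<psi> k)) \<longlonglongrightarrow> c"
  obtain \<phi> \<psi> where "form_approx m Cc (\<lambda>f x. - L f x) \<phi> f" "form_approx m Cc (\<lambda>f x. - L f x) \<psi> g"
    using assms form_approx_exists by blast
  then show "c = energy f g" using c form_approx_energy LIMSEQ_unique by blast
qed (use form_approx_energy in blast)

text \<open>For \<open>L f\<close> in l2 both sides are continuous in the second argument for the
  form norm, so the identity on \<open>Cc\<close> extends along a form approximation of
  \<open>g\<close>.\<close>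

lemma green:
  assumes f: "f \<in> form_dom" and Lf: "L f \<in> l2 m" and g: "g \<in> form_dom"
  shows "energy f g = - l2_inner m (L f) g"
proof -
  obtain \<phi> where \<phi>: "form_approx m Cc (\<lambda>f x. - L f x) \<phi> g" using form_approx_exists[OF g] by blast
  have C: "\<phi> k \<in> Cc" for k using \<phi> by (auto simp: form_approx_def)
  have "(\<lambda>k. l2_inner (case_prod b) (grad f) (grad (\<phi> k))) \<longlonglongrightarrow> l2_inner (case_prod b) (grad f) (grad g)"
    using form_approx_grad[OF \<phi>] C f
    by (intro W.l2_inner_tendsto) (auto simp: grad_lin W.l2_norm_zero intro: form_dom_grad Cc_form_dom)
  then have "(\<lambda>k. energy f (\<phi> k)) \<longlonglongrightarrow> energy f g"
    unfolding energy_def by (intro tendsto_intros) auto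
  moreover have "(\<lambda>k. l2_inner m (L f) (\<phi> k)) \<longlonglongrightarrow> l2_inner m (L f) g"
    using \<phi> C Lf form_dom_l2[OF g]
    by (intro M.l2_inner_tendsto) (auto simp: M.l2_norm_zero form_approx_def intro: Cc_l2)
  then have "(\<lambda>k. energy f (\<phi> k)) \<longlonglongrightarrow> - l2_inner m (L f) g"
    unfolding green_Cc[OF C] by (rule tendsto_minus)
  ultimately show ?thesis by (rule LIMSEQ_unique)
qed

definition gen_dom :: "('a \<Rightarrow> real) set" where
  "gen_dom = {f \<in> form_dom. L f \<in> l2 m}"

lemma Cc_gen_dom: "f \<in> Cc \<Longrightarrow> f \<in> gen_dom"
  by (simp add: gen_dom_def Cc_form_dom laplacian_Cc Cc_l2)

lemma gen_dom_symmetric: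
  assumes "f \<in> gen_dom" "g \<in> gen_dom"
  shows "l2_inner m (L f) g = l2_inner m f (L g)"
  using green[of f g] green[of g f] assms energy_commute[of f g]
  by (auto simp: gen_dom_def M.l2_inner_commute)

text \<open>Testing the weak identity against \<open>indicator {x}\<close> recovers \<open>h\<close>
  pointwise as minus the Laplacian; the converse inclusion is \<open>green\<close>.\<close>

lemma graph_operator_eq: "graph_operator b m = {(f, \<lambda>x. - L f x) | f. f \<in> gen_dom}"
proof (intro set_eqI iffI)
  fix p assume "p \<in> graph_operator b m"
  then obtain f h where p: "p = (f, h)" and f: "f \<in> form_dom" and h: "h \<in> l2 m"
    and E: "\<And>g. g \<in> form_dom \<Longrightarrow> energy f g = l2_inner m h g"
    by (auto simp: graph_operator_def friedrichs_extension_def closed_form_dom_eq closed_form_eq)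
  have "h x = - L f x" for x
  proof -
    have i: "l2_inner m u (indicator {x}) = u x * m x" for u
      using M.l2_inner_finite_support[of "{x}" "indicator {x}" u]
      by (simp add: M.l2_inner_commute)
    have "h x * m x = - L f x * m x"
      using E[OF Cc_form_dom[OF Cc_indicator], of x] green_Cc[OF Cc_indicator, of f x] by (simp add: i)
    then show ?thesis using m_pos[of x] by (metis mult_cancel_right less_irrefl)
  qed
  then have "h = (\<lambda>x. - L f x)" by auto
  moreover from this have "L f = (\<lambda>x. - h x)" by auto
  then have "L f \<in> l2 m" using M.l2_minus[OF h] by simp
  ultimately show "p \<in> {(f, \<lambda>x. - L f x) | f. f \<in> gen_dom}" using p f by (auto simp: gen_dom_def)
next
  fix p assume "p \<in> {(f, \<lambda>x. - L f x) | f. f \<in> gen_dom}"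
  then obtain f where "p = (f, \<lambda>x. - L f x)" "f \<in> gen_dom" by auto
  then show "p \<in> graph_operator b m"
    by (auto simp: graph_operator_def friedrichs_extension_def closed_form_dom_eq closed_form_eq
        gen_dom_def green M.l2_inner_minus_left M.l2_minus)
qed

end

section \<open>Exponentials of finite matrices\<close>

definition mat_op :: "'a set \<Rightarrow> ('a \<Rightarrow> 'a \<Rightarrow> real) \<Rightarrow> ('a \<Rightarrow> real) \<Rightarrow> 'a \<Rightarrow> real" where
  "mat_op F d u x = (if x \<in> F then \<Sum>y\<in>F. d x y * u y else 0)"

text \<open>The series of exp(tD)u for the matrix \<open>d\<close> restricted to \<open>F\<close>.
  The initial value is cut off to \<open>F\<close>, which keeps the result zero outside
  \<open>F\<close>.\<close>

definition mat_exp :: "'a set \<Rightarrow> ('a \<Rightarrow> 'a \<Rightarrow> real) \<Rightarrow> real \<Rightarrow> ('a \<Rightarrow> real) \<Rightarrow> 'a \<Rightarrow> real" where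
  "mat_exp F d t u x =
     (\<Sum>n. (mat_op F d ^^ n) (\<lambda>x. if x \<in> F then u x else 0) x / fact n * t ^ n)"

text \<open>The sum of all absolute entries is a crude operator norm for the l1 norm over
  \<open>F\<close>; any geometric growth is beaten by the factorials.\<close>

lemma mat_op_iterate_bound:
  assumes "finite F"
  shows "\<bar>(mat_op F d ^^ n) (\<lambda>x. if x \<in> F then u x else 0) x\<bar>
    \<le> (\<Sum>x\<in>F. \<Sum>y\<in>F. \<bar>d x y\<bar>) ^ n * (\<Sum>x\<in>F. \<bar>u x\<bar>)"
proof -
  let ?v = "\<lambda>n. (mat_op F d ^^ n) (\<lambda>x. if x \<in> F then u x else 0)"
  let ?R = "\<Sum>x\<in>F. \<Sum>y\<in>F. \<bar>d x y\<bar>"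
  have s: "(\<Sum>x\<in>F. \<bar>?v n x\<bar>) \<le> ?R ^ n * (\<Sum>x\<in>F. \<bar>u x\<bar>)" for n
  proof (induction n)
    case (Suc n)
    have "(\<Sum>x\<in>F. \<bar>?v (Suc n) x\<bar>) \<le> (\<Sum>x\<in>F. \<Sum>y\<in>F. \<bar>d x y\<bar> * (\<Sum>z\<in>F. \<bar>?v n z\<bar>))"
    proof (intro sum_mono)
      fix x assume "x \<in> F"
      then have "\<bar>?v (Suc n) x\<bar> = \<bar>\<Sum>y\<in>F. d x y * ?v n y\<bar>" by (simp add: mat_op_def)
      also have "\<dots> \<le> (\<Sum>y\<in>F. \<bar>d x y * ?v n y\<bar>)" by (rule sum_abs)
      also have "\<dots> \<le> (\<Sum>y\<in>F. \<bar>d x y\<bar> * (\<Sum>z\<in>F. \<bar>?v n z\<bar>))"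
        using assms by (intro sum_mono) (auto simp: abs_mult intro!: mult_left_mono member_le_sum)
      finally show "\<bar>?v (Suc n) x\<bar> \<le> (\<Sum>y\<in>F. \<bar>d x y\<bar> * (\<Sum>z\<in>F. \<bar>?v n z\<bar>))" .
    qed
    also have "\<dots> = ?R * (\<Sum>z\<in>F. \<bar>?v n z\<bar>)" by (simp only: sum_distrib_right)
    also have "\<dots> \<le> ?R * (?R ^ n * (\<Sum>x\<in>F. \<bar>u x\<bar>))"
      by (intro mult_left_mono Suc.IH sum_nonneg) auto
    finally show ?case by (simp only: power_Suc mult.assoc)
  qed simp
  show ?thesis
  proof (cases "x \<in> F")
    case True
    then have "\<bar>?v n x\<bar> \<le> (\<Sum>x\<in>F. \<bar>?v n x\<bar>)" using assms by (intro member_le_sum) auto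
    then show ?thesis using s[of n] by linarith
  next
    case False
    then have "?v n x = 0" by (cases n) (simp_all add: mat_op_def)
    then show ?thesis by (simp add: sum_nonneg)
  qed
qed

lemma mat_exp_summable:
  assumes "finite F"
  shows "summable (\<lambda>n. (mat_op F d ^^ n) (\<lambda>x. if x \<in> F then u x else 0) x / fact n * t ^ n)"
proof (rule summable_comparison_test)
  let ?R = "\<Sum>x\<in>F. \<Sum>y\<in>F. \<bar>d x y\<bar>"
  have "summable (\<lambda>n. (?R * \<bar>t\<bar>) ^ n /\<^sub>R fact n)" by (rule summable_exp_generic)
  then show "summable (\<lambda>n. (\<Sum>x\<in>F. \<bar>u x\<bar>) * ((?R * \<bar>t\<bar>) ^ n /\<^sub>R fact n))" by (rule summable_mult)
  have "norm ((mat_op F d ^^ n) (\<lambda>x. if x \<in> F then u x else 0) x / fact n * t ^ n)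
      \<le> (\<Sum>x\<in>F. \<bar>u x\<bar>) * ((?R * \<bar>t\<bar>) ^ n /\<^sub>R fact n)" for n
  proof -
    have "norm ((mat_op F d ^^ n) (\<lambda>x. if x \<in> F then u x else 0) x / fact n * t ^ n)
      = \<bar>(mat_op F d ^^ n) (\<lambda>x. if x \<in> F then u x else 0) x\<bar> * (\<bar>t\<bar> ^ n / fact n)"
      by (simp add: abs_mult power_abs)
    also have "\<dots> \<le> (?R ^ n * (\<Sum>x\<in>F. \<bar>u x\<bar>)) * (\<bar>t\<bar> ^ n / fact n)"
      by (intro mult_right_mono mat_op_iterate_bound assms) simp
    finally show ?thesis by (simp add: power_mult_distrib field_simps)
  qed
  then show "\<exists>N. \<forall>n\<ge>N. norm ((mat_op F d ^^ n) (\<lambda>x. if x \<in> F then u x else 0) x / fact n * t ^ n)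
      \<le> (\<Sum>x\<in>F. \<bar>u x\<bar>) * ((?R * \<bar>t\<bar>) ^ n /\<^sub>R fact n)" by blast
qed

lemma mat_exp_deriv:
  assumes "finite F"
  shows "((\<lambda>t. mat_exp F d t u x) has_real_derivative mat_op F d (mat_exp F d t u) x) (at t)"
proof -
  let ?v = "\<lambda>n. (mat_op F d ^^ n) (\<lambda>x. if x \<in> F then u x else 0)"
  have "((\<lambda>t. \<Sum>n. ?v n x / fact n * t ^ n) has_real_derivative
      (\<Sum>n. diffs (\<lambda>n. ?v n x / fact n) n * t ^ n)) (at t)"
    by (rule termdiffs_strong_converges_everywhere) (rule mat_exp_summable[OF assms])
  moreover have "(\<Sum>n. diffs (\<lambda>n. ?v n x / fact n) n * t ^ n) = mat_op F d (mat_exp F d t u) x"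
  proof -
    have df: "diffs (\<lambda>n. ?v n x / fact n) n = ?v (Suc n) x / fact n" for n
    proof -
      have "real (Suc n) * (c / fact (Suc n)) = c / fact n" for c :: real
        by (simp add: field_simps del: of_nat_Suc)
      then show ?thesis unfolding diffs_def .
    qed
    show ?thesis
    proof (cases "x \<in> F")
      case True
      have "mat_op F d (mat_exp F d t u) x = (\<Sum>y\<in>F. d x y * (\<Sum>n. ?v n y / fact n * t ^ n))"
        using True by (simp add: mat_op_def mat_exp_def)
      also have "\<dots> = (\<Sum>y\<in>F. \<Sum>n. d x y * (?v n y / fact n * t ^ n))"
        by (intro sum.cong refl suminf_mult[symmetric] mat_exp_summable assms)
      also have "\<dots> = (\<Sum>n. \<Sum>y\<in>F. d x y * (?v n y / fact n * t ^ n))"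
        by (intro suminf_sum[symmetric] summable_mult mat_exp_summable assms)
      also have "\<dots> = (\<Sum>n. diffs (\<lambda>n. ?v n x / fact n) n * t ^ n)"
        unfolding df by (simp add: mat_op_def True sum_distrib_right sum_divide_distrib mult.assoc)
      finally show ?thesis ..
    qed (simp add: df mat_op_def)
  qed
  ultimately show ?thesis by (simp add: mat_exp_def[abs_def])
qed

lemma mat_exp_zero: "mat_exp F d 0 u x = (if x \<in> F then u x else 0)"
  unfolding mat_exp_def by (subst powser_zero) simp

lemma mat_exp_outside: "x \<notin> F \<Longrightarrow> mat_exp F d t u x = 0"
proof -
  assume "x \<notin> F"
  then have "(mat_op F d ^^ n) (\<lambda>x. if x \<in> F then u x else 0) x = 0" for n
    by (cases n) (simp_all add: mat_op_def)
  then show ?thesis by (simp add: mat_exp_def)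
qed

text \<open>The common Lipschitz constant of the derivatives gives a quadratic remainder estimate
  that is uniform in n and hence survives pointwise limits. The index \<open>N\<close> allows for a
  point that enters the exhausting sets only later.\<close>

lemma has_real_derivative_limit:
  fixes f g :: "nat \<Rightarrow> real \<Rightarrow> real"
  assumes d: "\<And>n t. N \<le> n \<Longrightarrow> 0 \<le> t \<Longrightarrow> (f n has_real_derivative g n t) (at t within {0..})"
    and lip: "\<And>n s t. N \<le> n \<Longrightarrow> 0 \<le> s \<Longrightarrow> 0 \<le> t \<Longrightarrow> \<bar>g n s - g n t\<bar> \<le> B * \<bar>s - t\<bar>"
    and f: "\<And>t. 0 \<le> t \<Longrightarrow> (\<lambda>n. f n t) \<longlonglongrightarrow> f' t" and g: "\<And>t. 0 \<le> t \<Longrightarrow> (\<lambda>n. g n t) \<longlonglongrightarrow> g' t"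
    and t: "0 \<le> t"
  shows "(f' has_real_derivative g' t) (at t within {0..})"
proof -
  have 1: "\<bar>f n s - f n t - g n t * (s - t)\<bar> \<le> B * \<bar>s - t\<bar> * \<bar>s - t\<bar>" if n: "N \<le> n" and s: "0 \<le> s" for n s
  proof -
    let ?S = "{min s t..max s t}"
    have "norm ((f n s - g n t * s) - (f n t - g n t * t)) \<le> (B * \<bar>s - t\<bar>) * norm (s - t)"
    proof (rule field_differentiable_bound[where S="?S" and f'="\<lambda>r. g n r - g n t"])
      fix r assume r: "r \<in> ?S"
      then have r0: "0 \<le> r" using s t by auto
      have "(f n has_real_derivative g n r) (at r within ?S)"
        by (rule DERIV_subset[OF d[OF n r0]]) (use s t in auto)
      then show "((\<lambda>r. f n r - g n t * r) has_real_derivative g n r - g n t) (at r within ?S)"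
        by (auto intro!: derivative_eq_intros)
      \<comment> \<open>The Lipschitz bound at the times 1 and 0 forces \<open>B\<close> to be
        nonnegative.\<close>
      have "0 \<le> B * \<bar>1 - 0\<bar>" using lip[OF n, of 1 0] by (meson abs_ge_zero order_trans zero_le_one order_refl)
      then have "B * \<bar>r - t\<bar> \<le> B * \<bar>s - t\<bar>" using r by (intro mult_left_mono) auto
      then show "norm (g n r - g n t) \<le> B * \<bar>s - t\<bar>" using lip[OF n r0 t] by simp
    qed auto
    then show ?thesis by (simp add: algebra_simps)
  qed
  have 2: "\<bar>f' s - f' t - g' t * (s - t)\<bar> \<le> B * \<bar>s - t\<bar> * \<bar>s - t\<bar>" if s: "0 \<le> s" for s
  proof (rule LIMSEQ_le_const2)
    show "(\<lambda>n. \<bar>f n s - f n t - g n t * (s - t)\<bar>) \<longlonglongrightarrow> \<bar>f' s - f' t - g' t * (s - t)\<bar>"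
      by (intro tendsto_intros f g s t)
  qed (use 1 s in blast)
  show ?thesis
    unfolding has_field_derivative_iff
  proof (rule LIM_zero_cancel, rule Lim_null_comparison)
    show "\<forall>\<^sub>F s in at t within {0..}. norm ((f' s - f' t) / (s - t) - g' t) \<le> B * \<bar>s - t\<bar>"
    proof (rule eventually_at_topological[THEN iffD2], intro exI[of _ UNIV] conjI ballI impI)
      fix s :: real assume s: "s \<in> UNIV" "s \<noteq> t" "s \<in> {0..}"
      then have "(f' s - f' t) / (s - t) - g' t = (f' s - f' t - g' t * (s - t)) / (s - t)"
        by (simp add: field_simps)
      then show "norm ((f' s - f' t) / (s - t) - g' t) \<le> B * \<bar>s - t\<bar>"
        using 2[of s] s by (simp add: abs_divide pos_divide_le_eq)
    qed auto
    have "((\<lambda>s. B * \<bar>s - t\<bar>) \<longlongrightarrow> B * \<bar>t - t\<bar>) (at t within {0..})" by (intro tendsto_intros)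
    then show "((\<lambda>s. B * \<bar>s - t\<bar>) \<longlongrightarrow> 0) (at t within {0..})" by simp
  qed
qed

section \<open>Heat semigroups with absorption outside finite sets\<close>

context elliptic_graph
begin

text \<open>Weak parabolic maximum principle: after adding \<open>\<epsilon>(1+t)\<close>, a negative minimum over the
  parabolic cylinder would have a nonpositive time derivative and a nonnegative Laplacian.\<close>

lemma comparison_principle:
  assumes F: "finite F"
    and d: "\<And>t x. 0 \<le> t \<Longrightarrow> t \<le> a \<Longrightarrow> x \<in> F \<Longrightarrow> ((\<lambda>t. v t x) has_real_derivative v' t x) (at t within {0..a})"
    and super: "\<And>t x. 0 \<le> t \<Longrightarrow> t \<le> a \<Longrightarrow> x \<in> F \<Longrightarrow> L (v t) x \<le> v' t x"
    and init: "\<And>x. x \<in> F \<Longrightarrow> 0 \<le> v 0 x"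
    and bdry: "\<And>t x. 0 \<le> t \<Longrightarrow> t \<le> a \<Longrightarrow> x \<notin> F \<Longrightarrow> 0 \<le> v t x"
    and \<tau>: "0 \<le> \<tau>" "\<tau> \<le> a"
  shows "0 \<le> v \<tau> x0"
proof (rule ccontr)
  assume "\<not> 0 \<le> v \<tau> x0"
  then have neg: "v \<tau> x0 < 0" by simp
  then have x0: "x0 \<in> F" using bdry \<tau> by force
  \<comment> \<open>Chosen so that the perturbation at time \<open>\<tau>\<close> uses up half of
    the deficit \<open>- v \<tau> x0\<close>; the perturbed value stays negative.\<close>
  define e where "e = - v \<tau> x0 / (2 * (1 + \<tau>))"
  have e: "0 < e" using neg \<tau> by (simp add: e_def divide_neg_pos)
  define z where "z t x = v t x + e * (1 + t)" for t x
  have z\<tau>: "z \<tau> x0 < 0"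
  proof -
    have "e * (1 + \<tau>) = - v \<tau> x0 / 2" using \<tau> by (simp add: e_def field_simps)
    then show ?thesis using neg by (simp add: z_def)
  qed
  have zd: "((\<lambda>t. z t x) has_real_derivative v' t x + e) (at t within {0..\<tau>})"
    if "0 \<le> t" "t \<le> \<tau>" "x \<in> F" for t x
    unfolding z_def using that \<tau>
    by (auto intro!: derivative_eq_intros DERIV_subset[OF d[of t x]])
  have "\<exists>t\<in>{0..\<tau>}. \<forall>s\<in>{0..\<tau>}. z t x \<le> z s x" if "x \<in> F" for x
  proof (rule continuous_attains_inf)
    show "continuous_on {0..\<tau>} (\<lambda>t. z t x)"
      unfolding continuous_on_eq_continuous_within using DERIV_continuous[OF zd] that by auto
  qed (use \<tau> in auto)
  then obtain tm where tm: "\<And>x. x \<in> F \<Longrightarrow> tm x \<in> {0..\<tau>}"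
      "\<And>x s. x \<in> F \<Longrightarrow> s \<in> {0..\<tau>} \<Longrightarrow> z (tm x) x \<le> z s x" by metis
  \<comment> \<open>The minimum over the cylinder is found by minimising over time at each vertex
    and then over the finite set \<open>F\<close>.\<close>
  define x1 where "x1 = arg_min_on (\<lambda>x. z (tm x) x) F"
  have x1: "x1 \<in> F" "\<And>x. x \<in> F \<Longrightarrow> z (tm x1) x1 \<le> z (tm x) x"
    using F x0 arg_min_if_finite(1)[of F "\<lambda>x. z (tm x) x"] arg_min_least[of F _ "\<lambda>x. z (tm x) x"]
    unfolding x1_def by auto
  define t1 where "t1 = tm x1"
  have t1: "0 \<le> t1" "t1 \<le> \<tau>" using tm(1)[OF x1(1)] by (auto simp: t1_def)
  have min: "z t1 x1 \<le> z s x" if "x \<in> F" "s \<in> {0..\<tau>}" for s x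
    using x1(2)[OF that(1)] tm(2)[OF that] by (simp add: t1_def)
  have zneg: "z t1 x1 < 0" using min[OF x0, of \<tau>] z\<tau> \<tau> by simp
  have "t1 \<noteq> 0" using zneg init[OF x1(1)] e by (auto simp: z_def)
  then have t1p: "0 < t1" using t1 by simp
  have "0 \<le> L (v t1) x1"
    unfolding laplacian_def
  proof (intro mult_nonneg_nonneg sum_nonneg)
    fix y assume "y \<in> nbh x1"
    have "v t1 x1 \<le> v t1 y"
    proof (cases "y \<in> F")
      case True
      then show ?thesis using min[OF True, of t1] t1 by (simp add: z_def)
    next
      case False
      have "0 \<le> e * (1 + t1)" using e t1 by simp
      then show ?thesis using bdry[of t1 y] False t1 \<tau> zneg by (simp add: z_def)
    qed
    then show "0 \<le> v t1 y - v t1 x1" by simp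
  qed (use m_pos[of x1] b_nonneg in auto)
  then have "0 < v' t1 x1 + e" using super[of t1 x1] x1 t1 \<tau> e by auto
  from has_real_derivative_pos_inc_left[OF zd[OF t1 x1(1)] this] obtain \<delta> where
    \<delta>: "0 < \<delta>" "\<And>h. 0 < h \<Longrightarrow> t1 - h \<in> {0..\<tau>} \<Longrightarrow> h < \<delta> \<Longrightarrow> z (t1 - h) x1 < z t1 x1" by blast
  \<comment> \<open>Going back by \<open>min (\<delta> / 2) t1\<close> keeps the time nonnegative
    and gives a value below the minimum.\<close>
  have "z (t1 - min (\<delta> / 2) t1) x1 < z t1 x1" using \<delta>(1) t1 t1p by (intro \<delta>(2)) auto
  moreover have "z t1 x1 \<le> z (t1 - min (\<delta> / 2) t1) x1" using \<delta>(1) t1 t1p by (intro min x1(1)) auto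
  ultimately show False by simp
qed

text \<open>The Dirichlet heat semigroup of \<open>F\<close>: the diagonal entries carry the full
  weighted degree, including edges that leave \<open>F\<close>, so heat leaving \<open>F\<close> is
  lost.\<close>

definition PF :: "'a set \<Rightarrow> real \<Rightarrow> ('a \<Rightarrow> real) \<Rightarrow> 'a \<Rightarrow> real" where
  "PF F = mat_exp F (\<lambda>x y. L (indicator {y}) x)"

lemma laplacian_sum_fun:
  assumes "finite F" shows "L (\<lambda>x. \<Sum>y\<in>F. c y * g y x) x = (\<Sum>y\<in>F. c y * L (g y) x)"
  using assms
proof (induction F rule: finite_induct)
  case empty then show ?case using laplacian_const[of 0 x] by simp
next
  case (insert a F) then show ?case by (simp add: laplacian_add laplacian_scale)
qed

lemma laplacian_expand:
  assumes "finite F" "\<And>y. y \<notin> F \<Longrightarrow> u y = 0"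
  shows "L u x = (\<Sum>y\<in>F. L (indicator {y}) x * u y)"
proof -
  have "u = (\<lambda>z. \<Sum>y\<in>F. u y * indicator {y} z)"
  proof
    fix z
    have "(\<Sum>y\<in>F. u y * indicator {y} z) = (\<Sum>y\<in>F. if y = z then u y else 0)"
      by (rule sum.cong) (auto simp: indicator_def)
    also have "\<dots> = u z" using assms by (simp add: sum.delta)
    finally show "u z = (\<Sum>y\<in>F. u y * indicator {y} z)" ..
  qed
  then have "L u x = L (\<lambda>z. \<Sum>y\<in>F. u y * indicator {y} z) x" by simp
  also have "\<dots> = (\<Sum>y\<in>F. u y * L (indicator {y}) x)" by (rule laplacian_sum_fun[OF assms(1)])
  finally show ?thesis by (simp add: mult.commute)
qed

lemma PF_outside: "x \<notin> F \<Longrightarrow> PF F t u x = 0"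
  by (simp add: PF_def mat_exp_outside)

lemma PF_zero: "PF F 0 u x = (if x \<in> F then u x else 0)"
  by (simp add: PF_def mat_exp_zero)

lemma PF_deriv:
  assumes "finite F" "x \<in> F"
  shows "((\<lambda>t. PF F t u x) has_real_derivative L (PF F t u) x) (at t within S)"
proof -
  have "L (PF F t u) x = mat_op F (\<lambda>x y. L (indicator {y}) x) (PF F t u) x"
    using assms laplacian_expand[of F "PF F t u" x] by (simp add: PF_outside mat_op_def)
  then show ?thesis
    using mat_exp_deriv[OF assms(1), of "\<lambda>x y. L (indicator {y}) x" u x t]
    by (simp add: PF_def[symmetric] has_field_derivative_at_within)
qed

lemma PF_nonneg:
  assumes "finite F" "\<And>x. x \<in> F \<Longrightarrow> 0 \<le> u x" "0 \<le> t"
  shows "0 \<le> PF F t u x"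
  by (rule comparison_principle[where F=F and a=t and v="\<lambda>t. PF F t u" and v'="\<lambda>t. L (PF F t u)"])
     (use assms in \<open>auto simp: PF_zero PF_outside intro: PF_deriv\<close>)

lemma PF_le_one:
  assumes "finite F" "\<And>x. x \<in> F \<Longrightarrow> u x \<le> 1" "0 \<le> t"
  shows "PF F t u x \<le> 1"
proof -
  have "0 \<le> 1 - PF F t u x"
    by (rule comparison_principle[where F=F and a=t and v="\<lambda>t x. 1 - PF F t u x"
          and v'="\<lambda>t x. - L (PF F t u) x"])
       (use assms in \<open>auto simp: PF_zero PF_outside laplacian_diff laplacian_const
          intro!: derivative_eq_intros PF_deriv\<close>)
  then show ?thesis by simp
qed

text \<open>On \<open>F\<close> the difference solves the heat equation, and outside
  \<open>F\<close> it is the nonnegative function \<open>PF F' t u\<close>; the comparison principle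
  on the smaller cylinder applies.\<close>

lemma PF_mono:
  assumes "finite F'" "F \<subseteq> F'" "\<And>x. x \<in> F' \<Longrightarrow> 0 \<le> u x" "0 \<le> t"
  shows "PF F t u x \<le> PF F' t u x"
proof -
  have F: "finite F" using assms finite_subset by blast
  have "0 \<le> PF F' t u x - PF F t u x"
    by (rule comparison_principle[where F=F and a=t and v="\<lambda>t x. PF F' t u x - PF F t u x"
          and v'="\<lambda>t x. L (PF F' t u) x - L (PF F t u) x"])
       (use assms F in \<open>auto simp: PF_zero PF_outside laplacian_diff PF_nonneg subsetD
          intro!: derivative_eq_intros PF_deriv\<close>)
  then show ?thesis by simp
qed

text \<open>Linearity and the semigroup law follow from this by recognising solutions, without
  touching the exponential series.\<close>

lemma PF_unique:
  assumes "finite F"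
    and "\<And>t x. 0 \<le> t \<Longrightarrow> t \<le> a \<Longrightarrow> x \<in> F \<Longrightarrow> ((\<lambda>t. v t x) has_real_derivative L (v t) x) (at t within {0..a})"
    and "\<And>t x. 0 \<le> t \<Longrightarrow> t \<le> a \<Longrightarrow> x \<notin> F \<Longrightarrow> v t x = 0"
    and "\<And>x. x \<in> F \<Longrightarrow> v 0 x = u x" "0 \<le> a"
  shows "v a x = PF F a u x"
proof -
  have "0 \<le> v a x - PF F a u x"
    by (rule comparison_principle[where F=F and a=a and v="\<lambda>t x. v t x - PF F t u x"
          and v'="\<lambda>t x. L (v t) x - L (PF F t u) x"])
       (use assms in \<open>auto simp: PF_zero PF_outside laplacian_diff intro!: derivative_eq_intros PF_deriv\<close>)
  moreover have "0 \<le> PF F a u x - v a x"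
    by (rule comparison_principle[where F=F and a=a and v="\<lambda>t x. PF F t u x - v t x"
          and v'="\<lambda>t x. L (PF F t u) x - L (v t) x"])
       (use assms in \<open>auto simp: PF_zero PF_outside laplacian_diff intro!: derivative_eq_intros PF_deriv\<close>)
  ultimately show ?thesis by simp
qed

lemma PF_expand:
  assumes F: "finite F" and "0 \<le> t"
  shows "PF F t u x = (\<Sum>y\<in>F. u y * PF F t (indicator {y}) x)"
  by (rule PF_unique[symmetric, OF F, where v="\<lambda>t x. \<Sum>y\<in>F. u y * PF F t (indicator {y}) x"])
     (use assms in \<open>auto simp: PF_zero PF_outside laplacian_sum_fun indicator_def if_distrib sum.delta
        cong: if_cong intro!: DERIV_sum DERIV_cmult PF_deriv\<close>)

lemma PF_semigroup:
  assumes F: "finite F" and "0 \<le> s" "0 \<le> t"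
  shows "PF F (s + t) u x = PF F s (PF F t u) x"
  by (rule PF_unique[OF F, where v="\<lambda>s x. PF F (s + t) u x"])
     (use assms in \<open>auto simp: PF_outside DERIV_shift intro: DERIV_subset[OF PF_deriv]
       intro!: DERIV_shift[THEN iffD1] has_field_derivative_at_within[OF DERIV_shift[THEN iffD1]] PF_deriv\<close>)

lemma PF_Cc: "finite F \<Longrightarrow> PF F t u \<in> Cc"
  unfolding Cc_def mem_Collect_eq by (rule finite_subset[of _ F]) (auto intro: ccontr simp: PF_outside)

text \<open>The pairing of the solution from \<open>u\<close> at time s with that from
  \<open>g\<close> at time t - s has zero derivative in s, by symmetry of the Laplacian; compare s =
  t and s = 0.\<close>

lemma PF_symmetric:
  assumes F: "finite F" and t: "0 \<le> t"
  shows "(\<Sum>x\<in>F. PF F t u x * g x * m x) = (\<Sum>x\<in>F. u x * PF F t g x * m x)"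
proof -
  let ?\<phi> = "\<lambda>s. \<Sum>x\<in>F. PF F s u x * PF F (t - s) g x * m x"
  have z: "(\<Sum>x\<in>F. L (PF F s u) x * PF F (t - s) g x * m x)
      = (\<Sum>x\<in>F. PF F s u x * L (PF F (t - s) g) x * m x)" for s
  proof -
    have "l2_inner m (PF F (t - s) g) (L (PF F s u)) = (\<Sum>x\<in>F. PF F (t - s) g x * L (PF F s u) x * m x)"
      "l2_inner m (PF F s u) (L (PF F (t - s) g)) = (\<Sum>x\<in>F. PF F s u x * L (PF F (t - s) g) x * m x)"
      by (rule M.l2_inner_finite_support[OF F]; simp add: PF_outside)+
    then show ?thesis
      using gen_dom_symmetric[OF Cc_gen_dom[OF PF_Cc[OF F]] Cc_gen_dom[OF PF_Cc[OF F]], of s u "t - s" g]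
      by (simp add: M.l2_inner_commute[of "L (PF F s u)"] mult.commute)
  qed
  have "(?\<phi> has_real_derivative 0) (at s)" for s
  proof -
    have 1: "((\<lambda>s. PF F (t - s) g x) has_real_derivative L (PF F (t - s) g) x * (0 - 1)) (at s)" if "x \<in> F" for x
      by (rule DERIV_chain2[OF PF_deriv[OF F that]]) (auto intro!: derivative_eq_intros)
    have "((\<lambda>s. PF F s u x * PF F (t - s) g x * m x) has_real_derivative
        L (PF F s u) x * PF F (t - s) g x * m x - PF F s u x * L (PF F (t - s) g) x * m x) (at s)" if "x \<in> F" for x
      by (rule derivative_eq_intros PF_deriv[OF F that] 1[OF that] refl)+ (simp add: algebra_simps)
    then have "(?\<phi> has_real_derivative (\<Sum>x\<in>F. L (PF F s u) x * PF F (t - s) g x * m x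
        - PF F s u x * L (PF F (t - s) g) x * m x)) (at s)"
      by (intro DERIV_sum)
    then show ?thesis by (simp add: sum_subtractf z)
  qed
  then have "?\<phi> t = ?\<phi> 0" by (intro DERIV_isconst_all allI)
  then show ?thesis by (simp add: PF_zero F cong: sum.cong)
qed

section \<open>The minimal heat kernel\<close>

definition Fn :: "nat \<Rightarrow> 'a set" where "Fn n = {x. to_nat x < n}"

lemma finite_Fn: "finite (Fn n)"
proof -
  have "Fn n = to_nat -` {..<n}" by (auto simp: Fn_def)
  then show ?thesis by (simp add: finite_vimageI)
qed

lemma Fn_mono: "n \<le> n' \<Longrightarrow> Fn n \<subseteq> Fn n'"
  by (auto simp: Fn_def)

lemma eventually_Fn: "\<forall>\<^sub>F n in sequentially. x \<in> Fn n"
  by (auto simp: Fn_def eventually_sequentially intro!: exI[of _ "Suc (to_nat x)"])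

lemma eventually_subset_Fn: "finite G \<Longrightarrow> \<forall>\<^sub>F n in sequentially. G \<subseteq> Fn n"
  by (simp add: subset_iff eventually_ball_finite_distrib Ball_def[symmetric] eventually_Fn)

definition trunc :: "nat \<Rightarrow> ('a \<Rightarrow> real) \<Rightarrow> 'a \<Rightarrow> real" where
  "trunc n f x = (if x \<in> Fn n then f x else 0)"

lemma trunc_Cc: "trunc n f \<in> Cc"
  unfolding Cc_def mem_Collect_eq
  by (rule finite_subset[OF _ finite_Fn[of n]]) (auto simp: trunc_def)

lemma trunc_lim:
  assumes "f \<in> l2 m"
  shows "(\<lambda>n. l2_norm m (\<lambda>x. trunc n f x - f x)) \<longlonglongrightarrow> 0"
proof (rule M.l2_dominated_convergence[OF assms])
  show "(\<lambda>n. trunc n f x - f x) \<longlonglongrightarrow> 0" for x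
    by (rule tendsto_eventually) (use eventually_Fn[of x] in eventually_elim, simp add: trunc_def)
qed (auto simp: trunc_def)

definition qn :: "nat \<Rightarrow> real \<Rightarrow> 'a \<Rightarrow> 'a \<Rightarrow> real" where
  "qn n t x y = PF (Fn n) t (indicator {y}) x"

text \<open>\<open>q t x y\<close> is the transition probability, that is \<open>p\<^sub>t(x,y) m(y)\<close>.\<close>

definition q :: "real \<Rightarrow> 'a \<Rightarrow> 'a \<Rightarrow> real" where
  "q t x y = lim (\<lambda>n. qn n t x y)"

lemma qn_nonneg: "0 \<le> t \<Longrightarrow> 0 \<le> qn n t x y"
  unfolding qn_def by (rule PF_nonneg[OF finite_Fn]) auto

lemma qn_le_one: "0 \<le> t \<Longrightarrow> qn n t x y \<le> 1"
  unfolding qn_def by (rule PF_le_one[OF finite_Fn]) (auto simp: indicator_def)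

lemma qn_lim:
  assumes "0 \<le> t"
  shows "(\<lambda>n. qn n t x y) \<longlonglongrightarrow> q t x y"
proof -
  have "incseq (\<lambda>n. qn n t x y)"
    unfolding incseq_def qn_def using assms by (auto intro!: PF_mono finite_Fn Fn_mono)
  moreover have "\<forall>n. qn n t x y \<le> 1" using qn_le_one[OF assms] by blast
  ultimately obtain l where "(\<lambda>n. qn n t x y) \<longlonglongrightarrow> l" by (rule incseq_convergent)
  then show ?thesis by (simp add: q_def limI)
qed

lemma qn_le_q:
  assumes "0 \<le> t" shows "qn n t x y \<le> q t x y"
proof (rule incseq_le[OF _ qn_lim[OF assms]])
  show "incseq (\<lambda>n. qn n t x y)"
    unfolding incseq_def qn_def using assms by (auto intro!: PF_mono finite_Fn Fn_mono)
qed

lemma q_nonneg: "0 \<le> t \<Longrightarrow> 0 \<le> q t x y"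
  using qn_nonneg qn_le_q order_trans by blast

lemma q_le_one: "0 \<le> t \<Longrightarrow> q t x y \<le> 1"
  by (rule LIMSEQ_le_const2[OF qn_lim]) (auto simp: qn_le_one)

lemma q_sym:
  assumes "0 \<le> t"
  shows "q t x y * m x = q t y x * m y"
proof (rule tendsto_unique[OF sequentially_bot])
  show "(\<lambda>n. qn n t x y * m x) \<longlonglongrightarrow> q t x y * m x" by (intro tendsto_intros qn_lim assms)
  have "\<forall>\<^sub>F n in sequentially. qn n t y x * m y = qn n t x y * m x"
    using eventually_Fn[of x] eventually_Fn[of y]
  proof eventually_elim
    case (elim n)
    have "(\<Sum>z\<in>Fn n. PF (Fn n) t (indicator {y}) z * indicator {x} z * m z)
      = (\<Sum>z\<in>Fn n. indicator {y} z * PF (Fn n) t (indicator {x}) z * m z)"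
      by (rule PF_symmetric[OF finite_Fn assms])
    moreover have "(\<Sum>z\<in>Fn n. PF (Fn n) t (indicator {y}) z * indicator {x} z * m z) = qn n t x y * m x"
      using elim finite_Fn sum.mono_neutral_right[of "Fn n" "{x}" "\<lambda>z. PF (Fn n) t (indicator {y}) z * indicator {x} z * m z"]
      by (simp add: qn_def indicator_def)
    moreover have "(\<Sum>z\<in>Fn n. indicator {y} z * PF (Fn n) t (indicator {x}) z * m z) = qn n t y x * m y"
      using elim finite_Fn sum.mono_neutral_right[of "Fn n" "{y}" "\<lambda>z. indicator {y} z * PF (Fn n) t (indicator {x}) z * m z"]
      by (simp add: qn_def indicator_def)
    ultimately show ?case by simp
  qed
  then show "(\<lambda>n. qn n t x y * m x) \<longlonglongrightarrow> q t y x * m y"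
    using tendsto_mult[OF qn_lim[OF assms, of y x] tendsto_const[of "m y"]] by (rule Lim_transform_eventually[rotated])
qed

text \<open>Summing over \<open>Fn n\<close> gives the solution with initial value 1, which the
  maximum principle keeps below 1. An inequality is the natural form, as heat may escape to
  infinity.\<close>

lemma q_sum_le:
  assumes "0 \<le> t" "finite G"
  shows "(\<Sum>y\<in>G. q t x y) \<le> 1"
proof (rule tendsto_upperbound)
  show "(\<lambda>n. \<Sum>y\<in>G. qn n t x y) \<longlonglongrightarrow> (\<Sum>y\<in>G. q t x y)" by (intro tendsto_sum qn_lim assms)
  show "\<forall>\<^sub>F n in sequentially. (\<Sum>y\<in>G. qn n t x y) \<le> 1"
    using eventually_subset_Fn[OF assms(2)]
  proof eventually_elim
    case (elim n)
    have "(\<Sum>y\<in>G. qn n t x y) \<le> (\<Sum>y\<in>Fn n. qn n t x y)"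
      using elim by (intro sum_mono2 finite_Fn qn_nonneg assms)
    also have "\<dots> = PF (Fn n) t (\<lambda>_. 1) x"
      using PF_expand[OF finite_Fn assms(1), of n "\<lambda>_. 1" x] by (simp add: qn_def)
    also have "\<dots> \<le> 1" by (rule PF_le_one[OF finite_Fn]) (use assms in auto)
    finally show ?case .
  qed
qed simp

lemma q_summable: "0 \<le> t \<Longrightarrow> q t x summable_on UNIV"
  by (rule nonneg_bdd_above_summable_on) (auto intro!: bdd_aboveI2[where M=1] q_sum_le q_nonneg)

lemma q_infsum_le: "0 \<le> t \<Longrightarrow> infsum (q t x) UNIV \<le> 1"
  by (rule infsum_le_finite_sums[OF q_summable]) (auto intro: q_sum_le)

lemma q_chapman_kolmogorov:
  assumes s: "0 \<le> s" and t: "0 \<le> t"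
  shows "q (s + t) x y = (\<Sum>\<^sub>\<infinity>z. q s x z * q t z y)"
proof (rule LIMSEQ_unique)
  show "(\<lambda>n. qn n (s + t) x y) \<longlonglongrightarrow> q (s + t) x y" using assms by (intro qn_lim) auto
  have "(\<lambda>n. \<Sum>\<^sub>\<infinity>z. qn n s x z * qn n t z y) \<longlonglongrightarrow> (\<Sum>\<^sub>\<infinity>z. q s x z * q t z y)"
  proof (rule infsum_dominated_convergence(2))
    show "q s x summable_on UNIV" using s by (rule q_summable)
    show "\<bar>qn n s x z * qn n t z y\<bar> \<le> q s x z" for n z
      using mult_mono[OF qn_le_q[OF s] qn_le_one[OF t] q_nonneg[OF s] qn_nonneg[OF t]] qn_nonneg[OF s] qn_nonneg[OF t]
      by (simp add: abs_mult)
    show "(\<lambda>n. qn n s x z * qn n t z y) \<longlonglongrightarrow> q s x z * q t z y" for z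
      by (intro tendsto_mult qn_lim assms)
  qed
  moreover have "(\<Sum>\<^sub>\<infinity>z. qn n s x z * qn n t z y) = qn n (s + t) x y" for n
  proof -
    have "(\<Sum>\<^sub>\<infinity>z. qn n s x z * qn n t z y) = (\<Sum>\<^sub>\<infinity>z\<in>Fn n. qn n s x z * qn n t z y)"
      by (rule infsum_cong_neutral) (auto simp: qn_def PF_outside)
    also have "\<dots> = (\<Sum>z\<in>Fn n. qn n t z y * qn n s x z)" by (simp add: finite_Fn mult.commute)
    also have "\<dots> = qn n (s + t) x y"
      unfolding qn_def PF_semigroup[OF finite_Fn assms]
      by (rule PF_expand[OF finite_Fn s, symmetric])
    finally show ?thesis .
  qed
  ultimately show "(\<lambda>n. qn n (s + t) x y) \<longlonglongrightarrow> (\<Sum>\<^sub>\<infinity>z. q s x z * q t z y)" by simp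
qed

lemma q_zero: "q 0 x y = indicator {y} x"
proof (rule LIMSEQ_unique[OF qn_lim])
  show "(\<lambda>n. qn n 0 x y) \<longlonglongrightarrow> indicator {y} x"
    by (rule tendsto_eventually) (use eventually_Fn[of x] in eventually_elim, simp add: qn_def PF_zero)
qed simp

text \<open>The kernels take values in [0,1], so each is Lipschitz in time with constant the
  weighted degree \<open>D z\<close>. Hence their Laplacians at \<open>x\<close> are Lipschitz with
  a constant \<open>B\<close> uniform in n, as the limit lemma demands.\<close>

lemma q_deriv:
  assumes t: "0 \<le> t"
  shows "((\<lambda>t. q t x y) has_real_derivative L (\<lambda>z. q t z y) x) (at t within {0..})"
proof -
  define D where "D z = 1 / m z * (\<Sum>y\<in>nbh z. b z y)" for z
  define B where "B = 1 / m x * (\<Sum>z\<in>nbh x. b x z * (D z + D x))"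
  have D0: "0 \<le> D z" for z unfolding D_def using m_pos[of z] b_nonneg by (intro mult_nonneg_nonneg sum_nonneg) auto
  have LD: "\<bar>L u z\<bar> \<le> D z" if "\<And>x. 0 \<le> u x" "\<And>x. u x \<le> 1" for u z
  proof -
    have "\<bar>\<Sum>y\<in>nbh z. b z y * (u y - u z)\<bar> \<le> (\<Sum>y\<in>nbh z. b z y * 1)"
    proof (rule order_trans[OF sum_abs sum_mono])
      fix y
      have "\<bar>u y - u z\<bar> \<le> 1" using that[of y] that[of z] by auto
      then show "\<bar>b z y * (u y - u z)\<bar> \<le> b z y * 1"
        using b_nonneg[of z y] by (simp add: abs_mult mult_left_le)
    qed
    then show ?thesis
      using m_pos[of z] by (simp add: laplacian_def D_def abs_mult divide_right_mono)
  qed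
  have lip1: "\<bar>qn n s z y - qn n t z y\<bar> \<le> D z * \<bar>s - t\<bar>" if st: "0 \<le> s" "0 \<le> t" for n s t z
  proof (cases "z \<in> Fn n")
    case True
    have "norm (qn n s z y - qn n t z y) \<le> D z * norm (s - t)"
    proof (rule field_differentiable_bound[where S="{0..}" and f'="\<lambda>r. L (\<lambda>z. qn n r z y) z"])
      show "((\<lambda>a. qn n a z y) has_field_derivative L (\<lambda>z. qn n r z y) z) (at r within {0..})" for r
        unfolding qn_def by (rule PF_deriv[OF finite_Fn True])
      show "norm (L (\<lambda>z. qn n r z y) z) \<le> D z" if "r \<in> {0..}" for r
        using that qn_nonneg[of r n] qn_le_one[of r n] by (simp add: LD)
    qed (use st in auto)
    then show ?thesis by simp
  next
    case False
    then show ?thesis using D0[of z] by (simp add: qn_def PF_outside)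
  qed
  obtain N where N: "x \<in> Fn N" using eventually_happens'[OF sequentially_bot eventually_Fn] by blast
  show ?thesis
  proof (rule has_real_derivative_limit[where f="\<lambda>n t. qn n t x y" and g="\<lambda>n t. L (\<lambda>z. qn n t z y) x" and N=N and B=B])
    fix n and s t :: real assume n: "N \<le> n" and st: "0 \<le> s" "0 \<le> t"
    have xn: "x \<in> Fn n" using N Fn_mono[OF n] by blast
    show "((\<lambda>t. qn n t x y) has_real_derivative L (\<lambda>z. qn n t z y) x) (at t within {0..})"
      unfolding qn_def by (rule PF_deriv[OF finite_Fn xn])
    have "L (\<lambda>z. qn n s z y) x - L (\<lambda>z. qn n t z y) x
        = 1 / m x * (\<Sum>z\<in>nbh x. b x z * ((qn n s z y - qn n t z y) - (qn n s x y - qn n t x y)))"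
      unfolding laplacian_diff[symmetric] by (simp add: laplacian_def)
    moreover have "\<bar>\<Sum>z\<in>nbh x. b x z * ((qn n s z y - qn n t z y) - (qn n s x y - qn n t x y))\<bar>
        \<le> (\<Sum>z\<in>nbh x. b x z * (D z + D x) * \<bar>s - t\<bar>)"
    proof (rule order_trans[OF sum_abs sum_mono])
      fix z
      have "\<bar>(qn n s z y - qn n t z y) - (qn n s x y - qn n t x y)\<bar> \<le> (D z + D x) * \<bar>s - t\<bar>"
        using lip1[OF st, of n z] lip1[OF st, of n x] by (simp add: algebra_simps)
      then show "\<bar>b x z * ((qn n s z y - qn n t z y) - (qn n s x y - qn n t x y))\<bar> \<le> b x z * (D z + D x) * \<bar>s - t\<bar>"
        unfolding abs_mult mult.assoc using b_nonneg[of x z] by (simp add: mult_left_mono)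
    qed
    ultimately show "\<bar>L (\<lambda>z. qn n s z y) x - L (\<lambda>z. qn n t z y) x\<bar> \<le> B * \<bar>s - t\<bar>"
      using m_pos[of x] by (simp add: B_def abs_mult sum_distrib_right divide_right_mono)
  qed (use t m_pos[of x] in \<open>auto intro!: qn_lim tendsto_intros simp: laplacian_def\<close>)
qed

section \<open>The operators of the minimal semigroup on square summable functions\<close>

definition T :: "real \<Rightarrow> ('a \<Rightarrow> real) \<Rightarrow> 'a \<Rightarrow> real" where
  "T t f x = (\<Sum>\<^sub>\<infinity>y. q t x y * f y)"

text \<open>As entries are at most 1, squares are dominated by the entries, and symmetry converts a
  weighted column into a summable row.\<close>

lemma q_col_l2:
  assumes "0 \<le> t" shows "(\<lambda>y. q t y x) \<in> l2 m"
  unfolding l2_def mem_Collect_eq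
proof (rule summable_on_comparison_test)
  show "(\<lambda>y. q t x y * m x) summable_on UNIV" by (intro summable_on_cmult_left q_summable assms)
  show "(q t y x)\<^sup>2 * m y \<le> q t x y * m x" for y
  proof -
    have "(q t y x)\<^sup>2 \<le> q t y x"
      using q_nonneg[OF assms] q_le_one[OF assms] by (simp add: power2_eq_square mult_left_le)
    then show ?thesis unfolding q_sym[OF assms, of x y] using m_pos[of y] by (intro mult_right_mono) auto
  qed
qed (auto intro!: mult_nonneg_nonneg less_imp_le[OF m_pos])

lemma T_inner:
  assumes "0 \<le> t" shows "T t f x = l2_inner m (\<lambda>y. q t y x) f / m x"
proof -
  have "l2_inner m (\<lambda>y. q t y x) f = (\<Sum>\<^sub>\<infinity>y. m x * (q t x y * f y))"
    unfolding l2_inner_def using q_sym[OF assms, of x] by (intro infsum_cong) (metis mult.commute mult.left_commute)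
  also have "\<dots> = m x * T t f x" unfolding T_def by (rule infsum_cmult_right')
  finally show ?thesis using m_pos[of x] by (simp add: field_simps)
qed

lemma T_finite:
  assumes "finite G" "\<And>y. y \<notin> G \<Longrightarrow> f y = 0"
  shows "T t f x = (\<Sum>y\<in>G. f y * q t x y)"
proof -
  have "T t f x = (\<Sum>\<^sub>\<infinity>y\<in>G. q t x y * f y)"
    unfolding T_def using assms by (intro infsum_cong_neutral) auto
  then show ?thesis using assms by (simp add: mult.commute)
qed

lemma T_indicator: "T t (indicator {y}) x = q t x y"
  using T_finite[of "{y}" "indicator {y}"] by simp

lemma T_zero: "T 0 f x = f x"
proof -
  have "T 0 f x = (\<Sum>\<^sub>\<infinity>y\<in>{x}. q 0 x y * f y)"
    unfolding T_def by (intro infsum_cong_neutral) (auto simp: q_zero)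
  then show ?thesis by (simp add: q_zero)
qed

lemma T_lincomb:
  assumes "0 \<le> t" "f \<in> l2 m" "g \<in> l2 m"
  shows "T t (\<lambda>x. \<alpha> * f x + \<beta> * g x) x = \<alpha> * T t f x + \<beta> * T t g x"
  using assms M.l2_inner_add_right[OF M.l2_scale[OF assms(2)] M.l2_scale[OF assms(3)] q_col_l2[OF assms(1)]]
  by (simp add: T_inner M.l2_inner_scale_right add_divide_distrib)

lemma T_diff:
  assumes "0 \<le> t" "f \<in> l2 m" "g \<in> l2 m"
  shows "T t (\<lambda>x. f x - g x) x = T t f x - T t g x"
  using T_lincomb[OF assms, of 1 "-1"] by simp

text \<open>Cauchy-Schwarz against the constant 1, for the weight \<open>q t x\<close> of total mass
  at most 1.\<close>

lemma T_jensen: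
  assumes "0 \<le> t" "(\<lambda>y. q t x y * (f y)\<^sup>2) summable_on UNIV"
  shows "(T t f x)\<^sup>2 \<le> T t (\<lambda>y. (f y)\<^sup>2) x"
proof -
  interpret Q: weight "q t x" by unfold_locales (rule q_nonneg[OF assms(1)])
  have f: "f \<in> l2 (q t x)" using assms(2) by (simp add: l2_def mult.commute)
  have o: "(\<lambda>_. 1) \<in> l2 (q t x)" using q_summable[OF assms(1)] by (simp add: l2_def)
  have "\<bar>T t f x\<bar>\<^sup>2 \<le> (l2_norm (q t x) f * l2_norm (q t x) (\<lambda>_. 1))\<^sup>2"
    using Q.l2_cauchy_schwarz[OF f o] by (intro power_mono) (auto simp: T_def l2_inner_def mult.commute)
  also have "\<dots> = l2_inner (q t x) f f * l2_inner (q t x) (\<lambda>_. 1) (\<lambda>_. 1)"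
    by (simp add: power_mult_distrib Q.l2_norm_sq)
  also have "\<dots> \<le> l2_inner (q t x) f f * 1"
    using q_infsum_le[OF assms(1)] by (intro mult_left_mono Q.l2_inner_self_nonneg) (simp add: l2_inner_def)
  also have "\<dots> = T t (\<lambda>y. (f y)\<^sup>2) x"
    by (simp add: T_def l2_inner_def power2_eq_square mult.commute)
  finally show ?thesis by simp
qed

lemma infsum_finite_sum:
  fixes f :: "'i \<Rightarrow> 'c \<Rightarrow> real"
  assumes "finite G" "\<And>i. i \<in> G \<Longrightarrow> f i summable_on A"
  shows "(\<lambda>y. \<Sum>i\<in>G. f i y) summable_on A" "infsum (\<lambda>y. \<Sum>i\<in>G. f i y) A = (\<Sum>i\<in>G. infsum (f i) A)"
  using assms
proof (induction G rule: finite_induct)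
  case (insert a G)
  { case 1 show ?case using insert 1 by (simp add: summable_on_add) }
  { case 2 show ?case using insert 2 by (simp add: infsum_add) }
qed auto

text \<open>Jensen moves the square inside; symmetry of the kernel turns the sum over the first
  variable into a row sum, which is at most 1.\<close>

lemma T_contraction:
  assumes t: "0 \<le> t" and f: "f \<in> l2 m"
  shows "T t f \<in> l2 m" "l2_norm m (T t f) \<le> l2_norm m f"
proof -
  have fs: "(\<lambda>y. (f y)\<^sup>2 * m y) summable_on UNIV" using f by (simp add: l2_def)
  have s: "(\<lambda>y. (f y)\<^sup>2 * m y * q t y x) summable_on UNIV" for x
    by (rule summable_on_comparison_test[OF fs])
       (use q_nonneg[OF t] q_le_one[OF t] m_pos in \<open>auto intro!: mult_left_le mult_nonneg_nonneg simp: less_imp_le\<close>)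
  have eq: "(\<lambda>y. (f y)\<^sup>2 * m y * q t y x) = (\<lambda>y. m x * (q t x y * (f y)\<^sup>2))" for x
    using q_sym[OF t, of x] by (auto simp: fun_eq_iff mult.commute mult.left_commute)
  have s': "(\<lambda>y. q t x y * (f y)\<^sup>2) summable_on UNIV" for x
    using s[of x] m_pos[of x] unfolding eq by (simp add: summable_on_cmult_right')
  have "(\<Sum>x\<in>G. (T t f x)\<^sup>2 * m x) \<le> (l2_norm m f)\<^sup>2" if G: "finite G" for G
  proof -
    have "(\<Sum>x\<in>G. (T t f x)\<^sup>2 * m x) \<le> (\<Sum>x\<in>G. m x * T t (\<lambda>y. (f y)\<^sup>2) x)"
      using T_jensen[OF t s'] m_pos by (intro sum_mono) (simp add: mult.commute mult_left_mono less_imp_le)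
    also have "\<dots> = (\<Sum>x\<in>G. \<Sum>\<^sub>\<infinity>y. (f y)\<^sup>2 * m y * q t y x)"
      unfolding eq T_def by (simp add: infsum_cmult_right')
    also have "\<dots> = (\<Sum>\<^sub>\<infinity>y. \<Sum>x\<in>G. (f y)\<^sup>2 * m y * q t y x)"
      by (rule infsum_finite_sum(2)[symmetric, OF G s])
    also have "\<dots> \<le> (\<Sum>\<^sub>\<infinity>y. (f y)\<^sup>2 * m y)"
    proof (rule infsum_mono[OF infsum_finite_sum(1)[OF G s] fs])
      fix y
      show "(\<Sum>x\<in>G. (f y)\<^sup>2 * m y * q t y x) \<le> (f y)\<^sup>2 * m y"
        unfolding sum_distrib_left[symmetric] using q_sum_le[OF t G, of y] m_pos[of y]
        by (intro mult_left_le mult_nonneg_nonneg) auto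
    qed
    also have "\<dots> = (l2_norm m f)\<^sup>2"
      unfolding M.l2_norm_sq l2_inner_def by (simp add: power2_eq_square)
    finally show ?thesis .
  qed
  from M.l2_boundI[OF this M.l2_norm_nonneg] show "T t f \<in> l2 m" "l2_norm m (T t f) \<le> l2_norm m f" by auto
qed

lemma T_trunc_lim:
  assumes "0 \<le> t" "f \<in> l2 m"
  shows "(\<lambda>n. l2_norm m (\<lambda>x. T t (trunc n f) x - T t f x)) \<longlonglongrightarrow> 0"
proof (rule Lim_null_comparison[OF _ trunc_lim[OF assms(2)]])
  have "l2_norm m (\<lambda>x. T t (trunc n f) x - T t f x) \<le> l2_norm m (\<lambda>x. trunc n f x - f x)" for n
    using T_contraction(2)[OF assms(1) M.l2_diff[OF Cc_l2[OF trunc_Cc] assms(2)]]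
    by (simp add: T_diff[OF assms(1) Cc_l2[OF trunc_Cc] assms(2), abs_def])
  then show "\<forall>\<^sub>F n in sequentially. norm (l2_norm m (\<lambda>x. T t (trunc n f) x - T t f x)) \<le> l2_norm m (\<lambda>x. trunc n f x - f x)"
    by (simp add: M.l2_norm_nonneg)
qed

lemma T_symmetric:
  assumes t: "0 \<le> t" and f: "f \<in> l2 m" and g: "g \<in> l2 m"
  shows "l2_inner m (T t f) g = l2_inner m f (T t g)"
proof -
  have C: "l2_inner m (T t \<phi>) g = l2_inner m \<phi> (T t g)" if \<phi>: "\<phi> \<in> Cc" for \<phi>
  proof -
    let ?G = "{x. \<phi> x \<noteq> 0}"
    have G: "finite ?G" using \<phi> by (simp add: Cc_def)
    have "l2_inner m (T t \<phi>) g = (\<Sum>\<^sub>\<infinity>x. \<Sum>y\<in>?G. \<phi> y * (q t x y * g x * m x))"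
      unfolding l2_inner_def by (subst T_finite[OF G]) (auto simp: sum_distrib_right mult.assoc)
    also have "\<dots> = (\<Sum>y\<in>?G. \<Sum>\<^sub>\<infinity>x. \<phi> y * (q t x y * g x * m x))"
      by (intro infsum_finite_sum(2) G summable_on_cmult_right M.l2_prod_summable q_col_l2 t g)
    also have "\<dots> = (\<Sum>y\<in>?G. \<phi> y * (T t g y * m y))"
      unfolding infsum_cmult_right' T_inner[OF t] using m_pos by (simp add: l2_inner_def less_imp_neq[symmetric])
    also have "\<dots> = l2_inner m \<phi> (T t g)"
      by (subst M.l2_inner_finite_support[OF G]) (auto simp: mult.assoc)
    finally show ?thesis .
  qed
  show ?thesis
  proof (rule LIMSEQ_unique)
    show "(\<lambda>n. l2_inner m (T t (trunc n f)) g) \<longlonglongrightarrow> l2_inner m (T t f) g"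
      by (intro M.l2_inner_tendsto T_contraction Cc_l2 trunc_Cc T_trunc_lim t f g) (simp add: M.l2_norm_zero)
    show "(\<lambda>n. l2_inner m (T t (trunc n f)) g) \<longlonglongrightarrow> l2_inner m f (T t g)"
      unfolding C[OF trunc_Cc]
      by (intro M.l2_inner_tendsto T_contraction Cc_l2 trunc_Cc trunc_lim t f g) (simp add: M.l2_norm_zero)
  qed
qed

lemma T_semigroup:
  assumes s: "0 \<le> s" and t: "0 \<le> t" and f: "f \<in> l2 m"
  shows "T (s + t) f x = T s (T t f) x"
proof -
  have st: "0 \<le> s + t" using assms by simp
  have C: "T (s + t) \<phi> x = T s (T t \<phi>) x" if \<phi>: "\<phi> \<in> Cc" for \<phi>
  proof -
    let ?G = "{x. \<phi> x \<noteq> 0}"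
    have G: "finite ?G" using \<phi> by (simp add: Cc_def)
    have "T s (T t \<phi>) x = (\<Sum>\<^sub>\<infinity>z. \<Sum>y\<in>?G. \<phi> y * (q s x z * q t z y))"
      unfolding T_def[of s] by (subst T_finite[OF G]) (auto simp: sum_distrib_left mult_ac)
    also have "\<dots> = (\<Sum>y\<in>?G. \<Sum>\<^sub>\<infinity>z. \<phi> y * (q s x z * q t z y))"
    proof (intro infsum_finite_sum(2) G summable_on_cmult_right)
      fix y
      show "(\<lambda>z. q s x z * q t z y) summable_on UNIV"
        by (rule summable_on_comparison_test[OF q_summable[OF s, of x]])
           (use q_nonneg[OF s] q_nonneg[OF t] q_le_one[OF t] in \<open>auto intro: mult_left_le\<close>)
    qed
    also have "\<dots> = (\<Sum>y\<in>?G. \<phi> y * q (s + t) x y)"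
      unfolding infsum_cmult_right' q_chapman_kolmogorov[OF s t] ..
    also have "\<dots> = T (s + t) \<phi> x" by (rule T_finite[symmetric, OF G]) auto
    finally show ?thesis ..
  qed
  show ?thesis
  proof (rule LIMSEQ_unique)
    show "(\<lambda>n. T (s + t) (trunc n f) x) \<longlonglongrightarrow> T (s + t) f x"
      by (rule M.l2_tendsto_pointwise[OF T_contraction(1)[OF st Cc_l2[OF trunc_Cc]]
            T_contraction(1)[OF st f] T_trunc_lim[OF st f]])
    have "(\<lambda>n. l2_norm m (\<lambda>x. T s (T t (trunc n f)) x - T s (T t f) x)) \<longlonglongrightarrow> 0"
    proof (rule Lim_null_comparison[OF _ T_trunc_lim[OF t f]])
      have l: "T t (trunc n f) \<in> l2 m" "T t f \<in> l2 m" for n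
        by (intro T_contraction Cc_l2 trunc_Cc t f)+
      show "\<forall>\<^sub>F n in sequentially. norm (l2_norm m (\<lambda>x. T s (T t (trunc n f)) x - T s (T t f) x))
          \<le> l2_norm m (\<lambda>x. T t (trunc n f) x - T t f x)"
        using T_contraction(2)[OF s M.l2_diff[OF l]]
        by (simp add: T_diff[OF s l, abs_def] M.l2_norm_nonneg)
    qed
    from M.l2_tendsto_pointwise[OF T_contraction(1)[OF s T_contraction(1)[OF t Cc_l2[OF trunc_Cc]]]
        T_contraction(1)[OF s T_contraction(1)[OF t f]] this]
    show "(\<lambda>n. T (s + t) (trunc n f) x) \<longlonglongrightarrow> T s (T t f) x"
      unfolding C[OF trunc_Cc] .
  qed
qed

end

section \<open>The generator of the minimal semigroup\<close>

lemma has_real_derivative_unique_right: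
  fixes f :: "real \<Rightarrow> real"
  assumes "(f has_real_derivative a) (at t within {0..})" "(f has_real_derivative c) (at t within {0..})" "0 \<le> t"
  shows "a = c"
proof -
  have "(f has_real_derivative a) (at_right t)" "(f has_real_derivative c) (at_right t)"
    using assms by (auto intro: DERIV_subset)
  then show ?thesis
    unfolding has_field_derivative_iff by (rule tendsto_unique[OF trivial_limit_at_right_real])
qed

context elliptic_graph
begin

lemma T_deriv_Cc:
  assumes "f \<in> Cc" "0 \<le> t"
  shows "((\<lambda>t. T t f x) has_real_derivative L (T t f) x) (at t within {0..})"
proof -
  let ?G = "{x. f x \<noteq> 0}"
  have G: "finite ?G" using assms by (simp add: Cc_def)
  have e: "T t f = (\<lambda>x. \<Sum>y\<in>?G. f y * q t x y)" for t
    using T_finite[OF G, of f] by auto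
  show ?thesis
    unfolding e laplacian_sum_fun[OF G]
    by (intro DERIV_sum DERIV_cmult q_deriv assms)
qed

text \<open>Cutting \<open>u\<close> off to the support of \<open>f\<close> and its neighbours
  changes neither side, which reduces an arbitrary \<open>u\<close> to finite support.\<close>

lemma laplacian_symmetric_Cc:
  assumes "f \<in> Cc"
  shows "l2_inner m (L u) f = l2_inner m u (L f)"
proof -
  obtain G where G: "finite G" "\<And>x. x \<notin> G \<Longrightarrow> f x = 0" "\<And>x. f x \<noteq> 0 \<Longrightarrow> nbh x \<subseteq> G"
    "\<And>x y. (x, y) \<notin> G \<times> G \<Longrightarrow> (f x - f y) * b x y = 0"
    using edge_sum_finite[OF assms] by metis
  define v where "v x = (if x \<in> G then u x else 0)" for x
  have v: "v \<in> Cc" unfolding Cc_def mem_Collect_eq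
    by (rule finite_subset[OF _ G(1)]) (auto simp: v_def)
  have Lf: "L f x = 0" if "x \<notin> G" for x
  proof -
    have "b x y * (f y - f x) = 0" for y using G(4)[of x y] that by auto
    then have "(\<Sum>y\<in>nbh x. b x y * (f y - f x)) = 0" by (intro sum.neutral) blast
    then show ?thesis by (simp add: laplacian_def)
  qed
  have "l2_inner m u (L f) = l2_inner m v (L f)"
    unfolding l2_inner_def using Lf by (intro infsum_cong) (auto simp: v_def)
  also have "\<dots> = l2_inner m (L v) f"
    by (rule gen_dom_symmetric[symmetric]) (use assms v Cc_gen_dom in auto)
  also have "\<dots> = l2_inner m (L u) f"
    unfolding l2_inner_def
  proof (rule infsum_cong)
    fix x
    have "L v x = L u x" if "f x \<noteq> 0"
      unfolding laplacian_def using G(3)[OF that] G(2)[of x] that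
      by (intro arg_cong2[where f="(*)"] sum.cong) (auto simp: v_def)
    then show "L v x * f x * m x = L u x * f x * m x" by (cases "f x = 0") auto
  qed
  finally show ?thesis ..
qed

text \<open>The kernel is differentiated in its other space variable, reached by symmetry, and the
  Laplacian is then moved onto \<open>f\<close>.\<close>

lemma T_deriv_Cc':
  assumes "f \<in> Cc" "0 \<le> t"
  shows "((\<lambda>t. T t f x) has_real_derivative T t (L f) x) (at t within {0..})"
proof -
  let ?G = "{x. f x \<noteq> 0}"
  have G: "finite ?G" using assms by (simp add: Cc_def)
  have e: "T t f x = (\<Sum>y\<in>?G. f y * m y / m x * q t y x)" if "0 \<le> t" for t
    unfolding T_finite[OF G, of f t x, simplified] using q_sym[OF that, of x] m_pos[of x]
    by (intro sum.cong refl) (simp add: field_simps)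
  have "((\<lambda>t. \<Sum>y\<in>?G. f y * m y / m x * q t y x) has_real_derivative
      (\<Sum>y\<in>?G. f y * m y / m x * L (\<lambda>z. q t z x) y)) (at t within {0..})"
    by (intro DERIV_sum DERIV_cmult q_deriv assms)
  moreover have "(\<Sum>y\<in>?G. f y * m y / m x * L (\<lambda>z. q t z x) y) = T t (L f) x"
  proof -
    have "T t (L f) x = l2_inner m f (L (\<lambda>z. q t z x)) / m x"
      using laplacian_symmetric_Cc[OF assms(1), of "\<lambda>z. q t z x"]
      by (simp add: T_inner[OF assms(2)] M.l2_inner_commute)
    then show ?thesis
      by (subst (asm) M.l2_inner_finite_support[OF G]) (auto simp: sum_divide_distrib mult_ac)
  qed
  ultimately have "((\<lambda>t. \<Sum>y\<in>?G. f y * m y / m x * q t y x) has_real_derivative T t (L f) x) (at t within {0..})"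
    by simp
  then show ?thesis
    by (rule has_field_derivative_transform_within[OF _ zero_less_one]) (use assms e in auto)
qed

text \<open>The same function of time has both expressions as its derivative, so they
  coincide.\<close>

lemma T_laplacian_Cc:
  assumes "f \<in> Cc" "0 \<le> t"
  shows "L (T t f) = T t (L f)"
  using has_real_derivative_unique_right[OF T_deriv_Cc[OF assms] T_deriv_Cc'[OF assms] assms(2)] by auto

text \<open>For finitely supported \<open>\<phi>\<close>, contractivity bounds the squared norm of
  the increment by twice the defect of \<open>l2_inner m (T t \<phi>) \<phi>\<close>, a finite sum
  that is continuous in t. Truncation and contractivity then handle general
  \<open>f\<close>.\<close>

lemma T_strong_cont:
  assumes f: "f \<in> l2 m" and e: "0 < e"
  obtains \<delta> where "0 < \<delta>" "\<And>t. 0 \<le> t \<Longrightarrow> t \<le> \<delta> \<Longrightarrow> l2_norm m (\<lambda>x. T t f x - f x) \<le> e"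
proof -
  have "\<forall>\<^sub>F n in sequentially. l2_norm m (\<lambda>x. trunc n f x - f x) < e / 4"
    using order_tendstoD(2)[OF trunc_lim[OF f], of "e / 4"] e by simp
  then obtain n where n: "l2_norm m (\<lambda>x. trunc n f x - f x) < e / 4"
    using eventually_happens'[OF sequentially_bot] by blast
  define \<phi> where "\<phi> = trunc n f"
  have \<phi>: "\<phi> \<in> Cc" "\<phi> \<in> l2 m" by (simp_all add: \<phi>_def trunc_Cc Cc_l2)
  let ?G = "{x. \<phi> x \<noteq> 0}"
  have G: "finite ?G" using \<phi> by (simp add: Cc_def)
  have i: "l2_inner m (T t \<phi>) \<phi> = (\<Sum>x\<in>?G. \<phi> x * T t \<phi> x * m x)" for t
    unfolding M.l2_inner_commute[of "T t \<phi>"] by (rule M.l2_inner_finite_support[OF G]) auto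
  have c: "((\<lambda>t. T t \<phi> x) \<longlongrightarrow> T 0 \<phi> x) (at 0 within {0..})" for x
    using DERIV_continuous[OF T_deriv_Cc[OF \<phi>(1) order_refl]] by (simp add: continuous_within)
  have "((\<lambda>t. l2_inner m (T t \<phi>) \<phi>) \<longlongrightarrow> l2_inner m (T 0 \<phi>) \<phi>) (at 0 within {0..})"
    unfolding i by (intro tendsto_intros c)
  then have "((\<lambda>t. l2_inner m (T t \<phi>) \<phi>) \<longlongrightarrow> l2_inner m \<phi> \<phi>) (at 0 within {0..})"
    by (simp add: T_zero[abs_def])
  then have "\<forall>\<^sub>F t in at 0 within {0..}. l2_inner m \<phi> \<phi> - (e / 4)\<^sup>2 < l2_inner m (T t \<phi>) \<phi>"
    using e by (intro order_tendstoD(1)) auto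
  then obtain d where d: "0 < d" "\<And>t. 0 \<le> t \<Longrightarrow> t \<noteq> 0 \<Longrightarrow> t < d \<Longrightarrow> l2_inner m \<phi> \<phi> - (e / 4)\<^sup>2 < l2_inner m (T t \<phi>) \<phi>"
    unfolding eventually_at by (auto simp: dist_real_def)
  show ?thesis
  proof
    show "0 < d / 2" using d by simp
    fix t assume t: "0 \<le> t" "t \<le> d / 2"
    have li: "l2_inner m \<phi> \<phi> - (e / 4)\<^sup>2 \<le> l2_inner m (T t \<phi>) \<phi>"
      using d(2)[of t] t d(1) by (cases "t = 0") (auto simp: T_zero[abs_def])
    have T\<phi>: "T t \<phi> \<in> l2 m" "l2_norm m (T t \<phi>) \<le> l2_norm m \<phi>" by (rule T_contraction[OF t(1) \<phi>(2)])+
    have "(l2_norm m (\<lambda>x. T t \<phi> x - \<phi> x))\<^sup>2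
        = (l2_norm m (T t \<phi>))\<^sup>2 - 2 * l2_inner m (T t \<phi>) \<phi> + l2_inner m \<phi> \<phi>"
      using T\<phi>(1) \<phi>(2) M.l2_diff[OF T\<phi>(1) \<phi>(2)]
      by (simp add: M.l2_norm_sq M.l2_inner_diff_left M.l2_inner_diff_right M.l2_inner_commute[of \<phi> "T t \<phi>"])
    also have "\<dots> \<le> 2 * (e / 4)\<^sup>2"
      using power_mono[OF T\<phi>(2) M.l2_norm_nonneg, of 2] li by (simp add: M.l2_norm_sq)
    also have "\<dots> \<le> (e / 2)\<^sup>2" by (simp add: power2_eq_square)
    finally have 1: "l2_norm m (\<lambda>x. T t \<phi> x - \<phi> x) \<le> e / 2" using e by (rule power2_le_imp_le[OF _ less_imp_le[OF half_gt_zero]])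
    have Tf: "T t f \<in> l2 m" by (rule T_contraction[OF t(1) f])
    have n': "l2_norm m (\<lambda>x. \<phi> x - f x) < e / 4" using n by (simp add: \<phi>_def)
    have 2: "l2_norm m (\<lambda>x. T t f x - T t \<phi> x) \<le> e / 4"
      using T_contraction(2)[OF t(1) M.l2_diff[OF \<phi>(2) f]] n' M.l2_norm_diff_commute[of "T t f" "T t \<phi>"]
      by (simp add: T_diff[OF t(1) \<phi>(2) f, abs_def])
    have "l2_norm m (\<lambda>x. T t f x - f x) \<le> l2_norm m (\<lambda>x. T t f x - T t \<phi> x) + l2_norm m (\<lambda>x. T t \<phi> x - f x)"
      by (rule M.l2_norm_diff_trans[OF Tf T\<phi>(1) f])
    also have "l2_norm m (\<lambda>x. T t \<phi> x - f x) \<le> l2_norm m (\<lambda>x. T t \<phi> x - \<phi> x) + l2_norm m (\<lambda>x. \<phi> x - f x)"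
      by (rule M.l2_norm_diff_trans[OF T\<phi>(1) \<phi>(2) f])
    finally show "l2_norm m (\<lambda>x. T t f x - f x) \<le> e" using 1 2 n by (simp add: \<phi>_def)
  qed
qed

lemma T_increment_le:
  assumes f: "f \<in> l2 m" and r: "0 \<le> r" and t: "0 \<le> t"
  shows "l2_norm m (\<lambda>x. T r f x - T t f x) \<le> l2_norm m (\<lambda>x. T \<bar>r - t\<bar> f x - f x)"
proof -
  have *: "l2_norm m (\<lambda>x. T r f x - T t f x) \<le> l2_norm m (\<lambda>x. T \<bar>r - t\<bar> f x - f x)"
    if "t \<le> r" "0 \<le> t" for r t
  proof -
    have h: "T (r - t) f \<in> l2 m" using that by (intro T_contraction f) auto
    have "T r f x = T t (T (r - t) f) x" for x
      using T_semigroup[of t "r - t" f x] that f by simp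
    then have "l2_norm m (\<lambda>x. T r f x - T t f x) = l2_norm m (T t (\<lambda>x. T (r - t) f x - f x))"
      by (simp add: T_diff[OF that(2) h f, abs_def])
    also have "\<dots> \<le> l2_norm m (\<lambda>x. T (r - t) f x - f x)"
      by (rule T_contraction(2)[OF that(2) M.l2_diff[OF h f]])
    finally show ?thesis using that by simp
  qed
  show ?thesis
  proof (cases "t \<le> r")
    case False
    then show ?thesis using *[of r t] r M.l2_norm_diff_commute[of "T r f" "T t f"] by (simp add: abs_minus_commute)
  qed (use * t in blast)
qed

text \<open>A weak derivative along the semigroup is automatically a norm derivative, because
  \<open>s \<mapsto> T\<^sub>s g\<close> is norm continuous.\<close>

lemma T_norm_deriv:
  assumes f: "f \<in> l2 m" and g: "g \<in> l2 m"
    and d: "\<And>t x. 0 \<le> t \<Longrightarrow> ((\<lambda>t. T t f x) has_real_derivative T t g x) (at t within {0..})"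
    and t: "0 \<le> t" and e: "0 < e"
  obtains \<delta> where "0 < \<delta>" "\<And>s. 0 \<le> s \<Longrightarrow> \<bar>s - t\<bar> \<le> \<delta> \<Longrightarrow>
    l2_norm m (\<lambda>x. T s f x - T t f x - (s - t) * T t g x) \<le> \<bar>s - t\<bar> * e"
proof -
  obtain \<delta> where \<delta>: "0 < \<delta>" "\<And>t. 0 \<le> t \<Longrightarrow> t \<le> \<delta> \<Longrightarrow> l2_norm m (\<lambda>x. T t g x - g x) \<le> e"
    using T_strong_cont[OF g e] by metis
  have "l2_norm m (\<lambda>x. T s f x - T t f x - (s - t) * T t g x) \<le> \<bar>s - t\<bar> * e"
    if s: "0 \<le> s" "\<bar>s - t\<bar> \<le> \<delta>" for s
  proof -
    \<comment> \<open>The path starts at the earlier time and runs forward, since the semigroup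
      lives on nonnegative times; for s < t only the sign of the increment changes.\<close>
    define a where "a = min s t"
    define c where "c = \<bar>s - t\<bar>"
    let ?v = "\<lambda>r x. T (a + r) f x - r * T t g x"
    have a: "0 \<le> a" using s t by (simp add: a_def)
    have "l2_norm m (\<lambda>x. ?v c x - ?v 0 x) \<le> c * e"
    proof (rule M.l2_mean_value(2)[where v'="\<lambda>r x. T (a + r) g x - T t g x"])
      fix r assume r: "0 \<le> r" "r \<le> c"
      have "((\<lambda>t. T t f x) \<circ> (\<lambda>r. a + r) has_real_derivative T (a + r) g x * (0 + 1)) (at r within {0..c})" for x
      proof (rule DERIV_image_chain)
        show "((\<lambda>r. a + r) has_real_derivative 0 + 1) (at r within {0..c})"
          by (intro derivative_intros)
        show "((\<lambda>t. T t f x) has_real_derivative T (a + r) g x) (at (a + r) within (+) a ` {0..c})"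
          by (rule DERIV_subset[OF d]) (use a r in auto)
      qed
      from this[unfolded o_def, THEN DERIV_cong] show "((\<lambda>r. ?v r x) has_real_derivative T (a + r) g x - T t g x) (at r within {0..c})" for x
        by (auto intro!: derivative_eq_intros)
      have ar: "0 \<le> a + r" using a r by simp
      show "(\<lambda>x. T (a + r) g x - T t g x) \<in> l2 m" by (intro M.l2_diff T_contraction g ar t)
      have "\<bar>a + r - t\<bar> \<le> \<delta>" using r s by (auto simp: a_def c_def)
      then show "l2_norm m (\<lambda>x. T (a + r) g x - T t g x) \<le> e"
        using T_increment_le[OF g ar t] \<delta>(2)[of "\<bar>a + r - t\<bar>"] by simp
    qed (simp add: c_def)
    moreover have "l2_norm m (\<lambda>x. ?v c x - ?v 0 x) = l2_norm m (\<lambda>x. T s f x - T t f x - (s - t) * T t g x)"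
    proof (cases "t \<le> s")
      case True
      then show ?thesis by (simp add: a_def c_def algebra_simps)
    next
      case False
      then have "(\<lambda>x. ?v c x - ?v 0 x) = (\<lambda>x. - (T s f x - T t f x - (s - t) * T t g x))"
        by (auto simp: a_def c_def algebra_simps)
      then show ?thesis by (simp only: M.l2_norm_minus)
    qed
    ultimately show ?thesis by (simp add: c_def)
  qed
  then show ?thesis using that \<delta>(1) by blast
qed

lemma T_inner_deriv:
  assumes f: "f \<in> l2 m" and g: "g \<in> l2 m" and h: "h \<in> l2 m"
    and d: "\<And>t x. 0 \<le> t \<Longrightarrow> ((\<lambda>t. T t f x) has_real_derivative T t g x) (at t within {0..})"
    and t: "0 \<le> t"
  shows "((\<lambda>t. l2_inner m (T t f) h) has_real_derivative l2_inner m (T t g) h) (at t within {0..})"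
  unfolding has_field_derivative_iff
proof (rule LIM_zero_cancel, rule tendstoI)
  fix e :: real assume e: "0 < e"
  define K where "K = l2_norm m h + 1"
  have K: "0 < K" using M.l2_norm_nonneg[of h] by (simp add: K_def)
  have "0 < e / K" using e K by simp
  then obtain \<delta> where \<delta>: "0 < \<delta>" "\<And>s. 0 \<le> s \<Longrightarrow> \<bar>s - t\<bar> \<le> \<delta> \<Longrightarrow>
      l2_norm m (\<lambda>x. T s f x - T t f x - (s - t) * T t g x) \<le> \<bar>s - t\<bar> * (e / K)"
    using T_norm_deriv[OF f g d t, of "e / K"] by blast
  show "\<forall>\<^sub>F s in at t within {0..}. dist ((l2_inner m (T s f) h - l2_inner m (T t f) h) / (s - t) - l2_inner m (T t g) h) 0 < e"
    unfolding eventually_at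
  proof (intro exI[of _ \<delta>] conjI ballI impI \<delta>(1))
    fix s assume s: "s \<in> {0..}" "s \<noteq> t \<and> dist s t < \<delta>"
    have l: "T s f \<in> l2 m" "T t f \<in> l2 m" "T t g \<in> l2 m" using s t by (auto intro: T_contraction f g)
    let ?u = "\<lambda>x. T s f x - T t f x - (s - t) * T t g x"
    have u: "?u \<in> l2 m" by (intro M.l2_diff M.l2_scale l)
    have "l2_inner m ?u h = l2_inner m (T s f) h - l2_inner m (T t f) h - (s - t) * l2_inner m (T t g) h"
      using l h by (simp add: M.l2_inner_diff_left M.l2_inner_scale_left M.l2_diff M.l2_scale)
    then have "(l2_inner m (T s f) h - l2_inner m (T t f) h) / (s - t) - l2_inner m (T t g) h = l2_inner m ?u h / (s - t)"
      using s by (simp add: field_simps)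
    moreover have "\<bar>l2_inner m ?u h\<bar> < \<bar>s - t\<bar> * e"
    proof -
      have "\<bar>l2_inner m ?u h\<bar> \<le> l2_norm m ?u * l2_norm m h" by (rule M.l2_cauchy_schwarz[OF u h])
      also have "\<dots> \<le> (\<bar>s - t\<bar> * (e / K)) * l2_norm m h"
        using \<delta>(2)[of s] s by (intro mult_right_mono M.l2_norm_nonneg) (auto simp: dist_real_def)
      also have "\<dots> < (\<bar>s - t\<bar> * (e / K)) * K"
        using s e K by (intro mult_strict_left_mono) (auto simp: K_def)
      finally show ?thesis using K by simp
    qed
    ultimately show "dist ((l2_inner m (T s f) h - l2_inner m (T t f) h) / (s - t) - l2_inner m (T t g) h) 0 < e"
      using s by (simp add: dist_real_def abs_divide pos_divide_less_eq mult.commute)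
  qed
qed

text \<open>Expanding the square produces two square sums, each at most
  \<open>l2_inner m f f\<close> because rows have mass at most 1. Lost mass only enlarges the
  right-hand side.\<close>

lemma edge_energy_le:
  assumes f: "f \<in> l2 m" and h: "0 \<le> h" and G: "finite G"
  shows "(\<Sum>(x, y)\<in>G. q h x y * m x * (f x - f y)\<^sup>2) \<le> 2 * (l2_inner m f f - l2_inner m (T h f) f)"
proof (rule tendsto_lowerbound)
  let ?f = "\<lambda>n. trunc n f"
  show "(\<lambda>n. 2 * (l2_inner m (?f n) (?f n) - l2_inner m (T h (?f n)) (?f n)))
      \<longlonglongrightarrow> 2 * (l2_inner m f f - l2_inner m (T h f) f)"
    by (intro tendsto_intros M.l2_inner_tendsto T_contraction Cc_l2 trunc_Cc trunc_lim T_trunc_lim f h)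
  have "finite (fst ` G \<union> snd ` G)" using G by simp
  from eventually_subset_Fn[OF this]
  show "\<forall>\<^sub>F n in sequentially. (\<Sum>(x, y)\<in>G. q h x y * m x * (f x - f y)\<^sup>2)
      \<le> 2 * (l2_inner m (?f n) (?f n) - l2_inner m (T h (?f n)) (?f n))"
  proof eventually_elim
    case (elim n)
    let ?A = "Fn n"
    have A: "finite ?A" by (rule finite_Fn)
    have q0: "0 \<le> q h x y * m x" for x y using q_nonneg[OF h] m_pos[of x] by simp
    have "(\<Sum>(x, y)\<in>G. q h x y * m x * (f x - f y)\<^sup>2) \<le> (\<Sum>(x, y)\<in>?A \<times> ?A. q h x y * m x * (f x - f y)\<^sup>2)"
      using elim A q0 by (intro sum_mono2) (force intro!: mult_nonneg_nonneg[OF q0])+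
    also have "\<dots> = (\<Sum>x\<in>?A. \<Sum>y\<in>?A. q h x y * m x * (f x)\<^sup>2) + (\<Sum>x\<in>?A. \<Sum>y\<in>?A. q h x y * m x * (f y)\<^sup>2)
        - 2 * (\<Sum>x\<in>?A. \<Sum>y\<in>?A. q h x y * m x * (f x * f y))"
      unfolding sum.cartesian_product[symmetric] sum_distrib_left sum.distrib[symmetric] sum_subtractf[symmetric]
      by (intro sum.cong refl) (simp add: power2_eq_square algebra_simps)
    also have "(\<Sum>x\<in>?A. \<Sum>y\<in>?A. q h x y * m x * (f y)\<^sup>2) = (\<Sum>x\<in>?A. \<Sum>y\<in>?A. q h x y * m x * (f x)\<^sup>2)"
      by (subst sum.swap) (simp add: q_sym[OF h])
    also have "(\<Sum>x\<in>?A. \<Sum>y\<in>?A. q h x y * m x * (f x)\<^sup>2) \<le> l2_inner m (?f n) (?f n)"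
    proof -
      have "(\<Sum>y\<in>?A. q h x y * m x * (f x)\<^sup>2) \<le> (f x)\<^sup>2 * m x" for x
      proof -
        have "(\<Sum>y\<in>?A. q h x y * m x * (f x)\<^sup>2) = (f x)\<^sup>2 * m x * (\<Sum>y\<in>?A. q h x y)"
          unfolding sum_distrib_left by (intro sum.cong refl) (simp add: mult_ac)
        then show ?thesis using q_sum_le[OF h A, of x] m_pos[of x] by (simp add: mult_left_le)
      qed
      then have "(\<Sum>x\<in>?A. \<Sum>y\<in>?A. q h x y * m x * (f x)\<^sup>2) \<le> (\<Sum>x\<in>?A. (f x)\<^sup>2 * m x)" by (rule sum_mono)
      also have "\<dots> = l2_inner m (?f n) (?f n)"
        by (subst M.l2_inner_finite_support[OF A]) (auto simp: trunc_def power2_eq_square)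
      finally show ?thesis .
    qed
    also have "(\<Sum>x\<in>?A. \<Sum>y\<in>?A. q h x y * m x * (f x * f y)) = l2_inner m (T h (?f n)) (?f n)"
      unfolding M.l2_inner_commute[of "T h (?f n)"]
      by (subst M.l2_inner_finite_support[OF A], simp add: trunc_def, subst T_finite[OF A], simp add: trunc_def)
         (auto simp: trunc_def sum_distrib_left sum_distrib_right mult_ac intro!: sum.cong)
    finally show ?case by simp
  qed
qed simp

text \<open>Fatou's lemma for the approximating forms \<open>\<langle>f - T\<^sub>h f, f\<rangle> / h\<close>, whose edge weights converge to \<open>b\<close>.\<close>

lemma form_dom_if_difference_quotient:
  assumes f: "f \<in> l2 m"
    and lim: "((\<lambda>h. (l2_inner m f f - l2_inner m (T h f) f) / h) \<longlongrightarrow> c) (at_right 0)"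
  shows "f \<in> form_dom" "energy f f \<le> c"
proof -
  have le: "(\<Sum>p\<in>G. (grad f p)\<^sup>2 * case_prod b p) \<le> 2 * c" if G: "finite G" for G
  proof (rule tendsto_le[OF trivial_limit_at_right_real])
    show "((\<lambda>h. 2 * ((l2_inner m f f - l2_inner m (T h f) f) / h)) \<longlongrightarrow> 2 * c) (at_right 0)"
      by (intro tendsto_intros lim)
    have "((\<lambda>h. (q h x y / h) * m x * (f x - f y)\<^sup>2) \<longlongrightarrow> (f x - f y)\<^sup>2 * b x y) (at_right 0)" for x y
    proof (cases "x = y")
      case False
      \<comment> \<open>Off the diagonal \<open>q 0 x y\<close> vanishes, so
        \<open>q h x y / h\<close> is a difference quotient at time 0; times m(x) it tends to
        b(x,y).\<close>
      have "((\<lambda>t. q t x y) has_real_derivative L (\<lambda>z. q 0 z y) x) (at_right 0)"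
        by (rule DERIV_subset[OF q_deriv]) auto
      then have "((\<lambda>h. q h x y / h) \<longlongrightarrow> L (indicator {y}) x) (at_right 0)"
        using False by (simp add: has_field_derivative_iff q_zero)
      moreover have "L (indicator {y}) x = b x y / m x"
      proof -
        have "(\<Sum>z\<in>nbh x. b x z * (indicator {y} z - indicator {y} x)) = (\<Sum>z\<in>nbh x. if z = y then b x y else 0)"
          using False by (intro sum.cong) auto
        also have "\<dots> = b x y" using b_finite b_zero_iff[of x y] by (simp add: sum.delta)
        finally show ?thesis by (simp add: laplacian_def)
      qed
      ultimately have "((\<lambda>h. q h x y / h) \<longlongrightarrow> b x y / m x) (at_right 0)" by simp
      from tendsto_mult[OF tendsto_mult[OF this tendsto_const] tendsto_const]
      have "((\<lambda>h. (q h x y / h) * m x * (f x - f y)\<^sup>2) \<longlongrightarrow> b x y / m x * m x * (f x - f y)\<^sup>2) (at_right 0)" .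
      then show ?thesis using m_pos[of x] by (simp add: mult.commute)
    qed simp
    then have "((\<lambda>h. \<Sum>p\<in>G. (q h (fst p) (snd p) / h) * m (fst p) * (f (fst p) - f (snd p))\<^sup>2) \<longlongrightarrow>
        (\<Sum>p\<in>G. (f (fst p) - f (snd p))\<^sup>2 * b (fst p) (snd p))) (at_right 0)"
      by (intro tendsto_sum)
    then show "((\<lambda>h. \<Sum>p\<in>G. (q h (fst p) (snd p) / h) * m (fst p) * (f (fst p) - f (snd p))\<^sup>2) \<longlongrightarrow>
        (\<Sum>p\<in>G. (grad f p)\<^sup>2 * case_prod b p)) (at_right 0)"
      by (simp add: grad_def split_def)
    show "\<forall>\<^sub>F h in at_right 0. (\<Sum>p\<in>G. (q h (fst p) (snd p) / h) * m (fst p) * (f (fst p) - f (snd p))\<^sup>2)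
        \<le> 2 * ((l2_inner m f f - l2_inner m (T h f) f) / h)"
      using eventually_at_right_less[of 0]
    proof eventually_elim
      case (elim h)
      have "(\<Sum>p\<in>G. (q h (fst p) (snd p) / h) * m (fst p) * (f (fst p) - f (snd p))\<^sup>2)
          = (\<Sum>(x, y)\<in>G. q h x y * m x * (f x - f y)\<^sup>2) / h"
        by (simp add: sum_divide_distrib split_def)
      also have "\<dots> \<le> 2 * (l2_inner m f f - l2_inner m (T h f) f) / h"
        using edge_energy_le[OF f _ G, of h] elim by (intro divide_right_mono) auto
      finally show ?case by simp
    qed
  qed
  have c: "0 \<le> c" using le[of "{}"] by simp
  have le': "(\<Sum>p\<in>G. (grad f p)\<^sup>2 * case_prod b p) \<le> (sqrt (2 * c))\<^sup>2" if "finite G" for G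
    using le[OF that] c by simp
  have sq: "0 \<le> sqrt (2 * c)" using c by simp
  show "f \<in> form_dom" using W.l2_boundI(1)[OF le' sq] f by (simp add: form_dom_def)
  have "(grad_norm f)\<^sup>2 \<le> (sqrt (2 * c))\<^sup>2"
    by (intro power_mono W.l2_boundI(2)[OF le' sq] W.l2_norm_nonneg)
  then show "energy f f \<le> c" using c by (simp add: energy_self)
qed

text \<open>By symmetry and the semigroup law, \<open>l2_inner m (T h (T t g)) (T t g)\<close> is
  the value at 2t + h of the function \<open>l2_inner m (T s g) g\<close> of s, whose derivative is
  known. Cauchy-Schwarz makes the energy bound uniform in t, as needed for domination later.\<close>

lemma T_Cc_energy:
  assumes g: "g \<in> Cc" and t: "0 \<le> t"
  shows "T t g \<in> form_dom" "energy (T t g) (T t g) \<le> l2_norm m (L g) * l2_norm m g"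
proof -
  have gl: "g \<in> l2 m" "L g \<in> l2 m" using g by (auto intro: Cc_l2 laplacian_Cc)
  have Tg: "T t g \<in> l2 m" by (rule T_contraction[OF t gl(1)])
  have tt: "0 \<le> t + t" using t by simp
  have s: "l2_inner m (T h (T t g)) (T t g) = l2_inner m (T (h + (t + t)) g) g" if "0 \<le> h" for h
  proof -
    have "l2_inner m (T h (T t g)) (T t g) = l2_inner m (T t (T h (T t g))) g"
      by (rule T_symmetric[OF t _ gl(1), symmetric]) (intro T_contraction that t gl)
    moreover have "T t (T h (T t g)) = T (h + (t + t)) g"
    proof -
      have "T h (T t g) = T (h + t) g" using T_semigroup[OF that t gl(1)] by auto
      moreover have "T t (T (h + t) g) = T (t + (h + t)) g" using T_semigroup[OF t _ gl(1), of "h + t"] that t by auto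
      ultimately show ?thesis by (simp add: add_ac)
    qed
    ultimately show ?thesis by simp
  qed
  have "((\<lambda>t. l2_inner m (T t g) g) has_real_derivative l2_inner m (T (t + t) (L g)) g) (at (t + t) within {0..})"
    by (rule T_inner_deriv[OF gl gl(1) T_deriv_Cc'[OF g] tt])
  then have "((\<lambda>t. l2_inner m (T t g) g) has_real_derivative l2_inner m (T (t + t) (L g)) g) (at_right (t + t))"
    using t by (auto intro: DERIV_subset)
  then have "((\<lambda>h. (l2_inner m (T (h + (t + t)) g) g - l2_inner m (T (t + t) g) g) / h)
      \<longlongrightarrow> l2_inner m (T (t + t) (L g)) g) (at_right 0)"
    unfolding has_field_derivative_iff
    by (subst (asm) at_right_to_0) (simp add: filterlim_filtermap)
  from tendsto_minus[OF this]
  have "((\<lambda>h. (l2_inner m (T t g) (T t g) - l2_inner m (T h (T t g)) (T t g)) / h)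
      \<longlongrightarrow> - l2_inner m (T (t + t) (L g)) g) (at_right 0)"
  proof (rule Lim_transform_eventually)
    show "\<forall>\<^sub>F h in at_right 0. - ((l2_inner m (T (h + (t + t)) g) g - l2_inner m (T (t + t) g) g) / h)
        = (l2_inner m (T t g) (T t g) - l2_inner m (T h (T t g)) (T t g)) / h"
      using eventually_at_right_less[of 0]
    proof eventually_elim
      case (elim h)
      have "l2_inner m (T t g) (T t g) = l2_inner m (T (t + t) g) g"
        using s[of 0] by (simp add: T_zero[abs_def])
      then show ?case using s[of h] elim by (simp add: minus_divide_left)
    qed
  qed
  note E = form_dom_if_difference_quotient[OF Tg this]
  show "T t g \<in> form_dom" by (rule E(1))
  have "\<bar>l2_inner m (T (t + t) (L g)) g\<bar> \<le> l2_norm m (T (t + t) (L g)) * l2_norm m g"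
    by (rule M.l2_cauchy_schwarz) (intro T_contraction tt gl)+
  also have "\<dots> \<le> l2_norm m (L g) * l2_norm m g"
    by (intro mult_right_mono T_contraction tt gl M.l2_norm_nonneg)
  finally show "energy (T t g) (T t g) \<le> l2_norm m (L g) * l2_norm m g" using E(2) by linarith
qed

lemma T_Cc_gen_dom: "g \<in> Cc \<Longrightarrow> 0 \<le> t \<Longrightarrow> T t g \<in> gen_dom"
  by (simp add: gen_dom_def T_Cc_energy T_laplacian_Cc T_contraction Cc_l2 laplacian_Cc)

lemma l2_inner_indicator: "l2_inner m f (indicator {x}) = f x * m x"
  using M.l2_inner_finite_support[of "{x}" "indicator {x}" f] by (simp add: M.l2_inner_commute)

lemma T_pointwise: "0 \<le> t \<Longrightarrow> f \<in> l2 m \<Longrightarrow> T t f x = l2_inner m (T t (indicator {x})) f / m x"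
  using T_indicator[of t x, abs_def] by (simp add: T_inner)

text \<open>\<open>T t f x\<close> is an inner product with the evolved indicator of x. The
  derivative is taken there, on finitely supported initial data, and symmetry of the Laplacian
  brings it to \<open>f\<close>.\<close>

lemma T_deriv_gen_dom:
  assumes f: "f \<in> gen_dom" and t: "0 \<le> t"
  shows "((\<lambda>t. T t f x) has_real_derivative T t (L f) x) (at t within {0..})"
proof -
  let ?i = "indicator {x} :: 'a \<Rightarrow> real"
  have fl: "f \<in> l2 m" "L f \<in> l2 m" using f by (auto simp: gen_dom_def form_dom_def)
  have i: "?i \<in> Cc" "?i \<in> l2 m" "L ?i \<in> l2 m" by (auto intro: Cc_indicator Cc_l2 laplacian_Cc)
  have "((\<lambda>t. l2_inner m (T t ?i) f / m x) has_real_derivative l2_inner m (T t (L ?i)) f / m x) (at t within {0..})"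
    by (intro DERIV_cdivide T_inner_deriv i fl T_deriv_Cc' t)
  moreover have "l2_inner m (T t (L ?i)) f = l2_inner m (T t ?i) (L f)"
    using gen_dom_symmetric[OF T_Cc_gen_dom[OF i(1) t] f] by (simp add: T_laplacian_Cc[OF i(1) t])
  ultimately have "((\<lambda>t. l2_inner m (T t ?i) f / m x) has_real_derivative T t (L f) x) (at t within {0..})"
    by (simp add: T_pointwise[OF t fl(2)])
  then show ?thesis
    by (rule has_field_derivative_transform_within[OF _ zero_less_one]) (use t fl T_pointwise in auto)
qed

text \<open>One inclusion upgrades pointwise derivatives to norm derivatives. For the other, a norm
  derivative at 0 makes the approximating forms converge, hence the energy is finite, and testing
  against indicators identifies \<open>h\<close>.\<close>

lemma T_generator: "semigroup_generator m T = {(f, L f) | f. f \<in> gen_dom}"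
proof (intro set_eqI iffI)
  fix p assume "p \<in> {(f, L f) | f. f \<in> gen_dom}"
  then obtain f where p: "p = (f, L f)" and f: "f \<in> gen_dom" by auto
  have fl: "f \<in> l2 m" "L f \<in> l2 m" using f by (auto simp: gen_dom_def form_dom_def)
  have "((\<lambda>t. l2_norm m (\<lambda>x. (T t f x - f x) / t - L f x)) \<longlongrightarrow> 0) (at_right 0)"
  proof (rule tendstoI)
    fix e :: real assume e: "0 < e"
    obtain \<delta> where \<delta>: "0 < \<delta>" "\<And>s. 0 \<le> s \<Longrightarrow> \<bar>s - 0\<bar> \<le> \<delta> \<Longrightarrow>
        l2_norm m (\<lambda>x. T s f x - T 0 f x - (s - 0) * T 0 (L f) x) \<le> \<bar>s - 0\<bar> * (e / 2)"
      using T_norm_deriv[OF fl T_deriv_gen_dom[OF f] order_refl half_gt_zero[OF e]] by blast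
    have "\<forall>\<^sub>F s in at_right 0. s \<in> {0<..<\<delta>}" by (rule eventually_at_right_real[OF \<delta>(1)])
    then show "\<forall>\<^sub>F t in at_right 0. dist (l2_norm m (\<lambda>x. (T t f x - f x) / t - L f x)) 0 < e"
    proof eventually_elim
      case (elim s)
      have "l2_norm m (\<lambda>x. (T s f x - f x) / s - L f x) = l2_norm m (\<lambda>x. (1 / s) * (T s f x - f x - s * L f x))"
        using elim by (intro arg_cong[where f="l2_norm m"] ext) (simp add: field_simps)
      also have "\<dots> = (1 / s) * l2_norm m (\<lambda>x. T s f x - f x - s * L f x)"
        using elim by (subst M.l2_norm_scale) simp
      also have "\<dots> \<le> (1 / s) * (s * (e / 2))"
        using \<delta>(2)[of s] elim by (intro mult_left_mono) (auto simp: T_zero)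
      also have "\<dots> < e" using elim e by simp
      finally show ?case by (simp add: M.l2_norm_nonneg)
    qed
  qed
  then show "p \<in> semigroup_generator m T" using fl by (simp add: p semigroup_generator_def)
next
  fix p assume "p \<in> semigroup_generator m T"
  then obtain f h where p: "p = (f, h)" and fl: "f \<in> l2 m" "h \<in> l2 m"
    and lim: "((\<lambda>t. l2_norm m (\<lambda>x. (T t f x - f x) / t - h x)) \<longlongrightarrow> 0) (at_right 0)"
    by (auto simp: semigroup_generator_def)
  have il: "((\<lambda>t. (l2_inner m (T t f) g - l2_inner m f g) / t) \<longlongrightarrow> l2_inner m h g) (at_right 0)" if g: "g \<in> l2 m" for g
  proof (rule LIM_zero_cancel, rule Lim_null_comparison)
    show "((\<lambda>t. l2_norm m (\<lambda>x. (T t f x - f x) / t - h x) * l2_norm m g) \<longlongrightarrow> 0) (at_right 0)"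
      using tendsto_mult[OF lim tendsto_const[of "l2_norm m g"]] by simp
    show "\<forall>\<^sub>F t in at_right 0. norm ((l2_inner m (T t f) g - l2_inner m f g) / t - l2_inner m h g)
        \<le> l2_norm m (\<lambda>x. (T t f x - f x) / t - h x) * l2_norm m g"
      using eventually_at_right_less[of 0]
    proof eventually_elim
      case (elim t)
      have Tf: "T t f \<in> l2 m" using elim by (intro T_contraction fl) simp
      have a: "(\<lambda>x. (1 / t) * (T t f x - f x)) \<in> l2 m" by (intro M.l2_scale M.l2_diff Tf fl)
      have "l2_inner m (\<lambda>x. (1 / t) * (T t f x - f x) - h x) g = (l2_inner m (T t f) g - l2_inner m f g) / t - l2_inner m h g"
        using M.l2_inner_diff_left[OF a fl(2) g] M.l2_inner_scale_left[of "1/t" "\<lambda>x. T t f x - f x" g]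
          M.l2_inner_diff_left[OF Tf fl(1) g] by simp
      then show ?case
        using M.l2_cauchy_schwarz[OF M.l2_diff[OF a fl(2)] g] by simp
    qed
  qed
  have "((\<lambda>t. (l2_inner m f f - l2_inner m (T t f) f) / t) \<longlongrightarrow> - l2_inner m h f) (at_right 0)"
    using tendsto_minus[OF il[OF fl(1)]] by (simp add: minus_divide_left)
  from form_dom_if_difference_quotient(1)[OF fl(1) this] have fd: "f \<in> form_dom" .
  have "h x = L f x" for x
  proof -
    let ?i = "indicator {x} :: 'a \<Rightarrow> real"
    have i: "?i \<in> Cc" "?i \<in> l2 m" "L ?i \<in> l2 m" by (auto intro: Cc_indicator Cc_l2 laplacian_Cc)
    have "((\<lambda>t. l2_inner m (T t ?i) f) has_real_derivative l2_inner m (T 0 (L ?i)) f) (at 0 within {0..})"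
      by (intro T_inner_deriv i fl T_deriv_Cc') simp_all
    then have "((\<lambda>t. l2_inner m (T t ?i) f) has_real_derivative l2_inner m (T 0 (L ?i)) f) (at_right 0)"
      by (rule DERIV_subset) auto
    then have "((\<lambda>t. (l2_inner m (T t ?i) f - l2_inner m ?i f) / t) \<longlongrightarrow> l2_inner m (L ?i) f) (at_right 0)"
      by (simp add: has_field_derivative_iff T_zero[abs_def])
    moreover have "((\<lambda>t. (l2_inner m (T t ?i) f - l2_inner m ?i f) / t) \<longlongrightarrow> l2_inner m h ?i) (at_right 0)"
    proof (rule Lim_transform_eventually[OF il[OF i(2)]])
      show "\<forall>\<^sub>F t in at_right 0. (l2_inner m (T t f) ?i - l2_inner m f ?i) / t = (l2_inner m (T t ?i) f - l2_inner m ?i f) / t"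
        using eventually_at_right_less[of 0]
      proof eventually_elim
        case (elim t)
        have "l2_inner m (T t f) ?i = l2_inner m f (T t ?i)" using elim by (intro T_symmetric fl i) simp
        then show ?case by (simp add: M.l2_inner_commute)
      qed
    qed
    ultimately have "l2_inner m (L ?i) f = l2_inner m h ?i" by (rule tendsto_unique[OF trivial_limit_at_right_real])
    moreover have "l2_inner m (L f) ?i = l2_inner m f (L ?i)" by (rule laplacian_symmetric_Cc[OF i(1)])
    ultimately show ?thesis using m_pos[of x] by (simp add: l2_inner_indicator M.l2_inner_commute[of "L ?i"])
  qed
  then have "h = L f" by auto
  then show "p \<in> {(f, L f) | f. f \<in> gen_dom}" using p fd fl by (auto simp: gen_dom_def)
qed

lemma T_C0_semigroup: "C0_semigroup m T"
  unfolding C0_semigroup_def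
proof (intro conjI allI impI ballI)
  fix f assume f: "f \<in> l2 m"
  show "((\<lambda>t. l2_norm m (\<lambda>x. T t f x - f x)) \<longlongrightarrow> 0) (at_right 0)"
  proof (rule tendstoI)
    fix e :: real assume e: "0 < e"
    obtain \<delta> where \<delta>: "0 < \<delta>" "\<And>t. 0 \<le> t \<Longrightarrow> t \<le> \<delta> \<Longrightarrow> l2_norm m (\<lambda>x. T t f x - f x) \<le> e / 2"
      using T_strong_cont[OF f half_gt_zero[OF e]] by blast
    have "\<forall>\<^sub>F s in at_right 0. s \<in> {0<..<\<delta>}" by (rule eventually_at_right_real[OF \<delta>(1)])
    then show "\<forall>\<^sub>F t in at_right 0. dist (l2_norm m (\<lambda>x. T t f x - f x)) 0 < e"
    proof eventually_elim
      case (elim t)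
      then have "l2_norm m (\<lambda>x. T t f x - f x) \<le> e / 2" by (intro \<delta>(2)) auto
      then show ?case using e by (simp add: M.l2_norm_nonneg)
    qed
  qed
next
  fix t :: real assume "0 \<le> t"
  then show "\<exists>M. \<forall>f\<in>l2 m. l2_norm m (T t f) \<le> M * l2_norm m f"
    by (intro exI[of _ 1]) (simp add: T_contraction)
qed (auto simp: T_contraction T_lincomb T_zero T_semigroup fun_eq_iff)

end

section \<open>Uniqueness of the semigroup with a given symmetric generator\<close>

context pos_weight
begin

lemma
  assumes "C0_semigroup w S" "0 \<le> t" "f \<in> l2 w"
  shows C0_l2: "S t f \<in> l2 w"
    and C0_lincomb: "g \<in> l2 w \<Longrightarrow> S t (\<lambda>x. \<alpha> * f x + \<beta> * g x) = (\<lambda>x. \<alpha> * S t f x + \<beta> * S t g x)"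
    and C0_zero: "S 0 f = f"
    and C0_add: "0 \<le> s \<Longrightarrow> S (s + t) f = S s (S t f)"
    and C0_cont: "((\<lambda>t. l2_norm w (\<lambda>x. S t f x - f x)) \<longlongrightarrow> 0) (at_right 0)"
  using assms unfolding C0_semigroup_def by auto

lemma C0_bounded:
  assumes "C0_semigroup w S" "0 \<le> t"
  obtains B where "0 \<le> B" "\<And>f. f \<in> l2 w \<Longrightarrow> l2_norm w (S t f) \<le> B * l2_norm w f"
proof -
  obtain B where B: "\<And>f. f \<in> l2 w \<Longrightarrow> l2_norm w (S t f) \<le> B * l2_norm w f"
  proof -
    have "\<forall>t\<ge>0. \<exists>M. \<forall>f\<in>l2 w. l2_norm w (S t f) \<le> M * l2_norm w f"
      using assms(1) unfolding C0_semigroup_def by (elim conjE)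
    then show thesis using assms(2) that by blast
  qed
  have "l2_norm w (S t f) \<le> \<bar>B\<bar> * l2_norm w f" if "f \<in> l2 w" for f
    using B[OF that] mult_right_mono[OF abs_ge_self[of B] l2_norm_nonneg[of f]] by linarith
  then show ?thesis using that[of "\<bar>B\<bar>"] by simp
qed

lemma C0_diff:
  assumes "C0_semigroup w S" "0 \<le> t" "f \<in> l2 w" "g \<in> l2 w"
  shows "S t (\<lambda>x. f x - g x) = (\<lambda>x. S t f x - S t g x)"
  using C0_lincomb[OF assms, of 1 "-1"] by simp

lemma C0_scale:
  assumes "C0_semigroup w S" "0 \<le> t" "f \<in> l2 w"
  shows "S t (\<lambda>x. c * f x) = (\<lambda>x. c * S t f x)"
  using C0_lincomb[OF assms assms(3), of c 0] by simp

text \<open>The uniform boundedness principle for \<open>S\<^sub>h\<close>, \<open>h \<rightarrow> 0\<close>, proved by nested balls.\<close>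

lemma C0_bounded_near_zero:
  assumes S: "C0_semigroup w S"
  obtains \<delta> B where "0 < \<delta>" "1 \<le> B"
    "\<And>h f. 0 \<le> h \<Longrightarrow> h \<le> \<delta> \<Longrightarrow> f \<in> l2 w \<Longrightarrow> l2_norm w (S h f) \<le> B * l2_norm w f"
proof (rule ccontr)
  assume neg: "\<not> thesis"
  note obt = that
  have N: "\<exists>h f. 0 \<le> h \<and> h \<le> \<delta> \<and> f \<in> l2 w \<and> B * l2_norm w f < l2_norm w (S h f)"
    if p: "0 < \<delta>" "1 \<le> B" for \<delta> B
  proof (rule ccontr)
    assume c: "\<not> ?thesis"
    have "l2_norm w (S h f) \<le> B * l2_norm w f" if "0 \<le> h" "h \<le> \<delta>" "f \<in> l2 w" for h f
      using c that not_le by blast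
    from obt[OF p this] neg show False by blast
  qed
  have step: "\<exists>h x' r'. 0 \<le> h \<and> h \<le> 1 / real (Suc n) \<and> x' \<in> l2 w \<and> 0 < r' \<and> r' \<le> r / 2
      \<and> l2_norm w (\<lambda>z. x' z - x z) \<le> r / 2
      \<and> (\<forall>y\<in>l2 w. l2_norm w (\<lambda>z. y z - x' z) \<le> r' \<longrightarrow> real n \<le> l2_norm w (S h y))"
    if x: "x \<in> l2 w" and r: "0 < r" for n x r
  proof -
    have "\<exists>h f. 0 \<le> h \<and> h \<le> 1 / real (Suc n) \<and> f \<in> l2 w \<and> l2_norm w (\<lambda>z. f z - x z) \<le> r / 2 \<and> real (Suc n) < l2_norm w (S h f)"
    proof (rule ccontr)
      assume c: "\<nexists>h f. 0 \<le> h \<and> h \<le> 1 / real (Suc n) \<and> f \<in> l2 w \<and> l2_norm w (\<lambda>z. f z - x z) \<le> r / 2 \<and> real (Suc n) < l2_norm w (S h f)"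
      have le: "l2_norm w (S h f) \<le> real (Suc n)" if "0 \<le> h" "h \<le> 1 / real (Suc n)" "f \<in> l2 w" "l2_norm w (\<lambda>z. f z - x z) \<le> r / 2" for h f
        using c that by (meson not_le)
      \<comment> \<open>A bound n + 1 for all these S_h on the ball of radius r/2 about x gives 2(n
        + 1) on that ball about 0, hence operator norm at most 4(n + 1)/r. The chosen
        \<open>g\<close> violates this; the summand 1 meets the condition
        \<open>1 \<le> B\<close>.\<close>
      obtain h g where hg: "0 \<le> h" "h \<le> 1 / real (Suc n)" "g \<in> l2 w"
        and big: "(1 + 4 * real (Suc n) / r) * l2_norm w g < l2_norm w (S h g)"
        using N[of "1 / real (Suc n)" "1 + 4 * real (Suc n) / r"] r by auto
      have "l2_norm w g \<noteq> 0"
      proof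
        assume g0: "l2_norm w g = 0"
        obtain B where "\<And>f. f \<in> l2 w \<Longrightarrow> l2_norm w (S h f) \<le> B * l2_norm w f"
          using C0_bounded[OF S hg(1)] by blast
        from this[OF hg(3)] show False using big g0 by simp
      qed
      then have gp: "0 < l2_norm w g" using l2_norm_nonneg[of g] by simp
      define c where "c = r / 2 / l2_norm w g"
      have cp: "0 < c" using r gp by (simp add: c_def)
      let ?u = "\<lambda>z. c * g z"
      have u: "?u \<in> l2 w" by (rule l2_scale[OF hg(3)])
      have un: "l2_norm w ?u = r / 2" unfolding l2_norm_scale using cp gp r by (simp add: c_def)
      have xu: "(\<lambda>z. x z + ?u z) \<in> l2 w" by (rule l2_add[OF x u])
      have b1: "l2_norm w (S h (\<lambda>z. x z + ?u z)) \<le> real (Suc n)"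
        by (rule le[OF hg(1,2) xu]) (simp add: un)
      have b2: "l2_norm w (S h x) \<le> real (Suc n)"
        by (rule le[OF hg(1,2) x]) (use r in \<open>simp add: l2_norm_zero\<close>)
      have "S h ?u = (\<lambda>z. S h (\<lambda>z. x z + ?u z) z - S h x z)"
        using C0_diff[OF S hg(1) xu x] by simp
      then have "l2_norm w (S h ?u) \<le> l2_norm w (S h (\<lambda>z. x z + ?u z)) + l2_norm w (S h x)"
        using l2_norm_triangle_diff[OF C0_l2[OF S hg(1) xu] C0_l2[OF S hg(1) x]] by simp
      from order_trans[OF this add_mono[OF b1 b2]]
      have "l2_norm w (S h ?u) \<le> 2 * real (Suc n)" by simp
      then have "c * l2_norm w (S h g) \<le> 2 * real (Suc n)"
        using cp by (simp add: C0_scale[OF S hg(1,3)] l2_norm_scale)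
      then have "l2_norm w (S h g) \<le> 2 * real (Suc n) / c"
        using cp by (simp add: pos_le_divide_eq mult.commute)
      also have "2 * real (Suc n) / c = 4 * real (Suc n) / r * l2_norm w g"
        using r gp by (simp add: c_def)
      also have "\<dots> \<le> (1 + 4 * real (Suc n) / r) * l2_norm w g"
        using gp by (intro mult_right_mono) auto
      finally show False using big by simp
    qed
    then obtain h f where hf: "0 \<le> h" "h \<le> 1 / real (Suc n)" "f \<in> l2 w" "l2_norm w (\<lambda>z. f z - x z) \<le> r / 2"
      "real (Suc n) < l2_norm w (S h f)" by blast
    obtain B where B: "0 \<le> B" "\<And>f. f \<in> l2 w \<Longrightarrow> l2_norm w (S h f) \<le> B * l2_norm w f"
      using C0_bounded[OF S hf(1)] by blast
    \<comment> \<open>With B r' at most 1, the norm of S_h drops by at most 1 on the small ball, so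
      it stays above n.\<close>
    define r' where "r' = min (r / 2) (1 / (B + 1))"
    have r': "0 < r'" "r' \<le> r / 2" using r B by (auto simp: r'_def)
    have Br: "B * r' \<le> 1"
    proof -
      have "B * r' \<le> B * (1 / (B + 1))" using B by (intro mult_left_mono) (auto simp: r'_def)
      also have "\<dots> \<le> 1" using B by (simp add: pos_divide_le_eq)
      finally show ?thesis .
    qed
    have "real n \<le> l2_norm w (S h y)" if y: "y \<in> l2 w" "l2_norm w (\<lambda>z. y z - f z) \<le> r'" for y
    proof -
      have fy: "(\<lambda>z. y z - f z) \<in> l2 w" by (rule l2_diff[OF y(1) hf(3)])
      have "l2_norm w (S h f) \<le> l2_norm w (S h y) + l2_norm w (S h (\<lambda>z. y z - f z))"
        using l2_norm_triangle_diff[OF C0_l2[OF S hf(1) y(1)] C0_l2[OF S hf(1) fy]]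
        by (simp add: C0_diff[OF S hf(1) y(1) hf(3)])
      also have "l2_norm w (S h (\<lambda>z. y z - f z)) \<le> B * l2_norm w (\<lambda>z. y z - f z)" by (rule B(2)[OF fy])
      also have "\<dots> \<le> B * r'" by (intro mult_left_mono y B)
      finally show ?thesis using hf(5) Br by simp
    qed
    then show ?thesis using hf r' by blast
  qed
  \<comment> \<open>The recursion carries triples of centre, radius and time.\<close>
  define P where "P n p \<longleftrightarrow> fst p \<in> l2 w \<and> 0 < fst (snd p) \<and> fst (snd p) \<le> 1 / 2 ^ n" for n :: nat and p :: "('b \<Rightarrow> real) \<times> real \<times> real"
  define Q where "Q n p p' \<longleftrightarrow> fst (snd p') \<le> fst (snd p) / 2 \<and> l2_norm w (\<lambda>z. fst p' z - fst p z) \<le> fst (snd p) / 2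
    \<and> 0 \<le> snd (snd p') \<and> snd (snd p') \<le> 1 / real (Suc n)
    \<and> (\<forall>y\<in>l2 w. l2_norm w (\<lambda>z. y z - fst p' z) \<le> fst (snd p') \<longrightarrow> real n \<le> l2_norm w (S (snd (snd p')) y))"
    for n :: nat and p p' :: "('b \<Rightarrow> real) \<times> real \<times> real"
  have "\<exists>s. \<forall>n. P n (s n) \<and> Q n (s n) (s (Suc n))"
  proof (rule dependent_nat_choice)
    show "\<exists>p. P 0 p" by (intro exI[of _ "(\<lambda>_. 0, 1, 0)"]) (simp add: P_def l2_zero)
    fix p n assume p: "P n p"
    obtain h x' r' where 1: "0 \<le> h" "h \<le> 1 / real (Suc n)" "x' \<in> l2 w" "0 < r'" "r' \<le> fst (snd p) / 2"
      "l2_norm w (\<lambda>z. x' z - fst p z) \<le> fst (snd p) / 2"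
      "\<forall>y\<in>l2 w. l2_norm w (\<lambda>z. y z - x' z) \<le> r' \<longrightarrow> real n \<le> l2_norm w (S h y)"
      using step[of "fst p" "fst (snd p)" n] p unfolding P_def by blast
    have "r' \<le> 1 / 2 ^ Suc n" using 1(5) p by (simp add: P_def)
    then show "\<exists>p'. P (Suc n) p' \<and> Q n p p'"
      using 1 by (intro exI[of _ "(x', r', h)"]) (simp add: P_def Q_def)
  qed
  then obtain s where s: "\<And>n. P n (s n)" "\<And>n. Q n (s n) (s (Suc n))" by blast
  define x where "x n = fst (s n)" for n
  define r where "r n = fst (snd (s n))" for n
  define h where "h n = snd (snd (s n))" for n
  have x: "x n \<in> l2 w" and r: "0 < r n" "r n \<le> 1 / 2 ^ n" for n
    using s(1)[of n] by (simp_all add: P_def x_def r_def)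
  have r2: "r (Suc n) \<le> r n / 2" and x2: "l2_norm w (\<lambda>z. x (Suc n) z - x n z) \<le> r n / 2"
    and h: "0 \<le> h (Suc n)" "h (Suc n) \<le> 1 / real (Suc n)"
    and big: "\<And>y. y \<in> l2 w \<Longrightarrow> l2_norm w (\<lambda>z. y z - x (Suc n) z) \<le> r (Suc n) \<Longrightarrow> real n \<le> l2_norm w (S (h (Suc n)) y)" for n
    using s(2)[of n] by (simp_all add: Q_def x_def r_def h_def)
  \<comment> \<open>As radii at least halve, r(n)/2 is at most r(n) - r(n+1), so the distances of
    the centres telescope and the balls are nested.\<close>
  have nest: "l2_norm w (\<lambda>z. x k z - x n z) \<le> r n - r k" if "n \<le> k" for n k
    using that
  proof (induction k rule: dec_induct)
    case base show ?case by (simp add: l2_norm_zero)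
  next
    case (step k)
    have "l2_norm w (\<lambda>z. x (Suc k) z - x n z) \<le> l2_norm w (\<lambda>z. x (Suc k) z - x k z) + l2_norm w (\<lambda>z. x k z - x n z)"
      by (rule l2_norm_diff_trans[OF x x x])
    then show ?case using step.IH x2[of k] r2[of k] by linarith
  qed
  have half: "\<exists>N. \<forall>n\<ge>N. 1 / 2 ^ n \<le> e" if "0 < e" for e :: real
  proof -
    have "(\<lambda>n. (1 / 2 :: real) ^ n) \<longlonglongrightarrow> 0" by (rule LIMSEQ_realpow_zero) auto
    from order_tendstoD(2)[OF this that] show ?thesis
      by (auto simp: eventually_sequentially power_one_over intro: less_imp_le)
  qed
  have "\<exists>N. \<forall>j\<ge>N. \<forall>k\<ge>N. l2_norm w (\<lambda>z. x j z - x k z) \<le> e" if e: "0 < e" for e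
  proof -
    obtain N where N: "\<forall>n\<ge>N. 1 / 2 ^ n \<le> e / 2" using half[of "e / 2"] e by auto
    have "l2_norm w (\<lambda>z. x j z - x k z) \<le> e" if "N \<le> j" "N \<le> k" for j k
    proof -
      have "l2_norm w (\<lambda>z. x j z - x k z) \<le> l2_norm w (\<lambda>z. x j z - x N z) + l2_norm w (\<lambda>z. x N z - x k z)"
        by (rule l2_norm_diff_trans[OF x x x])
      also have "l2_norm w (\<lambda>z. x N z - x k z) = l2_norm w (\<lambda>z. x k z - x N z)" by (rule l2_norm_diff_commute)
      finally show ?thesis using nest[OF that(1)] nest[OF that(2)] r(1)[of j] r(1)[of k] r(2)[of N] N by force
    qed
    then show ?thesis by blast
  qed
  from l2_complete[of x, OF x this] obtain y where y: "y \<in> l2 w"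
    and lim: "\<And>e. 0 < e \<Longrightarrow> \<exists>N. \<forall>k\<ge>N. l2_norm w (\<lambda>z. x k z - y z) \<le> e" by blast
  have in_ball: "l2_norm w (\<lambda>z. y z - x n z) \<le> r n" for n
  proof (rule field_le_epsilon)
    fix e :: real assume "0 < e"
    then obtain N where N: "\<forall>k\<ge>N. l2_norm w (\<lambda>z. x k z - y z) \<le> e" using lim by blast
    have "l2_norm w (\<lambda>z. y z - x n z) \<le> l2_norm w (\<lambda>z. y z - x (max N n) z) + l2_norm w (\<lambda>z. x (max N n) z - x n z)"
      by (rule l2_norm_diff_trans[OF y x x])
    also have "l2_norm w (\<lambda>z. y z - x (max N n) z) \<le> e" using N l2_norm_diff_commute[of y "x (max N n)"] by simp
    also have "l2_norm w (\<lambda>z. x (max N n) z - x n z) \<le> r n" using nest[of n "max N n"] r(1)[of "max N n"] by simp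
    finally show "l2_norm w (\<lambda>z. y z - x n z) \<le> r n + e" by simp
  qed
  have "\<forall>\<^sub>F t in at_right 0. l2_norm w (\<lambda>z. S t y z - y z) < 1"
    by (rule order_tendstoD(2)[OF C0_cont[OF S order_refl y]]) simp
  then obtain d where d: "0 < d" "\<And>t. 0 < t \<Longrightarrow> t < d \<Longrightarrow> l2_norm w (\<lambda>z. S t y z - y z) < 1"
    unfolding eventually_at_right_field by auto
  have Sy: "l2_norm w (S t y) \<le> l2_norm w y + 1" if t: "0 \<le> t" "t < d" for t
  proof (cases "t = 0")
    case True
    then show ?thesis by (simp add: C0_zero[OF S order_refl y])
  next
    case False
    have "l2_norm w (S t y) \<le> l2_norm w (\<lambda>z. S t y z - y z) + l2_norm w y"
      using l2_norm_triangle[OF l2_diff[OF C0_l2[OF S t(1) y] y] y] by simp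
    then show ?thesis using d(2)[of t] t False by simp
  qed
  obtain n where n: "max (1 / d) (l2_norm w y + 1) < real n" using reals_Archimedean2 by blast
  have "1 / real (Suc n) < d"
  proof -
    have "1 / d < real (Suc n)" using n by simp
    then show ?thesis using d(1) by (simp add: field_simps)
  qed
  then have "l2_norm w (S (h (Suc n)) y) \<le> l2_norm w y + 1" using h[of n] by (intro Sy) auto
  moreover have "real n \<le> l2_norm w (S (h (Suc n)) y)" by (rule big[OF y in_ball])
  ultimately show False using n by simp
qed

text \<open>A number of steps that depends only on t and \<open>\<delta>\<close> brings each step
  length s/N below \<open>\<delta>\<close>, and the semigroup law multiplies the bounds.\<close>

lemma C0_locally_bounded:
  assumes S: "C0_semigroup w S" and t: "0 \<le> t"
  obtains B where "0 \<le> B" "\<And>s f. 0 \<le> s \<Longrightarrow> s \<le> t \<Longrightarrow> f \<in> l2 w \<Longrightarrow> l2_norm w (S s f) \<le> B * l2_norm w f"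
proof -
  obtain \<delta> B where \<delta>: "0 < \<delta>" and B: "1 \<le> B"
    "\<And>h f. 0 \<le> h \<Longrightarrow> h \<le> \<delta> \<Longrightarrow> f \<in> l2 w \<Longrightarrow> l2_norm w (S h f) \<le> B * l2_norm w f"
    using C0_bounded_near_zero[OF S] by metis
  obtain N where N: "t / \<delta> < real N" using reals_Archimedean2 by blast
  have N0: "0 < N" using N t \<delta> by (cases N) (auto simp: field_simps)
  have "l2_norm w (S (real k * h) f) \<le> B ^ k * l2_norm w f" if h: "0 \<le> h" "h \<le> \<delta>" and f: "f \<in> l2 w" for k h f
  proof (induction k)
    case 0 show ?case by (simp add: C0_zero[OF S order_refl f])
  next
    case (Suc k)
    have kh: "0 \<le> real k * h" using h by simp
    have "S (real (Suc k) * h) f = S h (S (real k * h) f)"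
      using C0_add[OF S kh f h(1)] by (simp add: algebra_simps)
    then have "l2_norm w (S (real (Suc k) * h) f) \<le> B * l2_norm w (S (real k * h) f)"
      using B(2)[OF h C0_l2[OF S kh f]] by simp
    also have "\<dots> \<le> B * (B ^ k * l2_norm w f)" using B by (intro mult_left_mono Suc.IH) simp
    finally show ?case by (simp add: mult.assoc)
  qed
  note pw = this
  have "l2_norm w (S s f) \<le> B ^ N * l2_norm w f" if "0 \<le> s" "s \<le> t" "f \<in> l2 w" for s f
  proof -
    have "s / real N \<le> \<delta>" using N N0 \<delta> that by (simp add: field_simps)
    then show ?thesis using pw[of "s / real N" f N] that N0 by simp
  qed
  then show ?thesis using that[of "B ^ N"] B(1) by simp
qed

lemma generator_invariant:
  assumes S: "C0_semigroup w S" and a: "0 \<le> a" and f: "(f, f') \<in> semigroup_generator w S"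
  shows "(S a f, S a f') \<in> semigroup_generator w S"
proof -
  have l: "f \<in> l2 w" "f' \<in> l2 w" and lim: "((\<lambda>t. l2_norm w (\<lambda>x. (S t f x - f x) / t - f' x)) \<longlongrightarrow> 0) (at_right 0)"
    using f by (auto simp: semigroup_generator_def)
  obtain B where B: "\<And>f. f \<in> l2 w \<Longrightarrow> l2_norm w (S a f) \<le> B * l2_norm w f"
    using C0_bounded[OF S a] by blast
  have "((\<lambda>t. l2_norm w (\<lambda>x. (S t (S a f) x - S a f x) / t - S a f' x)) \<longlongrightarrow> 0) (at_right 0)"
  proof (rule Lim_null_comparison)
    show "((\<lambda>t. B * l2_norm w (\<lambda>x. (S t f x - f x) / t - f' x)) \<longlongrightarrow> 0) (at_right 0)"
      using tendsto_mult[OF tendsto_const lim, of B] by simp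
    show "\<forall>\<^sub>F t in at_right 0. norm (l2_norm w (\<lambda>x. (S t (S a f) x - S a f x) / t - S a f' x))
        \<le> B * l2_norm w (\<lambda>x. (S t f x - f x) / t - f' x)"
      using eventually_at_right_less[of 0]
    proof eventually_elim
      case (elim t)
      then have t: "0 \<le> t" by simp
      have u: "(\<lambda>x. S t f x - f x) \<in> l2 w" by (intro l2_diff C0_l2[OF S t] l)
      have u': "(\<lambda>x. (1 / t) * (S t f x - f x)) \<in> l2 w" by (rule l2_scale[OF u])
      have "S t (S a f) = S a (S t f)"
        using C0_add[OF S a l(1) t] C0_add[OF S t l(1) a] by (simp add: add.commute)
      moreover have "S a (\<lambda>x. (1 / t) * (S t f x - f x) - f' x) = (\<lambda>x. (1 / t) * (S a (S t f) x - S a f x) - S a f' x)"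
        by (simp only: C0_diff[OF S a u' l(2)] C0_scale[OF S a u] C0_diff[OF S a C0_l2[OF S t l(1)] l(1)])
      ultimately have "(\<lambda>x. (S t (S a f) x - S a f x) / t - S a f' x) = S a (\<lambda>x. (1 / t) * (S t f x - f x) - f' x)"
        by simp
      then show ?case using B[OF l2_diff[OF u' l(2)]] by (simp add: l2_norm_nonneg)
    qed
  qed
  then show ?thesis using C0_l2[OF S a] l by (simp add: semigroup_generator_def)
qed

lemma generator_increment:
  assumes S: "C0_semigroup w S" and f: "(f, f') \<in> semigroup_generator w S" and e: "0 < e"
  obtains \<delta> where "0 < \<delta>" "\<And>h. 0 < h \<Longrightarrow> h < \<delta> \<Longrightarrow> l2_norm w (\<lambda>x. S h f x - f x - h * f' x) \<le> e * h"
proof -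
  have l: "f \<in> l2 w" "f' \<in> l2 w" and lim: "((\<lambda>t. l2_norm w (\<lambda>x. (S t f x - f x) / t - f' x)) \<longlongrightarrow> 0) (at_right 0)"
    using f by (auto simp: semigroup_generator_def)
  have "\<forall>\<^sub>F t in at_right 0. l2_norm w (\<lambda>x. (S t f x - f x) / t - f' x) < e"
    by (rule order_tendstoD(2)[OF lim e])
  then obtain d where d: "0 < d" "\<And>t. 0 < t \<Longrightarrow> t < d \<Longrightarrow> l2_norm w (\<lambda>x. (S t f x - f x) / t - f' x) < e"
    unfolding eventually_at_right_field by auto
  have "l2_norm w (\<lambda>x. S h f x - f x - h * f' x) \<le> e * h" if h: "0 < h" "h < d" for h
  proof -
    have "(\<lambda>x. S h f x - f x - h * f' x) = (\<lambda>x. h * ((S h f x - f x) / h - f' x))"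
      using h by (auto simp: field_simps)
    then have "l2_norm w (\<lambda>x. S h f x - f x - h * f' x) = h * l2_norm w (\<lambda>x. (S h f x - f x) / h - f' x)"
      using h l2_norm_scale[of h] by simp
    then show ?thesis using d(2)[OF h] h by (simp add: mult.commute)
  qed
  then show ?thesis using that d(1) by blast
qed

text \<open>\<open>\<langle>S\<^sub>s f, T\<^bsub>t-s\<^esub> g\<rangle>\<close> is shown to be constant in \<open>s\<close> by telescoping over fine partitions, since its
  increments are \<open>o(h)\<close> by symmetry. No left derivative of \<open>S\<close> is needed.\<close>

lemma symmetric_generator_adjoint:
  assumes S: "C0_semigroup w S" and T: "C0_semigroup w T"
    and eq: "semigroup_generator w S = A" "semigroup_generator w T = A"
    and sym: "\<And>f f' g g'. (f, f') \<in> A \<Longrightarrow> (g, g') \<in> A \<Longrightarrow> l2_inner w f' g = l2_inner w f g'"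
    and f: "(f, f') \<in> A" and g: "(g, g') \<in> A" and t: "0 \<le> t"
  shows "l2_inner w (S t f) g = l2_inner w f (T t g)"
proof (cases "t = 0")
  case True
  then show ?thesis using f g eq C0_zero[OF S order_refl] C0_zero[OF T order_refl]
    by (auto simp: semigroup_generator_def)
next
  case False
  then have tp: "0 < t" using t by simp
  have fl: "f \<in> l2 w" "f' \<in> l2 w" and gl: "g \<in> l2 w" "g' \<in> l2 w"
    using f g eq by (auto simp: semigroup_generator_def)
  obtain B where B: "0 \<le> B" "\<And>s f. 0 \<le> s \<Longrightarrow> s \<le> t \<Longrightarrow> f \<in> l2 w \<Longrightarrow> l2_norm w (S s f) \<le> B * l2_norm w f"
    using C0_locally_bounded[OF S t] by blast
  obtain D where D: "0 \<le> D" "\<And>s f. 0 \<le> s \<Longrightarrow> s \<le> t \<Longrightarrow> f \<in> l2 w \<Longrightarrow> l2_norm w (T s f) \<le> D * l2_norm w f"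
    using C0_locally_bounded[OF T t] by blast
  define K where "K = B * D * (l2_norm w f + l2_norm w g)"
  have K: "0 \<le> K" unfolding K_def using B D by (intro mult_nonneg_nonneg add_nonneg_nonneg l2_norm_nonneg)
  have small: "\<bar>l2_inner w (S t f) g - l2_inner w f (T t g)\<bar> \<le> t * (e * K)" if e: "0 < e" for e
  proof -
    obtain d1 where d1: "0 < d1" "\<And>h. 0 < h \<Longrightarrow> h < d1 \<Longrightarrow> l2_norm w (\<lambda>x. S h f x - f x - h * f' x) \<le> e * h"
      using generator_increment[OF S f[folded eq(1)] e] by blast
    obtain d2 where d2: "0 < d2" "\<And>h. 0 < h \<Longrightarrow> h < d2 \<Longrightarrow> l2_norm w (\<lambda>x. T h g x - g x - h * g' x) \<le> e * h"
      using generator_increment[OF T g[folded eq(2)] e] by blast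
    \<comment> \<open>The partition is so fine that both generator increments have error at most e h
      over one step.\<close>
    obtain N where N: "t / min d1 d2 < real N" using reals_Archimedean2 by blast
    have dm: "0 < min d1 d2" using d1 d2 by simp
    have N0: "0 < real N" using N divide_nonneg_pos[OF t dm] by linarith
    define h where "h = t / real N"
    have "t / real N < min d1 d2" using N N0 dm by (simp only: pos_divide_less_eq mult.commute)
    then have h: "0 < h" "h < d1" "h < d2" "real N * h = t"
      using N0 tp by (auto simp: h_def)
    let ?\<phi> = "\<lambda>k. l2_inner w (S (real k * h) f) (T (t - real k * h) g)"
    have step: "\<bar>?\<phi> (Suc k) - ?\<phi> k\<bar> \<le> h * (e * K)" if k: "k < N" for k
    proof -
      define a where "a = real k * h"
      define c where "c = t - real (Suc k) * h"
      have "real (Suc k) * h \<le> real N * h" using k h(1) by (intro mult_right_mono) auto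
      then have ac: "0 \<le> a" "0 \<le> c" "a \<le> t" "c \<le> t" "t - a = h + c" "h + a = real (Suc k) * h"
        using h by (auto simp: a_def c_def algebra_simps)
      have h0: "0 \<le> h" using h by simp
      let ?\<rho> = "\<lambda>x. S h f x - f x - h * f' x" and ?\<sigma> = "\<lambda>x. T h g x - g x - h * g' x"
      have Sh: "S h f \<in> l2 w" "T h g \<in> l2 w" using C0_l2[OF S h0] C0_l2[OF T h0] fl gl by auto
      have df: "(\<lambda>x. S h f x - f x) \<in> l2 w" "(\<lambda>x. h * f' x) \<in> l2 w" by (intro l2_diff l2_scale Sh fl)+
      have dg: "(\<lambda>x. T h g x - g x) \<in> l2 w" "(\<lambda>x. h * g' x) \<in> l2 w" by (intro l2_diff l2_scale Sh gl)+
      have \<rho>: "?\<rho> \<in> l2 w" by (rule l2_diff[OF df])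
      have \<sigma>: "?\<sigma> \<in> l2 w" by (rule l2_diff[OF dg])
      have Sl: "S a f \<in> l2 w" "S a f' \<in> l2 w" "S a ?\<rho> \<in> l2 w" by (intro C0_l2[OF S ac(1)] fl \<rho>)+
      have Tl: "T c g \<in> l2 w" "T c g' \<in> l2 w" "T c ?\<sigma> \<in> l2 w" by (intro C0_l2[OF T ac(2)] gl \<sigma>)+
      have e1: "S (h + a) f = (\<lambda>x. S a f x + (S a ?\<rho> x + h * S a f' x))"
        using C0_add[OF S h0 fl(1) ac(1)]
        by (simp add: add.commute C0_diff[OF S ac(1) df] C0_diff[OF S ac(1) Sh(1) fl(1)] C0_scale[OF S ac(1) fl(2)])
      have e2: "T (h + c) g = (\<lambda>x. T c g x + (T c ?\<sigma> x + h * T c g' x))"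
        using C0_add[OF T h0 gl(1) ac(2)]
        by (simp add: add.commute C0_diff[OF T ac(2) dg] C0_diff[OF T ac(2) Sh(2) gl(1)] C0_scale[OF T ac(2) gl(2)])
      have "l2_inner w (S a f') (T c g) = l2_inner w (S a f) (T c g')"
        using generator_invariant[OF S ac(1) f[folded eq(1)]] generator_invariant[OF T ac(2) g[folded eq(2)]]
        by (intro sym) (simp_all add: eq)
      moreover have "?\<phi> (Suc k) = l2_inner w (S a f) (T c g) + (l2_inner w (S a ?\<rho>) (T c g) + h * l2_inner w (S a f') (T c g))"
        unfolding ac(6)[symmetric] e1 using Sl Tl
        by (simp add: l2_inner_add_left l2_inner_scale_left l2_add l2_scale c_def[symmetric] ac(6) del: of_nat_Suc)
      moreover have "?\<phi> k = l2_inner w (S a f) (T c g) + (l2_inner w (S a f) (T c ?\<sigma>) + h * l2_inner w (S a f) (T c g'))"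
        unfolding a_def[symmetric] ac(5) e2 using Sl Tl
        by (simp add: l2_inner_add_right l2_inner_scale_right l2_add l2_scale)
      \<comment> \<open>The first order terms cancel by symmetry of the common generator; only the
        two remainders of size e h are left.\<close>
      ultimately have "?\<phi> (Suc k) - ?\<phi> k = l2_inner w (S a ?\<rho>) (T c g) - l2_inner w (S a f) (T c ?\<sigma>)" by simp
      moreover have "\<bar>l2_inner w (S a ?\<rho>) (T c g)\<bar> \<le> (B * (e * h)) * (D * l2_norm w g)"
      proof -
        have "\<bar>l2_inner w (S a ?\<rho>) (T c g)\<bar> \<le> l2_norm w (S a ?\<rho>) * l2_norm w (T c g)"
          by (rule l2_cauchy_schwarz[OF Sl(3) Tl(1)])
        also have "\<dots> \<le> (B * l2_norm w ?\<rho>) * (D * l2_norm w g)"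
          by (intro mult_mono B(2) D(2) ac gl \<rho> mult_nonneg_nonneg B(1) l2_norm_nonneg)
        also have "\<dots> \<le> (B * (e * h)) * (D * l2_norm w g)"
          by (intro mult_right_mono mult_left_mono d1(2) h B(1) D(1) mult_nonneg_nonneg l2_norm_nonneg)
        finally show ?thesis .
      qed
      moreover have "\<bar>l2_inner w (S a f) (T c ?\<sigma>)\<bar> \<le> (B * l2_norm w f) * (D * (e * h))"
      proof -
        have "\<bar>l2_inner w (S a f) (T c ?\<sigma>)\<bar> \<le> l2_norm w (S a f) * l2_norm w (T c ?\<sigma>)"
          by (rule l2_cauchy_schwarz[OF Sl(1) Tl(3)])
        also have "\<dots> \<le> (B * l2_norm w f) * (D * l2_norm w ?\<sigma>)"
          by (intro mult_mono B(2) D(2) ac fl \<sigma> mult_nonneg_nonneg B(1) l2_norm_nonneg)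
        also have "\<dots> \<le> (B * l2_norm w f) * (D * (e * h))"
          by (intro mult_left_mono d2(2) h B(1) D(1) mult_nonneg_nonneg l2_norm_nonneg)
        finally show ?thesis .
      qed
      moreover have "(B * (e * h)) * (D * l2_norm w g) + (B * l2_norm w f) * (D * (e * h)) = h * (e * K)"
        by (simp add: K_def algebra_simps)
      ultimately show ?thesis by linarith
    qed
    have "\<bar>?\<phi> n - ?\<phi> 0\<bar> \<le> real n * (h * (e * K))" if "n \<le> N" for n
      using that
    proof (induction n)
      case (Suc n)
      then have "\<bar>?\<phi> n - ?\<phi> 0\<bar> \<le> real n * (h * (e * K))" "\<bar>?\<phi> (Suc n) - ?\<phi> n\<bar> \<le> h * (e * K)"
        using step[of n] by auto
      then have "\<bar>?\<phi> (Suc n) - ?\<phi> 0\<bar> \<le> real n * (h * (e * K)) + h * (e * K)" by linarith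
      then show ?case by (simp add: algebra_simps)
    qed simp
    from this[of N] have "\<bar>?\<phi> N - ?\<phi> 0\<bar> \<le> (real N * h) * (e * K)" by (simp add: mult.assoc)
    moreover have "?\<phi> N = l2_inner w (S t f) g" "?\<phi> 0 = l2_inner w f (T t g)"
      using h(4) C0_zero[OF S order_refl fl(1)] C0_zero[OF T order_refl gl(1)] by simp_all
    ultimately show ?thesis by (simp add: h(4))
  qed
  have "\<bar>l2_inner w (S t f) g - l2_inner w f (T t g)\<bar> \<le> 0"
  proof (rule field_le_epsilon)
    fix e :: real assume e: "0 < e"
    have tK: "0 < t * K + 1" using t K by (simp add: add_nonneg_pos)
    have "t * (e / (t * K + 1) * K) \<le> e"
    proof -
      have "t * (e / (t * K + 1) * K) = e * (t * K) / (t * K + 1)" by simp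
      also have "\<dots> \<le> e" using e tK by (simp add: pos_divide_le_eq)
      finally show ?thesis .
    qed
    then show "\<bar>l2_inner w (S t f) g - l2_inner w f (T t g)\<bar> \<le> 0 + e"
      using small[of "e / (t * K + 1)"] e tK by simp
  qed
  then show ?thesis by simp
qed

end

context elliptic_graph
begin

text \<open>\<open>T\<close> witnesses that the choice is meaningful. Whatever semigroup was chosen
  is adjoint to \<open>T\<close> on the generator domain, and \<open>T\<close> is symmetric, so both
  agree on indicators, which is all that \<open>heat_kernel\<close> reads.\<close>

lemma heat_l2_indicator:
  assumes t: "0 \<le> t"
  shows "heat_l2 b m t (indicator {y}) x = q t x y"
proof -
  let ?A = "{(f, L f) | f. f \<in> gen_dom}"
  let ?S = "heat_l2 b m"
  have A: "{(f, \<lambda>x. - h x) | f h. (f, h) \<in> graph_operator b m} = ?A"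
    by (auto simp: graph_operator_eq)
  have S: "C0_semigroup m ?S \<and> semigroup_generator m ?S = ?A"
    unfolding heat_l2_def A by (rule someI[of _ T]) (simp add: T_C0_semigroup T_generator)
  have "l2_inner m (?S t (indicator {y})) (indicator {x}) = l2_inner m (indicator {y}) (T t (indicator {x}))"
    by (rule M.symmetric_generator_adjoint[where A="?A" and f'="L (indicator {y})" and g'="L (indicator {x})"])
       (use S T_C0_semigroup T_generator t in \<open>auto intro: Cc_gen_dom Cc_indicator gen_dom_symmetric\<close>)
  also have "\<dots> = l2_inner m (T t (indicator {y})) (indicator {x})"
    by (rule T_symmetric[symmetric, OF t]) (auto intro: Cc_l2 Cc_indicator)
  finally show ?thesis using m_pos[of x] by (simp add: l2_inner_indicator T_indicator)
qed

lemma heat_eq_T: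
  assumes "0 \<le> t" shows "heat b m t f x = T t f x"
proof -
  have "heat_l2 b m t (indicator {y}) x / m y * f y * m y = q t x y * f y" for y
    using m_pos[of y] heat_l2_indicator[OF assms] by simp
  then show ?thesis by (simp add: heat_def heat_kernel_def T_def)
qed

end

section \<open>Differentiating along the semigroup\<close>

context elliptic_graph
begin

text \<open>Finite sums encode summability together with an explicit constant, which can be kept
  uniform in time.\<close>

definition l1_bound :: "('a \<Rightarrow> real) \<Rightarrow> real \<Rightarrow> bool" where
  "l1_bound g K \<longleftrightarrow> (\<forall>G. finite G \<longrightarrow> (\<Sum>y\<in>G. \<bar>g y\<bar> * m y) \<le> K)"

lemma l1_bound_summable: "l1_bound g K \<Longrightarrow> (\<lambda>y. \<bar>g y\<bar> * m y) summable_on UNIV"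
  unfolding l1_bound_def using m_pos
  by (intro nonneg_bdd_above_summable_on bdd_aboveI2[where M=K]) (auto simp: less_imp_le)

lemma infsum_Fn_lim:
  fixes h :: "'a \<Rightarrow> real"
  assumes "H summable_on UNIV" "\<And>y. \<bar>h y\<bar> \<le> H y"
  shows "(\<lambda>k. \<Sum>y\<in>Fn k. h y) \<longlonglongrightarrow> infsum h UNIV" "h summable_on UNIV"
proof -
  have H0: "0 \<le> H y" for y using assms(2)[of y] by linarith
  have p: "(\<lambda>k. trunc k h y) \<longlonglongrightarrow> h y" for y
    by (rule tendsto_eventually) (use eventually_Fn[of y] in eventually_elim, simp add: trunc_def)
  have le: "\<bar>trunc k h y\<bar> \<le> H y" for k y using assms(2) H0 by (simp add: trunc_def)
  have "infsum (trunc k h) UNIV = (\<Sum>y\<in>Fn k. h y)" for k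
  proof -
    have "infsum (trunc k h) UNIV = infsum h (Fn k)" by (rule infsum_cong_neutral) (auto simp: trunc_def)
    then show ?thesis by (simp add: finite_Fn)
  qed
  then show "(\<lambda>k. \<Sum>y\<in>Fn k. h y) \<longlonglongrightarrow> infsum h UNIV"
    using infsum_dominated_convergence(2)[OF assms(1) le p] by simp
  show "h summable_on UNIV" by (rule infsum_dominated_convergence(1)[OF assms(1) le p])
qed

lemma T_abs_le:
  assumes "0 \<le> s" "\<And>y. \<bar>f y\<bar> \<le> B"
  shows "\<bar>T s f x\<bar> \<le> B"
proof -
  have B: "0 \<le> B" using assms(2)[of x] by linarith
  have q0: "0 \<le> q s x y" for y by (rule q_nonneg[OF assms(1)])
  have bs: "(\<lambda>y. q s x y * B) summable_on UNIV" by (intro summable_on_cmult_left q_summable assms)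
  have le: "norm (q s x y * f y) \<le> q s x y * B" for y
    using q0[of y] assms(2)[of y] by (simp add: abs_mult mult_left_mono)
  have "\<bar>T s f x\<bar> \<le> (\<Sum>\<^sub>\<infinity>y. q s x y * B)"
    unfolding T_def real_norm_def[symmetric] by (rule norm_infsum_le[OF has_sum_infsum has_sum_infsum])
       (use le bs infsum_Fn_lim(2)[OF bs] in auto)
  also have "\<dots> = infsum (q s x) UNIV * B" by (rule infsum_cmult_left')
  also have "\<dots> \<le> 1 * B" by (intro mult_right_mono q_infsum_le assms B)
  finally show ?thesis by simp
qed

lemma Cc_bounded:
  assumes "f \<in> Cc" obtains B where "0 \<le> B" "\<And>y. \<bar>f y\<bar> \<le> B"
proof
  have G: "finite {y. f y \<noteq> 0}" using assms by (simp add: Cc_def)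
  show "0 \<le> (\<Sum>y | f y \<noteq> 0. \<bar>f y\<bar>)" by (rule sum_nonneg) simp
  show "\<bar>f y\<bar> \<le> (\<Sum>y | f y \<noteq> 0. \<bar>f y\<bar>)" for y
    by (cases "f y = 0") (use G in \<open>auto intro: member_le_sum sum_nonneg\<close>)
qed

text \<open>The column is the evolved indicator, so its Laplacian is \<open>T s\<close> applied to a
  finitely supported function, and \<open>T s\<close> contracts the supremum norm.\<close>

lemma laplacian_col_bound:
  obtains B where "0 \<le> B" "\<And>s y. 0 \<le> s \<Longrightarrow> \<bar>L (\<lambda>z. q s z x) y\<bar> \<le> B"
proof -
  obtain B where B: "0 \<le> B" "\<And>y. \<bar>L (indicator {x}) y\<bar> \<le> B"
    using Cc_bounded[OF laplacian_Cc[OF Cc_indicator]] by blast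
  have "\<bar>L (\<lambda>z. q s z x) y\<bar> \<le> B" if "0 \<le> s" for s y
  proof -
    have "T s (indicator {x}) = (\<lambda>z. q s z x)" by (auto simp: T_indicator)
    then have "L (\<lambda>z. q s z x) = T s (L (indicator {x}))"
      using T_laplacian_Cc[OF Cc_indicator that, of x] by simp
    then show ?thesis using T_abs_le[OF that B(2)] by simp
  qed
  then show ?thesis using that B(1) by blast
qed

lemma q_swap: "0 \<le> s \<Longrightarrow> q s x y = q s y x * m y / m x"
  using q_sym[of s x y] m_pos[of x] by (simp add: field_simps)

text \<open>By ellipticity the edge part of the Laplacian of \<open>p\<^sub>s(x,\<cdot>)\<close> is bounded, and so is the whole
  Laplacian. Hence so is the product of \<open>p\<^sub>s(x,\<cdot>)\<close> with the weighted degree, and the Laplacian of a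
  summable function can be integrated against \<open>p\<^sub>s(x,\<cdot>)\<close>.\<close>

lemma T_laplacian_l1:
  assumes s: "0 \<le> s" and g: "l1_bound g K"
  shows "(\<lambda>y. q s x y * L g y) summable_on UNIV"
    and "T s (L g) x = (\<Sum>\<^sub>\<infinity>y. L (\<lambda>z. q s z x) y * m y / m x * g y)"
proof -
  let ?u = "\<lambda>y. q s y x"
  obtain B where B: "0 \<le> B" "\<And>y. \<bar>L ?u y\<bar> \<le> B" using laplacian_col_bound[of x] s by metis
  have K: "0 \<le> K" using g unfolding l1_bound_def by (drule_tac spec[of _ "{}"]) simp
  have u0: "0 \<le> ?u y" for y by (rule q_nonneg[OF s])
  have gs: "(\<lambda>y. \<bar>g y\<bar> * m y) summable_on UNIV" by (rule l1_bound_summable[OF g])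
  have um: "(\<lambda>y. ?u y * m y) = (\<lambda>y. m x * q s x y)" using q_sym[OF s, of x] by (auto simp: mult.commute)
  have us: "(\<lambda>y. ?u y * m y) summable_on UNIV" unfolding um by (intro summable_on_cmult_right q_summable s)
  \<comment> \<open>Ellipticity bounds a weighted neighbour sum by C m(y) times a total mass,
    however many neighbours \<open>y\<close> has.\<close>
  have edge: "(\<Sum>z\<in>nbh y. b y z * \<bar>h z\<bar>) \<le> C * m y * R" if "\<And>G. finite G \<Longrightarrow> (\<Sum>z\<in>G. \<bar>h z\<bar> * m z) \<le> R" for h R y
  proof -
    have "(\<Sum>z\<in>nbh y. b y z * \<bar>h z\<bar>) \<le> (\<Sum>z\<in>nbh y. (C * m y) * (\<bar>h z\<bar> * m z))"
      using b_le[of y] by (intro sum_mono) (metis abs_ge_zero mult.assoc mult.commute mult_right_mono)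
    also have "\<dots> = C * m y * (\<Sum>z\<in>nbh y. \<bar>h z\<bar> * m z)" by (simp add: sum_distrib_left)
    also have "\<dots> \<le> C * m y * R" using C_pos m_pos[of y] that[OF b_finite] by (intro mult_left_mono) auto
    finally show ?thesis .
  qed
  define D where "D y = (\<Sum>z\<in>nbh y. b y z)" for y
  \<comment> \<open>Degree times kernel is the neighbour part minus m(y) times the Laplacian; both
    are bounded by multiples of m(y).\<close>
  have Du: "D y * ?u y \<le> (C * m x + B) * m y" for y
  proof -
    have "(\<Sum>z\<in>G. \<bar>?u z\<bar> * m z) \<le> m x" if "finite G" for G
    proof -
      have "(\<Sum>z\<in>G. \<bar>?u z\<bar> * m z) = m x * (\<Sum>z\<in>G. q s x z)"
        unfolding sum_distrib_left using fun_cong[OF um] u0 by (intro sum.cong) auto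
      then show ?thesis using q_sum_le[OF s that, of x] m_pos[of x] by (simp add: mult_left_le)
    qed
    from edge[OF this] have 1: "(\<Sum>z\<in>nbh y. b y z * ?u z) \<le> C * m y * m x" using u0 by simp
    have "m y * L ?u y = (\<Sum>z\<in>nbh y. b y z * ?u z) - D y * ?u y"
      using m_pos[of y] by (simp add: laplacian_def D_def right_diff_distrib sum_subtractf sum_distrib_right)
    moreover have "- (m y * B) \<le> m y * L ?u y"
    proof -
      have "- B \<le> L ?u y" using B(2)[of y] by linarith
      then have "m y * (- B) \<le> m y * L ?u y" using m_pos[of y] by (intro mult_left_mono) auto
      then show ?thesis by simp
    qed
    ultimately have "D y * ?u y \<le> C * m y * m x + m y * B" using 1 by linarith
    then show ?thesis by (simp add: algebra_simps)
  qed
  define H where "H y = C * K * (?u y * m y) + (C * m x + B) * (\<bar>g y\<bar> * m y)" for y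
  have Hs: "H summable_on UNIV"
    unfolding H_def by (intro summable_on_add summable_on_cmult_right us gs)
  \<comment> \<open>Stated for every \<open>h\<close> dominated by \<open>g\<close>, so that one
    majorant covers all truncations of \<open>g\<close> as well as \<open>g\<close> itself.\<close>
  have Hle: "\<bar>?u y * L h y * m y\<bar> \<le> H y" if h: "\<And>z. \<bar>h z\<bar> \<le> \<bar>g z\<bar>" for h y
  proof -
    have "\<bar>m y * L h y\<bar> = \<bar>\<Sum>z\<in>nbh y. b y z * (h z - h y)\<bar>" using m_pos[of y] by (simp add: laplacian_def)
    also have "\<dots> \<le> (\<Sum>z\<in>nbh y. b y z * \<bar>g z\<bar> + b y z * \<bar>g y\<bar>)"
    proof (rule order_trans[OF sum_abs sum_mono])
      fix z
      have "\<bar>h z - h y\<bar> \<le> \<bar>g z\<bar> + \<bar>g y\<bar>" using h[of z] h[of y] by linarith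
      then have "b y z * \<bar>h z - h y\<bar> \<le> b y z * (\<bar>g z\<bar> + \<bar>g y\<bar>)" using b_nonneg by (rule mult_left_mono)
      then show "\<bar>b y z * (h z - h y)\<bar> \<le> b y z * \<bar>g z\<bar> + b y z * \<bar>g y\<bar>"
        using b_nonneg[of y z] by (simp add: abs_mult distrib_left)
    qed
    also have "\<dots> = (\<Sum>z\<in>nbh y. b y z * \<bar>g z\<bar>) + D y * \<bar>g y\<bar>"
      by (simp add: sum.distrib D_def sum_distrib_right)
    also have "(\<Sum>z\<in>nbh y. b y z * \<bar>g z\<bar>) \<le> C * m y * K"
      using g unfolding l1_bound_def by (intro edge) blast
    finally have "?u y * \<bar>m y * L h y\<bar> \<le> ?u y * (C * m y * K + D y * \<bar>g y\<bar>)" using u0 by (intro mult_left_mono) auto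
    also have "\<dots> = C * K * (?u y * m y) + (D y * ?u y) * \<bar>g y\<bar>" by (simp add: algebra_simps)
    also have "(D y * ?u y) * \<bar>g y\<bar> \<le> ((C * m x + B) * m y) * \<bar>g y\<bar>" by (intro mult_right_mono Du) simp
    finally show ?thesis using u0[of y] by (simp add: H_def abs_mult mult_ac)
  qed
  have "(\<lambda>k. \<Sum>\<^sub>\<infinity>y. ?u y * L (trunc k g) y * m y) \<longlonglongrightarrow> (\<Sum>\<^sub>\<infinity>y. ?u y * L g y * m y)"
  proof (rule infsum_dominated_convergence(2)[OF Hs])
    show "\<bar>?u y * L (trunc k g) y * m y\<bar> \<le> H y" for k y by (rule Hle) (simp add: trunc_def)
    have "(\<lambda>k. trunc k g y) \<longlonglongrightarrow> g y" for y
      by (rule tendsto_eventually) (use eventually_Fn[of y] in eventually_elim, simp add: trunc_def)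
    then have "(\<lambda>k. L (trunc k g) y) \<longlonglongrightarrow> L g y" for y
      unfolding laplacian_def by (intro tendsto_mult tendsto_const tendsto_sum tendsto_diff)
    then show "(\<lambda>k. ?u y * L (trunc k g) y * m y) \<longlonglongrightarrow> ?u y * L g y * m y" for y
      by (intro tendsto_mult tendsto_const)
  qed
  moreover have "(\<lambda>k. \<Sum>\<^sub>\<infinity>y. ?u y * L (trunc k g) y * m y) \<longlonglongrightarrow> (\<Sum>\<^sub>\<infinity>y. L ?u y * g y * m y)"
  proof -
    have "(\<Sum>\<^sub>\<infinity>y. ?u y * L (trunc k g) y * m y) = (\<Sum>y\<in>Fn k. L ?u y * g y * m y)" for k
    proof -
      have "(\<Sum>\<^sub>\<infinity>y. ?u y * L (trunc k g) y * m y) = l2_inner m (trunc k g) (L ?u)"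
        using laplacian_symmetric_Cc[OF trunc_Cc, of ?u k g] by (simp add: l2_inner_def M.l2_inner_commute[of "trunc k g"] mult.commute)
      also have "\<dots> = (\<Sum>y\<in>Fn k. trunc k g y * L ?u y * m y)"
        by (rule M.l2_inner_finite_support[OF finite_Fn]) (simp add: trunc_def)
      finally show ?thesis by (simp add: trunc_def mult.commute cong: sum.cong)
    qed
    moreover have "(\<lambda>k. \<Sum>y\<in>Fn k. L ?u y * g y * m y) \<longlonglongrightarrow> (\<Sum>\<^sub>\<infinity>y. L ?u y * g y * m y)"
    proof (rule infsum_Fn_lim(1))
      show "(\<lambda>y. B * (\<bar>g y\<bar> * m y)) summable_on UNIV" by (intro summable_on_cmult_right gs)
      show "\<bar>L ?u y * g y * m y\<bar> \<le> B * (\<bar>g y\<bar> * m y)" for y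
        using mult_right_mono[OF B(2)[of y], of "\<bar>g y\<bar> * m y"] m_pos[of y] by (simp add: abs_mult mult.assoc)
    qed
    ultimately show ?thesis by simp
  qed
  ultimately have eq: "(\<Sum>\<^sub>\<infinity>y. ?u y * L g y * m y) = (\<Sum>\<^sub>\<infinity>y. L ?u y * g y * m y)" by (rule LIMSEQ_unique)
  have r: "q s x y * L g y = (1 / m x) * (?u y * L g y * m y)" for y
    unfolding q_swap[OF s, of x y] by simp
  have "(\<lambda>y. ?u y * L g y * m y) summable_on UNIV" by (rule infsum_Fn_lim(2)[OF Hs]) (rule Hle, simp)
  then show "(\<lambda>y. q s x y * L g y) summable_on UNIV" unfolding r by (rule summable_on_cmult_right)
  have "T s (L g) x = (1 / m x) * (\<Sum>\<^sub>\<infinity>y. L ?u y * g y * m y)"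
    unfolding T_def r infsum_cmult_right' eq ..
  also have "\<dots> = (\<Sum>\<^sub>\<infinity>y. L (\<lambda>z. q s z x) y * m y / m x * g y)"
    unfolding infsum_cmult_right'[symmetric] by (intro infsum_cong) simp
  finally show "T s (L g) x = (\<Sum>\<^sub>\<infinity>y. L (\<lambda>z. q s z x) y * m y / m x * g y)" .
qed

text \<open>Symmetry transfers the Laplacian to \<open>y\<close>, the variable summed over in
  \<open>T\<close>, from where it can be moved onto the other factor.\<close>

lemma q_deriv_right:
  assumes "0 \<le> s" "S \<subseteq> {0..}"
  shows "((\<lambda>s. q s x y) has_real_derivative L (\<lambda>z. q s z x) y * m y / m x) (at s within S)"
proof (cases "s \<in> S")
  case True
  have "((\<lambda>s. q s y x * (m y / m x)) has_real_derivative L (\<lambda>z. q s z x) y * (m y / m x)) (at s within S)"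
    by (rule DERIV_cmult_right[OF DERIV_subset[OF q_deriv[OF assms(1)] assms(2)]])
  then have "((\<lambda>s. q s x y) has_real_derivative L (\<lambda>z. q s z x) y * (m y / m x)) (at s within S)"
    by (rule has_field_derivative_transform_within[OF _ zero_less_one True])
       (use assms(2) in \<open>auto simp: q_swap[of _ x y]\<close>)
  then show ?thesis by simp
next
  case False
  have "((\<lambda>s. q s x y) has_real_derivative L (\<lambda>z. q s z x) y * (m y / m x)) (at s within {0..})"
    using assms(1) by (intro has_field_derivative_transform_within[OF DERIV_cmult_right[OF q_deriv[OF assms(1)]] zero_less_one])
      (auto simp: q_swap[of _ x y])
  then show ?thesis using DERIV_subset[OF _ assms(2)] by simp
qed

text \<open>Partial sums over finite sets are differentiated termwise. Their derivatives are bounded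
  uniformly in time, so the limit is taken under the time integral.\<close>

theorem T_path_integral:
  assumes ac: "0 \<le> a" "a \<le> c"
    and d: "\<And>s y. s \<in> {a..c} \<Longrightarrow> ((\<lambda>s. g s y) has_real_derivative g' s y) (at s within {a..c})"
    and cont: "\<And>y. continuous_on {a..c} (\<lambda>s. g' s y)"
    and K: "\<And>s. s \<in> {a..c} \<Longrightarrow> l1_bound (g s) K" and K': "\<And>s. s \<in> {a..c} \<Longrightarrow> l1_bound (g' s) K"
  shows "((\<lambda>s. T s (\<lambda>y. L (g s) y + g' s y) x) has_integral (T c (g c) x - T a (g a) x)) {a..c}"
proof -
  obtain B where B: "0 \<le> B" "\<And>s y. 0 \<le> s \<Longrightarrow> \<bar>L (\<lambda>z. q s z x) y\<bar> \<le> B" using laplacian_col_bound[of x] by blast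
  define q' where "q' s y = L (\<lambda>z. q s z x) y * m y / m x" for s y
  have sub: "{a..c} \<subseteq> {0..}" using ac by auto
  have q'le: "\<bar>q' s y * h\<bar> \<le> B / m x * (\<bar>h\<bar> * m y)" if "0 \<le> s" for s y h
  proof -
    have "\<bar>L (\<lambda>z. q s z x) y\<bar> * (m y / m x * \<bar>h\<bar>) \<le> B * (m y / m x * \<bar>h\<bar>)"
      using m_pos[of x] m_pos[of y] by (intro mult_right_mono B that mult_nonneg_nonneg) auto
    then show ?thesis using m_pos[of x] m_pos[of y] by (simp add: q'_def abs_mult abs_divide mult_ac)
  qed
  have qle: "\<bar>q s x y * h\<bar> \<le> 1 / m x * (\<bar>h\<bar> * m y)" if "0 \<le> s" for s y h
  proof -
    have "q s y x * (m y / m x * \<bar>h\<bar>) \<le> 1 * (m y / m x * \<bar>h\<bar>)"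
      using m_pos[of x] m_pos[of y] by (intro mult_right_mono q_le_one that mult_nonneg_nonneg) auto
    then show ?thesis unfolding q_swap[OF that, of x y]
      using m_pos[of x] m_pos[of y] q_nonneg[OF that, of y x] by (simp add: abs_mult abs_divide mult_ac)
  qed
  define F where "F k s = (\<Sum>y\<in>Fn k. q s x y * g s y)" for k s
  define dF where "dF k s = (\<Sum>y\<in>Fn k. q' s y * g s y + q s x y * g' s y)" for k s
  have gs: "(\<lambda>y. \<bar>g s y\<bar> * m y) summable_on UNIV" "(\<lambda>y. \<bar>g' s y\<bar> * m y) summable_on UNIV" if "s \<in> {a..c}" for s
    using l1_bound_summable K[OF that] K'[OF that] by auto
  have lim1: "(\<lambda>k. \<Sum>y\<in>Fn k. q s x y * g s y) \<longlonglongrightarrow> T s (g s) x" if s: "s \<in> {a..c}" for s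
    unfolding T_def using s sub
    by (intro infsum_Fn_lim(1)[OF summable_on_cmult_right[OF gs(1)[OF s], of "1 / m x"]] qle) auto
  have lim2: "(\<lambda>k. \<Sum>y\<in>Fn k. q s x y * g' s y) \<longlonglongrightarrow> T s (g' s) x"
    and sm2: "(\<lambda>y. q s x y * g' s y) summable_on UNIV" if s: "s \<in> {a..c}" for s
  proof -
    have le: "\<bar>q s x y * g' s y\<bar> \<le> 1 / m x * (\<bar>g' s y\<bar> * m y)" for y using s sub by (intro qle) auto
    show "(\<lambda>k. \<Sum>y\<in>Fn k. q s x y * g' s y) \<longlonglongrightarrow> T s (g' s) x" "(\<lambda>y. q s x y * g' s y) summable_on UNIV"
      unfolding T_def using infsum_Fn_lim[OF summable_on_cmult_right[OF gs(2)[OF s], of "1 / m x"] le] by auto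
  qed
  \<comment> \<open>Here the Laplacian passes from the kernel to \<open>g s\<close>, by
    \<open>T_laplacian_l1\<close>.\<close>
  have lim3: "(\<lambda>k. \<Sum>y\<in>Fn k. q' s y * g s y) \<longlonglongrightarrow> T s (L (g s)) x" if s: "s \<in> {a..c}" for s
  proof -
    have s0: "0 \<le> s" using s sub by auto
    show ?thesis
      unfolding T_laplacian_l1(2)[OF s0 K[OF s]] q'_def[symmetric]
      by (intro infsum_Fn_lim(1)[OF summable_on_cmult_right[OF gs(1)[OF s], of "B / m x"]] q'le s0)
  qed
  have lim: "(\<lambda>k. dF k s) \<longlonglongrightarrow> T s (\<lambda>y. L (g s) y + g' s y) x" if s: "s \<in> {a..c}" for s
  proof -
    have s0: "0 \<le> s" using s sub by auto
    have "T s (\<lambda>y. L (g s) y + g' s y) x = T s (L (g s)) x + T s (g' s) x"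
      unfolding T_def distrib_left by (rule infsum_add[OF T_laplacian_l1(1)[OF s0 K[OF s]] sm2[OF s]])
    then show ?thesis unfolding dF_def sum.distrib using tendsto_add[OF lim3[OF s] lim2[OF s]] by simp
  qed
  have bound: "norm (dF k s) \<le> (B / m x + 1 / m x) * K" if s: "s \<in> {a..c}" for k s
  proof -
    have s0: "0 \<le> s" using s sub by auto
    have "\<bar>dF k s\<bar> \<le> (\<Sum>y\<in>Fn k. B / m x * (\<bar>g s y\<bar> * m y) + 1 / m x * (\<bar>g' s y\<bar> * m y))"
      unfolding dF_def
    proof (rule order_trans[OF sum_abs sum_mono])
      fix y
      show "\<bar>q' s y * g s y + q s x y * g' s y\<bar> \<le> B / m x * (\<bar>g s y\<bar> * m y) + 1 / m x * (\<bar>g' s y\<bar> * m y)"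
        using q'le[OF s0, of y "g s y"] qle[OF s0, of y "g' s y"] by linarith
    qed
    also have "\<dots> = B / m x * (\<Sum>y\<in>Fn k. \<bar>g s y\<bar> * m y) + 1 / m x * (\<Sum>y\<in>Fn k. \<bar>g' s y\<bar> * m y)"
      by (simp only: sum.distrib sum_distrib_left)
    also have "\<dots> \<le> B / m x * K + 1 / m x * K"
    proof (intro add_mono mult_left_mono)
      show "(\<Sum>y\<in>Fn k. \<bar>g s y\<bar> * m y) \<le> K" "(\<Sum>y\<in>Fn k. \<bar>g' s y\<bar> * m y) \<le> K"
        using K[OF s] K'[OF s] finite_Fn unfolding l1_bound_def by blast+
    qed (use B m_pos[of x] in auto)
    finally show ?thesis by (simp add: distrib_right)
  qed
  have qc: "continuous_on {a..c} (\<lambda>s. q s z y)" for z y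
    unfolding continuous_on_eq_continuous_within
  proof
    fix s assume "s \<in> {a..c}"
    then show "continuous (at s within {a..c}) (\<lambda>s. q s z y)"
      using sub by (intro DERIV_continuous[OF DERIV_subset[OF q_deriv sub]]) auto
  qed
  have gc: "continuous_on {a..c} (\<lambda>s. g s y)" for y
    unfolding continuous_on_eq_continuous_within using DERIV_continuous[OF d] by blast
  have dFc: "continuous_on {a..c} (dF k)" for k
    unfolding dF_def q'_def laplacian_def using m_pos[of x]
    by (intro continuous_intros qc gc cont) auto
  have FTC: "(dF k has_integral (F k c - F k a)) {a..c}" for k
  proof (rule fundamental_theorem_of_calculus[OF ac(2)])
    fix s assume s: "s \<in> {a..c}"
    have s0: "0 \<le> s" using s sub by auto
    have "((\<lambda>s. q s x y * g s y) has_real_derivative q' s y * g s y + q s x y * g' s y) (at s within {a..c})" for y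
      using DERIV_mult[OF q_deriv_right[OF s0 sub, of x y] d[OF s, of y]] by (simp add: q'_def mult.commute add.commute)
    then have "(F k has_real_derivative dF k s) (at s within {a..c})"
      unfolding F_def dF_def by (intro DERIV_sum)
    then show "(F k has_vector_derivative dF k s) (at s within {a..c})"
      by (simp add: has_real_derivative_iff_has_vector_derivative)
  qed
  have I: "(\<lambda>s. T s (\<lambda>y. L (g s) y + g' s y) x) integrable_on {a..c}"
    "(\<lambda>k. integral {a..c} (dF k)) \<longlonglongrightarrow> integral {a..c} (\<lambda>s. T s (\<lambda>y. L (g s) y + g' s y) x)"
    using dominated_convergence[of dF "{a..c}" "\<lambda>_. (B / m x + 1 / m x) * K", OF integrable_continuous_interval[OF dFc] _ bound lim]
    by (auto simp: integrable_const_ivl)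
  have "(\<lambda>k. integral {a..c} (dF k)) \<longlonglongrightarrow> T c (g c) x - T a (g a) x"
    unfolding integral_unique[OF FTC] F_def using ac by (intro tendsto_diff lim1) auto
  from LIMSEQ_unique[OF I(2) this] integrable_integral[OF I(1)] show ?thesis by simp
qed

section \<open>Explicit form and mass bounds of the carre du champ\<close>

lemma Gam_one: "Gam b m 1 f g x = (\<Sum>y\<in>nbh x. b x y * ((f y - f x) * (g y - g x))) / (2 * m x)"
proof -
  have "(\<Sum>y\<in>nbh x. b x y * (f y * g y - f x * g x)) - f x * (\<Sum>y\<in>nbh x. b x y * (g y - g x))
      - (\<Sum>y\<in>nbh x. b x y * (f y - f x)) * g x = (\<Sum>y\<in>nbh x. b x y * ((f y - f x) * (g y - g x)))"
    unfolding sum_distrib_left sum_distrib_right sum_subtractf[symmetric]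
    by (intro sum.cong refl) (simp add: algebra_simps)
  then show ?thesis using m_pos[of x] by (simp add: laplacian_def field_simps)
qed

lemma Gamma_nonneg: "0 \<le> Gamma b m f x"
  unfolding Gam_one using m_pos[of x] b_nonneg by (intro divide_nonneg_pos sum_nonneg) auto

lemma Gam_commute: "Gam b m 1 f g x = Gam b m 1 g f x"
  unfolding Gam_one by (simp add: mult.commute)

lemma Gam_abs_le: "\<bar>Gam b m 1 f g x\<bar> \<le> Gamma b m f x + Gamma b m g x"
proof -
  have "\<bar>\<Sum>y\<in>nbh x. b x y * ((f y - f x) * (g y - g x))\<bar>
      \<le> (\<Sum>y\<in>nbh x. b x y * ((f y - f x) * (f y - f x)) + b x y * ((g y - g x) * (g y - g x)))"
  proof (rule order_trans[OF sum_abs sum_mono])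
    fix y
    let ?a = "f y - f x" and ?c = "g y - g x"
    have "\<bar>?a * ?c\<bar> \<le> ?a * ?a + ?c * ?c"
    proof -
      have "2 * \<bar>?a * ?c\<bar> \<le> ?a * ?a + ?c * ?c"
        using sum_squares_bound[of "\<bar>?a\<bar>" "\<bar>?c\<bar>"] by (simp add: power2_eq_square abs_mult mult.assoc)
      then show ?thesis using abs_ge_zero[of "?a * ?c"] by linarith
    qed
    from mult_left_mono[OF this b_nonneg]
    show "\<bar>b x y * (?a * ?c)\<bar> \<le> b x y * (?a * ?a) + b x y * (?c * ?c)"
      using b_nonneg[of x y] by (simp add: abs_mult distrib_left)
  qed
  then show ?thesis
    unfolding Gam_one add_divide_distrib[symmetric] sum.distrib[symmetric]
    using m_pos[of x] by (simp add: abs_divide divide_right_mono)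
qed

text \<open>Each vertex collects half of the squared differences along its outgoing ordered edges,
  and all of them together make up the energy.\<close>

lemma Gamma_l1_bound:
  assumes "f \<in> form_dom" shows "l1_bound (Gamma b m f) (energy f f)"
  unfolding l1_bound_def
proof (intro allI impI)
  fix G :: "'a set" assume G: "finite G"
  have "(\<Sum>x\<in>G. \<bar>Gamma b m f x\<bar> * m x) = (\<Sum>x\<in>G. (\<Sum>y\<in>nbh x. (grad f (x, y))\<^sup>2 * b x y) / 2)"
  proof (rule sum.cong)
    fix x
    have "(\<Sum>y\<in>nbh x. b x y * ((f y - f x) * (f y - f x))) = (\<Sum>y\<in>nbh x. (grad f (x, y))\<^sup>2 * b x y)"
      by (intro sum.cong) (simp_all add: grad_def power2_eq_square algebra_simps)
    then show "\<bar>Gamma b m f x\<bar> * m x = (\<Sum>y\<in>nbh x. (grad f (x, y))\<^sup>2 * b x y) / 2"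
      unfolding abs_of_nonneg[OF Gamma_nonneg] unfolding Gam_one using m_pos[of x] by simp
  qed simp
  also have "\<dots> = (\<Sum>p\<in>Sigma G nbh. (grad f p)\<^sup>2 * case_prod b p) / 2"
    unfolding sum_divide_distrib[symmetric] using G b_finite by (subst sum.Sigma) (auto simp: split_def)
  also have "\<dots> \<le> (grad_norm f)\<^sup>2 / 2"
    using W.l2_sum_le[OF form_dom_grad[OF assms], of "Sigma G nbh"] G b_finite by simp
  finally show "(\<Sum>x\<in>G. \<bar>Gamma b m f x\<bar> * m x) \<le> energy f f" by (simp add: energy_self)
qed

section \<open>Evolution identities along the reversed flow\<close>

lemma T_reverse_deriv:
  assumes "f \<in> Cc" "0 \<le> s" "s \<le> t"
  shows "((\<lambda>s. T (t - s) f y) has_real_derivative - T (t - s) (L f) y) (at s within {0..t})"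
proof -
  have "((\<lambda>r. T r f y) \<circ> (\<lambda>s. t - s) has_real_derivative T (t - s) (L f) y * (0 - 1)) (at s within {0..t})"
  proof (rule DERIV_image_chain)
    show "((\<lambda>s. t - s) has_real_derivative 0 - 1) (at s within {0..t})" by (intro derivative_intros)
    show "((\<lambda>r. T r f y) has_real_derivative T (t - s) (L f) y) (at (t - s) within (-) t ` {0..t})"
      by (rule DERIV_subset[OF T_deriv_Cc']) (use assms in auto)
  qed
  then show ?thesis by (simp add: o_def)
qed

lemma T_reverse_cont:
  assumes "f \<in> Cc" shows "continuous_on {0..t} (\<lambda>s. T (t - s) f y)"
  unfolding continuous_on_eq_continuous_within
  using DERIV_continuous[OF T_reverse_deriv[OF assms]] by auto

lemma square_l1_bound:
  assumes "f \<in> l2 m" "l2_norm m f \<le> R" shows "l1_bound (\<lambda>y. (f y)\<^sup>2) (R\<^sup>2)"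
  unfolding l1_bound_def
proof (intro allI impI)
  fix G :: "'a set" assume "finite G"
  have "(\<Sum>y\<in>G. \<bar>(f y)\<^sup>2\<bar> * m y) \<le> (l2_norm m f)\<^sup>2"
    using M.l2_sum_le[OF assms(1) \<open>finite G\<close>] by simp
  also have "\<dots> \<le> R\<^sup>2" by (intro power_mono assms M.l2_norm_nonneg)
  finally show "(\<Sum>y\<in>G. \<bar>(f y)\<^sup>2\<bar> * m y) \<le> R\<^sup>2" .
qed

lemma l1_bound_mono:
  assumes "l1_bound g K" "l1_bound h K'" "\<And>y. \<bar>f y\<bar> \<le> \<alpha> * \<bar>g y\<bar> + \<beta> * \<bar>h y\<bar>" "0 \<le> \<alpha>" "0 \<le> \<beta>" "\<alpha> * K + \<beta> * K' \<le> R"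
  shows "l1_bound f R"
  unfolding l1_bound_def
proof (intro allI impI)
  fix G :: "'a set" assume G: "finite G"
  have "(\<Sum>y\<in>G. \<bar>f y\<bar> * m y) \<le> (\<Sum>y\<in>G. (\<alpha> * \<bar>g y\<bar> + \<beta> * \<bar>h y\<bar>) * m y)"
    using assms(3) m_pos by (intro sum_mono mult_right_mono) (auto simp: less_imp_le)
  also have "\<dots> = \<alpha> * (\<Sum>y\<in>G. \<bar>g y\<bar> * m y) + \<beta> * (\<Sum>y\<in>G. \<bar>h y\<bar> * m y)"
    by (simp add: sum.distrib sum_distrib_left algebra_simps)
  also have "\<dots> \<le> \<alpha> * K + \<beta> * K'"
    using assms G unfolding l1_bound_def by (intro add_mono mult_left_mono) auto
  finally show "(\<Sum>y\<in>G. \<bar>f y\<bar> * m y) \<le> R" using assms(6) by simp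
qed

lemma T_scale: "T s (\<lambda>y. k * h y) x = k * T s h x"
  unfolding T_def using infsum_cmult_right'[of k "\<lambda>y. q s x y * h y" UNIV] by (simp add: mult.left_commute)

text \<open>The endpoint \<open>c\<close> is kept free because the identity also yields comparison
  and continuity of the squared flow in \<open>c\<close>.\<close>

lemma variance_integral:
  assumes f: "f \<in> Cc" and c: "0 \<le> c" "c \<le> t"
  shows "((\<lambda>s. 2 * T s (Gamma b m (T (t - s) f)) x) has_integral (T c (\<lambda>y. (T (t - c) f y)\<^sup>2) x - (T t f x)\<^sup>2)) {0..c}"
proof -
  let ?u = "\<lambda>s. T (t - s) f"
  let ?g = "\<lambda>s y. (?u s y)\<^sup>2" and ?g' = "\<lambda>s y. - (2 * (?u s y * T (t - s) (L f) y))"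
  have sub: "{0..c} \<subseteq> {0..t}" using c by auto
  have Lf: "L f \<in> Cc" by (rule laplacian_Cc[OF f])
  define K where "K = (l2_norm m f)\<^sup>2 + (l2_norm m (L f))\<^sup>2"
  have "((\<lambda>s. T s (\<lambda>y. L (?g s) y + ?g' s y) x) has_integral (T c (?g c) x - T 0 (?g 0) x)) {0..c}"
  proof (rule T_path_integral[OF order_refl c(1), where K=K])
    fix s assume s: "s \<in> {0..c}"
    then have ts: "0 \<le> t - s" and st: "0 \<le> s" "s \<le> t" using c by auto
    have l: "T (t - s) f \<in> l2 m" "T (t - s) (L f) \<in> l2 m" by (intro T_contraction ts Cc_l2 f Lf)+
    have n: "l2_norm m (T (t - s) f) \<le> l2_norm m f" "l2_norm m (T (t - s) (L f)) \<le> l2_norm m (L f)"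
      by (intro T_contraction ts Cc_l2 f Lf)+
    note b1 = square_l1_bound[OF l(1) n(1)] and b2 = square_l1_bound[OF l(2) n(2)]
    show "l1_bound (?g s) K" by (rule l1_bound_mono[OF b1 b2, where \<alpha>=1 and \<beta>=0]) (auto simp: K_def)
    show "l1_bound (?g' s) K"
    proof (rule l1_bound_mono[OF b1 b2, where \<alpha>=1 and \<beta>=1])
      show "\<bar>?g' s y\<bar> \<le> 1 * \<bar>?g s y\<bar> + 1 * \<bar>(T (t - s) (L f) y)\<^sup>2\<bar>" for y
        using sum_squares_bound[of "\<bar>T (t - s) f y\<bar>" "\<bar>T (t - s) (L f) y\<bar>"] by (simp add: abs_mult mult.assoc)
    qed (auto simp: K_def)
    show "((\<lambda>s. ?g s y) has_real_derivative ?g' s y) (at s within {0..c})" for y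
      using DERIV_power[OF DERIV_subset[OF T_reverse_deriv[OF f st, of y] sub], of 2]
      by (simp add: mult.assoc mult.commute)
  next
    show "continuous_on {0..c} (\<lambda>s. ?g' s y)" for y
      by (intro continuous_intros continuous_on_subset[OF T_reverse_cont[OF f] sub]
          continuous_on_subset[OF T_reverse_cont[OF Lf] sub])
  qed
  moreover have "(\<lambda>y. L (?g s) y + ?g' s y) = (\<lambda>y. 2 * Gamma b m (?u s) y)" if "s \<in> {0..c}" for s
    using that c T_laplacian_Cc[OF f, of "t - s"] by (auto simp: power2_eq_square[abs_def])
  moreover have "T s (\<lambda>y. 2 * h y) x = 2 * T s h x" for s h
    by (rule T_scale)
  ultimately have "((\<lambda>s. 2 * T s (Gamma b m (?u s)) x) has_integral (T c (?g c) x - T 0 (?g 0) x)) {0..c}"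
    by (simp only: has_integral_eq cong: has_integral_cong)
  then show ?thesis by (simp add: T_zero[abs_def] T_zero)
qed

lemma q_summable_l1:
  assumes s: "0 \<le> s" and g: "l1_bound g K"
  shows "(\<lambda>y. q s x y * g y) summable_on UNIV"
proof (rule infsum_Fn_lim(2)[OF summable_on_cmult_right[OF l1_bound_summable[OF g], of "1 / m x"]])
  fix y
  have "q s y x * (m y / m x * \<bar>g y\<bar>) \<le> 1 * (m y / m x * \<bar>g y\<bar>)"
    using m_pos[of x] m_pos[of y] by (intro mult_right_mono q_le_one s mult_nonneg_nonneg) auto
  then show "\<bar>q s x y * g y\<bar> \<le> 1 / m x * (\<bar>g y\<bar> * m y)"
    unfolding q_swap[OF s, of x y]
    using m_pos[of x] m_pos[of y] q_nonneg[OF s, of y x] by (simp add: abs_mult abs_divide mult_ac)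
qed

lemma Gam_two: "2 * Gam b m 2 f f y = L (Gamma b m f) y - 2 * Gam b m 1 f (L f) y"
  unfolding numeral_2_eq_2 Gam.simps(2)[of b m "Suc 0"] using Gam_commute[of "L f" f y]
  by (simp del: Gam.simps)

text \<open>The time derivative involves Gamma(u, L u), which is dominated by Gamma(u) + Gamma(L u).
  Both have bounded mass, since \<open>f\<close> and \<open>L f\<close> are finitely supported and
  \<open>T_Cc_energy\<close> applies to each.\<close>

lemma Gamma_flow_integral:
  assumes f: "f \<in> Cc" and ac: "0 \<le> a" "a \<le> c" "c \<le> t"
  shows "((\<lambda>s. T s (\<lambda>y. exp (2 * K * s) * (2 * Gam b m 2 (T (t - s) f) (T (t - s) f) y + 2 * K * Gamma b m (T (t - s) f) y)) x)
    has_integral (exp (2 * K * c) * T c (Gamma b m (T (t - c) f)) x - exp (2 * K * a) * T a (Gamma b m (T (t - a) f)) x)) {a..c}"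
proof -
  let ?u = "\<lambda>s. T (t - s) f" and ?v = "\<lambda>s. T (t - s) (L f)"
  let ?g = "\<lambda>s y. exp (2 * K * s) * Gamma b m (?u s) y"
  let ?g' = "\<lambda>s y. exp (2 * K * s) * (2 * K * Gamma b m (?u s) y - 2 * Gam b m 1 (?u s) (?v s) y)"
  have Lf: "L f \<in> Cc" by (rule laplacian_Cc[OF f])
  have sub: "{a..c} \<subseteq> {0..t}" using ac by auto
  define E where "E = l2_norm m (L f) * l2_norm m f"
  define E' where "E' = l2_norm m (L (L f)) * l2_norm m (L f)"
  define X where "X = exp (2 * \<bar>K\<bar> * t)"
  \<comment> \<open>One constant for \<open>?g\<close> and \<open>?g'\<close>: \<open>X\<close>
    bounds the exponential, \<open>E\<close> and \<open>E'\<close> the two energies, and 2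
    Gamma(u,v) costs at most 2 Gamma(u) + 2 Gamma(v).\<close>
  define R where "R = X * (2 * \<bar>K\<bar> + 3) * E + X * 2 * E'"
  have X: "0 < X" by (simp add: X_def)
  have E0: "0 \<le> E" "0 \<le> E'" by (simp_all add: E_def E'_def M.l2_norm_nonneg)
  have "((\<lambda>s. T s (\<lambda>y. L (?g s) y + ?g' s y) x) has_integral (T c (?g c) x - T a (?g a) x)) {a..c}"
  proof (rule T_path_integral[OF ac(1,2), where K=R])
    fix s assume s: "s \<in> {a..c}"
    then have ts: "0 \<le> t - s" and st: "0 \<le> s" "s \<le> t" using ac by auto
    have eX: "exp (2 * K * s) \<le> X"
    proof -
      have "K * s \<le> \<bar>K\<bar> * t" using st by (intro mult_mono) auto
      then show ?thesis by (simp add: X_def)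
    qed
    have b1: "l1_bound (Gamma b m (?u s)) E"
      using Gamma_l1_bound[OF T_Cc_energy(1)[OF f ts]] T_Cc_energy(2)[OF f ts]
      unfolding l1_bound_def E_def by (meson order_trans)
    have b2: "l1_bound (Gamma b m (?v s)) E'"
      using Gamma_l1_bound[OF T_Cc_energy(1)[OF Lf ts]] T_Cc_energy(2)[OF Lf ts]
      unfolding l1_bound_def E'_def by (meson order_trans)
    have g0: "0 \<le> Gamma b m (?u s) y" "0 \<le> Gamma b m (?v s) y" for y by (rule Gamma_nonneg)+
    show "l1_bound (?g s) R"
    proof (rule l1_bound_mono[OF b1 b2, where \<alpha>=X and \<beta>=0])
      show "\<bar>?g s y\<bar> \<le> X * \<bar>Gamma b m (?u s) y\<bar> + 0 * \<bar>Gamma b m (?v s) y\<bar>" for y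
        using mult_right_mono[OF eX g0(1)[of y]] g0(1)[of y] by (simp add: abs_mult del: Gam.simps)
      have "X * E \<le> X * (2 * \<bar>K\<bar> + 3) * E" using X E0 by (intro mult_right_mono) auto
      moreover have "0 \<le> X * 2 * E'" using X E0 by simp
      ultimately show "X * E + 0 * E' \<le> R" unfolding R_def by linarith
    qed (use X in auto)
    show "l1_bound (?g' s) R"
    proof (rule l1_bound_mono[OF b1 b2, where \<alpha>="X * (2 * \<bar>K\<bar> + 3)" and \<beta>="X * 2"])
      fix y
      have "\<bar>2 * K * Gamma b m (?u s) y - 2 * Gam b m 1 (?u s) (?v s) y\<bar>
          \<le> 2 * \<bar>K\<bar> * Gamma b m (?u s) y + 2 * \<bar>Gam b m 1 (?u s) (?v s) y\<bar>"
        using abs_triangle_ineq4[of "2 * K * Gamma b m (?u s) y" "2 * Gam b m 1 (?u s) (?v s) y"] g0(1)[of y]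
        by (simp only: abs_mult abs_numeral abs_of_nonneg)
      also have "\<dots> \<le> (2 * \<bar>K\<bar> + 3) * Gamma b m (?u s) y + 2 * Gamma b m (?v s) y"
        unfolding distrib_right using Gam_abs_le[of "?u s" "?v s" y] g0[of y] by linarith
      finally have 1: "\<bar>2 * K * Gamma b m (?u s) y - 2 * Gam b m 1 (?u s) (?v s) y\<bar>
        \<le> (2 * \<bar>K\<bar> + 3) * Gamma b m (?u s) y + 2 * Gamma b m (?v s) y" .
      have "\<bar>?g' s y\<bar> \<le> X * ((2 * \<bar>K\<bar> + 3) * Gamma b m (?u s) y + 2 * Gamma b m (?v s) y)"
        unfolding abs_mult abs_exp_cancel by (rule mult_mono[OF eX 1]) (use X in auto)
      also have "\<dots> = X * (2 * \<bar>K\<bar> + 3) * Gamma b m (?u s) y + X * 2 * Gamma b m (?v s) y"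
        by (simp add: algebra_simps del: Gam.simps)
      finally show "\<bar>?g' s y\<bar> \<le> X * (2 * \<bar>K\<bar> + 3) * \<bar>Gamma b m (?u s) y\<bar> + X * 2 * \<bar>Gamma b m (?v s) y\<bar>"
        unfolding abs_of_nonneg[OF g0(1)] abs_of_nonneg[OF g0(2)] .
    qed (use X in \<open>auto simp: R_def\<close>)
    have du: "((\<lambda>s. ?u s z) has_real_derivative - ?v s z) (at s within {a..c})" for z
      by (rule DERIV_subset[OF T_reverse_deriv[OF f st] sub])
    show "((\<lambda>s. ?g s y) has_real_derivative ?g' s y) (at s within {a..c})" for y
    proof -
      have "((\<lambda>s. \<Sum>z\<in>nbh y. b y z * ((?u s z - ?u s y) * (?u s z - ?u s y))) has_real_derivative
          (\<Sum>z\<in>nbh y. - 2 * (b y z * ((?u s z - ?u s y) * (?v s z - ?v s y))))) (at s within {a..c})"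
        by (intro DERIV_sum) (auto intro!: derivative_eq_intros du simp: algebra_simps)
      from DERIV_cdivide[OF this, of "2 * m y"]
      have "((\<lambda>s. Gamma b m (?u s) y) has_real_derivative - 2 * Gam b m 1 (?u s) (?v s) y) (at s within {a..c})"
        unfolding Gam_one by (simp only: sum_distrib_left[symmetric] times_divide_eq_right)
      moreover have "((\<lambda>s. exp (2 * K * s)) has_real_derivative exp (2 * K * s) * (2 * K)) (at s within {a..c})"
        by (auto intro!: derivative_eq_intros)
      ultimately show ?thesis
        by (rule DERIV_cong[OF DERIV_mult[rotated]]) (simp add: algebra_simps del: Gam.simps)
    qed
  next
    fix y
    have c: "continuous_on {a..c} (\<lambda>s. ?u s z)" "continuous_on {a..c} (\<lambda>s. ?v s z)" for z
      by (rule continuous_on_subset[OF T_reverse_cont[OF f] sub] continuous_on_subset[OF T_reverse_cont[OF Lf] sub])+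
    show "continuous_on {a..c} (\<lambda>s. ?g' s y)"
      unfolding Gam_one using m_pos[of y] by (intro continuous_intros c) auto
  qed
  moreover have "(\<lambda>y. L (?g s) y + ?g' s y) = (\<lambda>y. exp (2 * K * s) * (2 * Gam b m 2 (?u s) (?u s) y + 2 * K * Gamma b m (?u s) y))"
    if "s \<in> {a..c}" for s
  proof
    fix y
    have Lu: "L (?u s) = ?v s" using T_laplacian_Cc[OF f, of "t - s"] that ac by auto
    have e: "L (Gamma b m (?u s)) y = 2 * Gam b m 2 (?u s) (?u s) y + 2 * Gam b m 1 (?u s) (?v s) y"
      using Gam_two[of "?u s" y] by (simp add: Lu del: Gam.simps)
    show "L (?g s) y + ?g' s y = exp (2 * K * s) * (2 * Gam b m 2 (?u s) (?u s) y + 2 * K * Gamma b m (?u s) y)"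
      unfolding laplacian_scale e by (simp only: distrib_left right_diff_distrib)
  qed
  ultimately have I: "((\<lambda>s. T s (\<lambda>y. exp (2 * K * s) * (2 * Gam b m 2 (?u s) (?u s) y + 2 * K * Gamma b m (?u s) y)) x)
      has_integral (T c (?g c) x - T a (?g a) x)) {a..c}"
    by (simp only: cong: has_integral_cong)
  have e: "T s (?g s) x = exp (2 * K * s) * T s (Gamma b m (?u s)) x" for s
    by (rule T_scale)
  show ?thesis using I unfolding e[of c] e[of a] .
qed

end

section \<open>Curvature dimension condition and gradient estimates\<close>

text \<open>The integral of 2 exp(2Ks) over [0,t]; \<open>exp_coef2\<close> is the integral of twice
  this function. The values at K = 0 are the limits, and both functions at -K give the coefficients
  of the lower variance bound.\<close>

definition exp_coef1 :: "real \<Rightarrow> real \<Rightarrow> real" where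
  "exp_coef1 K t = (if K = 0 then 2 * t else (exp (2 * K * t) - 1) / K)"

definition exp_coef2 :: "real \<Rightarrow> real \<Rightarrow> real" where
  "exp_coef2 K t = (if K = 0 then 2 * t\<^sup>2 else (exp (2 * K * t) - 1 - 2 * K * t) / K\<^sup>2)"

lemma exp_coef_zero: "exp_coef1 K 0 = 0" "exp_coef2 K 0 = 0"
  by (simp_all add: exp_coef1_def exp_coef2_def)

lemma exp_coef1_deriv: "(exp_coef1 K has_real_derivative 2 * exp (2 * K * t)) (at t within S)"
proof (cases "K = 0")
  case True
  then have "exp_coef1 K = (\<lambda>t. 2 * t)" by (auto simp: exp_coef1_def)
  then show ?thesis using True by (auto intro!: derivative_eq_intros)
next
  case False
  then have "exp_coef1 K = (\<lambda>t. (exp (2 * K * t) - 1) / K)" by (auto simp: exp_coef1_def)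
  then show ?thesis using False by (auto intro!: derivative_eq_intros)
qed

lemma exp_coef2_deriv: "(exp_coef2 K has_real_derivative 2 * exp_coef1 K t) (at t within S)"
proof (cases "K = 0")
  case True
  then have "exp_coef2 K = (\<lambda>t. 2 * t\<^sup>2)" by (auto simp: exp_coef2_def)
  then show ?thesis using True by (auto intro!: derivative_eq_intros simp: exp_coef1_def)
next
  case False
  then have "exp_coef2 K = (\<lambda>t. (exp (2 * K * t) - 1 - 2 * K * t) / K\<^sup>2)" by (auto simp: exp_coef2_def)
  then show ?thesis using False
    by (auto intro!: derivative_eq_intros simp: exp_coef1_def field_simps power2_eq_square)
qed

lemma exp_coef1_shift: "exp (- 2 * K * s) * (exp_coef1 K t - exp_coef1 K s) = exp_coef1 K (t - s)"
proof (cases "K = 0")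
  case False
  have "exp (- 2 * K * s) * (exp (2 * K * t) - exp (2 * K * s)) = exp (2 * K * (t - s)) - 1"
    by (simp add: right_diff_distrib exp_add[symmetric] algebra_simps)
  then show ?thesis using False by (simp add: exp_coef1_def diff_divide_distrib[symmetric])
qed (simp add: exp_coef1_def)

lemma exp_coef1_neg: "exp (- 2 * K * s) * exp_coef1 K s = exp_coef1 (- K) s"
proof (cases "K = 0")
  case False
  have "exp (- 2 * K * s) * (exp (2 * K * s) - 1) = 1 - exp (- 2 * K * s)"
    by (simp add: right_diff_distrib exp_add[symmetric])
  then show ?thesis using False by (simp add: exp_coef1_def field_simps)
qed (simp add: exp_coef1_def)

lemma exp_coef1_integral:
  assumes "a \<le> c" shows "((\<lambda>s. 2 * exp (2 * K * s)) has_integral (exp_coef1 K c - exp_coef1 K a)) {a..c}"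
  by (rule fundamental_theorem_of_calculus[OF assms])
     (simp add: has_real_derivative_iff_has_vector_derivative[symmetric] exp_coef1_deriv)

lemma deriv_nonneg_at_zero:
  fixes h :: "real \<Rightarrow> real"
  assumes "(h has_real_derivative D) (at 0 within {0..})" "h 0 = 0" "\<And>t. 0 \<le> t \<Longrightarrow> 0 \<le> h t"
  shows "0 \<le> D"
proof (rule ccontr)
  assume "\<not> 0 \<le> D"
  then obtain d where d: "0 < d" "\<And>r. 0 < r \<Longrightarrow> 0 + r \<in> {0..} \<Longrightarrow> r < d \<Longrightarrow> h (0 + r) < h 0"
    using has_real_derivative_neg_dec_right[OF assms(1)] by (auto simp: not_le)
  show False using d(2)[of "d / 2"] d(1) assms(2) assms(3)[of "d / 2"] by simp
qed

text \<open>If D were negative, \<open>k\<close> would be negative just to the right of 0, and the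
  mean value theorem would push \<open>h\<close> below 0.\<close>

lemma second_deriv_nonneg_at_zero:
  fixes h k :: "real \<Rightarrow> real"
  assumes h: "\<And>t. 0 \<le> t \<Longrightarrow> (h has_real_derivative k t) (at t within {0..})"
    and k: "(k has_real_derivative D) (at 0 within {0..})" "k 0 = 0"
    and "h 0 = 0" "\<And>t. 0 \<le> t \<Longrightarrow> 0 \<le> h t"
  shows "0 \<le> D"
proof (rule ccontr)
  assume "\<not> 0 \<le> D"
  then obtain d where d: "0 < d" "\<And>r. 0 < r \<Longrightarrow> 0 + r \<in> {0..} \<Longrightarrow> r < d \<Longrightarrow> k (0 + r) < k 0"
    using has_real_derivative_neg_dec_right[OF k(1)] by (auto simp: not_le)
  have "continuous_on {0..d / 2} h"
    unfolding continuous_on_eq_continuous_within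
  proof
    fix t assume "t \<in> {0..d / 2}"
    then show "continuous (at t within {0..d / 2}) h"
      by (intro DERIV_continuous[OF DERIV_subset[OF h]]) auto
  qed
  moreover have "(h has_real_derivative k t) (at t)" if "0 < t" for t
  proof -
    have "(h has_real_derivative k t) (at t within {0<..})" using that by (intro DERIV_subset[OF h]) auto
    then show ?thesis using that by (simp add: at_within_open[of t "{0<..}"])
  qed
  ultimately obtain z where z: "0 < z" "z < d / 2" "h (d / 2) - h 0 = (d / 2 - 0) * k z"
    using MVT2[of 0 "d / 2" h k] d(1) MVT[of 0 "d / 2" h]
    by (metis DERIV_unique half_gt_zero real_differentiable_def)
  have "k z < 0" using d(2)[of z] z d(1) k(2) by simp
  then have "(d / 2 - 0) * k z < 0" using d(1) by (simp add: mult_pos_neg)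
  then show False using z assms(4) assms(5)[of "d / 2"] d(1) by simp
qed

context elliptic_graph
begin

lemma laplacian_cong:
  "(\<And>y. y \<in> nbh x \<Longrightarrow> f y - f x = g y - g x) \<Longrightarrow> L f x = L g x"
  by (simp add: laplacian_def)

lemma Gam_one_cong:
  assumes "\<And>y. y \<in> nbh x \<Longrightarrow> f y - f x = f' y - f' x" "\<And>y. y \<in> nbh x \<Longrightarrow> g y - g x = g' y - g' x"
  shows "Gam b m 1 f g x = Gam b m 1 f' g' x"
  unfolding Gam_one using assms by (intro arg_cong2[where f="(/)"] sum.cong) auto

text \<open>The inequality is local and invariant under adding constants, so nonnegative finitely
  supported test functions suffice.\<close>

lemma CD_iff_Cc_plus:
  "CD b m (- K) n \<longleftrightarrow> (\<forall>f\<in>Cc_plus. \<forall>x. inv_dim n * (L f x)\<^sup>2 - K * Gamma b m f x \<le> Gam b m 2 f f x)"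
proof
  assume R: "\<forall>f\<in>Cc_plus. \<forall>x. inv_dim n * (L f x)\<^sup>2 - K * Gamma b m f x \<le> Gam b m 2 f f x"
  show "CD b m (- K) n"
    unfolding CD_def
  proof (intro allI)
    fix f :: "'a \<Rightarrow> real" and x
    \<comment> \<open>The ball of radius two: Gamma_2 at x reads \<open>L f\<close> and Gamma(f) at
      the neighbours of x, hence \<open>f\<close> at their neighbours.\<close>
    define S where "S = insert x (nbh x) \<union> (\<Union>z\<in>nbh x. nbh z)"
    have S: "finite S" unfolding S_def using b_finite by auto
    \<comment> \<open>Adding the sum of all moduli over \<open>S\<close> makes the shifted function
      nonnegative there.\<close>
    define c where "c = (\<Sum>z\<in>S. \<bar>f z\<bar>)"
    define f' where "f' y = (if y \<in> S then f y + c else 0)" for y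
    have c: "0 \<le> f y + c" if "y \<in> S" for y
    proof -
      have "\<bar>f y\<bar> \<le> c" unfolding c_def using S that by (intro member_le_sum) auto
      then show ?thesis by linarith
    qed
    have "{y. f' y \<noteq> 0} \<subseteq> S" by (auto simp: f'_def)
    then have f': "f' \<in> Cc_plus" using S c by (auto simp: Cc_plus_def Cc_def f'_def intro: finite_subset)
    have d: "f' y - f' z = f y - f z" if "z \<in> insert x (nbh x)" "y \<in> nbh z" for y z
      using that by (auto simp: f'_def S_def)
    have Lz: "L f' z = L f z" if "z \<in> insert x (nbh x)" for z by (rule laplacian_cong) (rule d[OF that])
    have Gz: "Gamma b m f' z = Gamma b m f z" if "z \<in> insert x (nbh x)" for z
      by (rule Gam_one_cong) (rule d[OF that], assumption)+
    have "L (Gamma b m f') x = L (Gamma b m f) x"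
      by (rule laplacian_cong) (use Gz in \<open>simp del: Gam.simps\<close>)
    moreover have "Gam b m 1 f' (L f') x = Gam b m 1 f (L f) x"
      by (rule Gam_one_cong) (use d Lz in auto)
    ultimately have "Gam b m 2 f' f' x = Gam b m 2 f f x"
      using Gam_two[of f' x] Gam_two[of f x] by linarith
    then show "inv_dim n * (L f x)\<^sup>2 + - K * Gamma b m f x \<le> Gam b m 2 f f x"
      using R[rule_format, OF f', of x] Lz[of x] Gz[of x] by (simp del: Gam.simps)
  qed
qed (auto simp: CD_def)

text \<open>Jensen's inequality along the flow, read off from the nonnegative integrand of the
  variance identity.\<close>

lemma square_flow_ge:
  assumes "f \<in> Cc" "0 \<le> c" "c \<le> t"
  shows "(T t f x)\<^sup>2 \<le> T c (\<lambda>y. (T (t - c) f y)\<^sup>2) x"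
proof -
  have "0 \<le> T c (\<lambda>y. (T (t - c) f y)\<^sup>2) x - (T t f x)\<^sup>2"
  proof (rule has_integral_nonneg[OF variance_integral[OF assms]])
    fix s assume "s \<in> {0..c}"
    then show "0 \<le> 2 * T s (Gamma b m (T (t - s) f)) x"
      unfolding T_def[of s] by (intro mult_nonneg_nonneg infsum_nonneg q_nonneg Gamma_nonneg) auto
  qed
  then show ?thesis by simp
qed

text \<open>By \<open>variance_integral\<close> this is a constant plus an indefinite integral.
  Continuity guarantees that the time integral in the gradient estimate is a genuine one, since
  \<open>integral\<close> is 0 for a non-integrable function.\<close>

lemma square_flow_cont:
  assumes f: "f \<in> Cc"
  shows "continuous_on {0..t} (\<lambda>c. T c (\<lambda>y. (T (t - c) f y)\<^sup>2) x)"
proof (cases "0 \<le> t")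
  case True
  let ?G = "\<lambda>s. 2 * T s (Gamma b m (T (t - s) f)) x"
  have "?G integrable_on {0..t}" using variance_integral[OF f True order_refl] by blast
  from indefinite_integral_continuous_1[OF this]
  have "continuous_on {0..t} (\<lambda>c. (T t f x)\<^sup>2 + integral {0..c} ?G)" by (intro continuous_intros)
  then show ?thesis
    by (rule continuous_on_eq) (use integral_unique[OF variance_integral[OF f]] in auto)
qed simp

text \<open>\<open>T s\<close> is positive, so the pointwise curvature inequality passes under it
  and is integrated. The interval is free: [0,t] serves the gradient estimates, [s,t] the upper and
  [0,s] the lower variance bound.\<close>

lemma CD_flow:
  assumes cd: "CD b m (- K) n" and n: "0 \<le> inv_dim n" and f: "f \<in> Cc" and ac: "0 \<le> a" "a \<le> c" "c \<le> t"
  shows "2 * inv_dim n * integral {a..c} (\<lambda>s. exp (2 * K * s) * T s (\<lambda>y. (T (t - s) (L f) y)\<^sup>2) x)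
    \<le> exp (2 * K * c) * T c (Gamma b m (T (t - c) f)) x - exp (2 * K * a) * T a (Gamma b m (T (t - a) f)) x"
proof -
  let ?J = "\<lambda>s. exp (2 * K * s) * T s (\<lambda>y. (T (t - s) (L f) y)\<^sup>2) x"
  have Lf: "L f \<in> Cc" by (rule laplacian_Cc[OF f])
  have "continuous_on {a..c} ?J"
    by (intro continuous_intros continuous_on_subset[OF square_flow_cont[OF Lf]]) (use ac in auto)
  then have "(?J has_integral integral {a..c} ?J) {a..c}" by (intro integrable_integral integrable_continuous_interval)
  then have "((\<lambda>s. 2 * inv_dim n * ?J s) has_integral 2 * inv_dim n * integral {a..c} ?J) {a..c}"
    by (rule has_integral_mult_right)
  then show ?thesis
  proof (rule has_integral_le[OF _ Gamma_flow_integral[OF f ac]])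
    fix s assume s: "s \<in> {a..c}"
    then have s0: "0 \<le> s" and ts: "0 \<le> t - s" using ac by auto
    let ?u = "T (t - s) f" and ?v = "T (t - s) (L f)"
    let ?l = "\<lambda>y. 2 * inv_dim n * exp (2 * K * s) * (?v y)\<^sup>2"
    let ?r = "\<lambda>y. exp (2 * K * s) * (2 * Gam b m 2 ?u ?u y + 2 * K * Gamma b m ?u y)"
    have Lu: "L ?u = ?v" by (rule T_laplacian_Cc[OF f ts])
    have gb: "l1_bound (Gamma b m ?u) (energy ?u ?u)" "l1_bound (Gamma b m ?v) (energy ?v ?v)"
      by (intro Gamma_l1_bound T_Cc_energy f Lf ts)+
    have guv: "l1_bound (Gam b m 1 ?u ?v) (energy ?u ?u + energy ?v ?v)"
    proof (rule l1_bound_mono[OF gb, where \<alpha>=1 and \<beta>=1])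
      show "\<bar>Gam b m 1 ?u ?v y\<bar> \<le> 1 * \<bar>Gamma b m ?u y\<bar> + 1 * \<bar>Gamma b m ?v y\<bar>" for y
        using Gam_abs_le[of ?u ?v y] Gamma_nonneg[of ?u y] Gamma_nonneg[of ?v y] by (simp del: Gam.simps)
    qed auto
    \<comment> \<open>Summability of Gamma_2(u) against the kernel is reached through its two parts,
      L Gamma(u) by \<open>T_laplacian_l1\<close> and Gamma(u, L u) by domination.\<close>
    have S2: "(\<lambda>y. q s x y * (L (Gamma b m ?u) y - 2 * Gam b m 1 ?u ?v y)) summable_on UNIV"
      using summable_on_add[OF T_laplacian_l1(1)[OF s0 gb(1)] summable_on_cmult_right[OF q_summable_l1[OF s0 guv], of "-2"]]
      by (simp add: algebra_simps del: Gam.simps)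
    have sr: "(\<lambda>y. q s x y * ?r y) summable_on UNIV"
      using summable_on_cmult_right[OF summable_on_add[OF S2 summable_on_cmult_right[OF q_summable_l1[OF s0 gb(1)], of "2 * K"]], of "exp (2 * K * s)"]
      unfolding Gam_two[of ?u] Lu by (simp add: algebra_simps del: Gam.simps)
    have sl: "(\<lambda>y. q s x y * ?l y) summable_on UNIV"
      using summable_on_cmult_right[OF q_summable_l1[OF s0 square_l1_bound[OF T_contraction(1)[OF ts Cc_l2[OF Lf]] order_refl]], of "2 * inv_dim n * exp (2 * K * s)"]
      by (simp add: algebra_simps)
    have "?l y \<le> ?r y" for y
    proof -
      have "2 * (inv_dim n * (?v y)\<^sup>2) \<le> 2 * Gam b m 2 ?u ?u y + 2 * K * Gamma b m ?u y"
        using cd[unfolded CD_def, rule_format, of ?u y] unfolding Lu by linarith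
      from mult_left_mono[OF this, of "exp (2 * K * s)"] show ?thesis by (simp add: mult_ac del: Gam.simps)
    qed
    then have "T s ?l x \<le> T s ?r x"
      unfolding T_def[of s] by (intro infsum_mono sl sr mult_left_mono q_nonneg s0)
    then show "2 * inv_dim n * ?J s \<le> T s ?r x"
      unfolding T_scale by (simp add: mult.assoc del: Gam.simps)
  qed
qed

text \<open>Jensen's bound holds at every s and is integrated against 2 exp(2Ks). This shows that
  the estimate with the time integral is the stronger one.\<close>

lemma square_flow_integral_ge:
  assumes f: "f \<in> Cc" and ac: "0 \<le> a" "a \<le> c" "c \<le> t"
  shows "(exp_coef1 K c - exp_coef1 K a) * (T t f x)\<^sup>2
    \<le> 2 * integral {a..c} (\<lambda>s. exp (2 * K * s) * T s (\<lambda>y. (T (t - s) f y)\<^sup>2) x)"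
proof -
  let ?J = "\<lambda>s. exp (2 * K * s) * T s (\<lambda>y. (T (t - s) f y)\<^sup>2) x"
  have "continuous_on {a..c} ?J"
    by (intro continuous_intros continuous_on_subset[OF square_flow_cont[OF f]]) (use ac in auto)
  then have J: "((\<lambda>s. 2 * ?J s) has_integral 2 * integral {a..c} ?J) {a..c}"
    by (intro has_integral_mult_right integrable_integral integrable_continuous_interval)
  show ?thesis
  proof (rule has_integral_le[OF has_integral_mult_left[OF exp_coef1_integral[OF ac(2)]] J])
    fix s assume "s \<in> {a..c}"
    then show "2 * exp (2 * K * s) * (T t f x)\<^sup>2 \<le> 2 * ?J s"
      using square_flow_ge[OF f, of s t x] ac by simp
  qed
qed

lemma CD_flow':
  assumes cd: "CD b m (- K) n" and n: "0 \<le> inv_dim n" and f: "f \<in> Cc" and ac: "0 \<le> a" "a \<le> c" "c \<le> t"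
  shows "inv_dim n * (T t (L f) x)\<^sup>2 * (exp_coef1 K c - exp_coef1 K a)
    \<le> exp (2 * K * c) * T c (Gamma b m (T (t - c) f)) x - exp (2 * K * a) * T a (Gamma b m (T (t - a) f)) x"
  using CD_flow[OF assms, of x]
    mult_left_mono[OF square_flow_integral_ge[OF laplacian_Cc[OF f] ac, of K x] n]
  by (simp add: mult_ac del: Gam.simps)

lemma T_fun_zero: "T 0 f = f"
  by (auto simp: T_zero)

text \<open>In the variance identity T_s Gamma(u_s) is estimated from above by T_t Gamma(f), using
  the flow inequality on [s,t] divided by exp(2Ks).\<close>

lemma CD_imp_variance_upper:
  assumes cd: "CD b m (- K) n" and n: "0 \<le> inv_dim n" and f: "f \<in> Cc" and t: "0 \<le> t"
  shows "T t (\<lambda>y. (f y)\<^sup>2) x - (T t f x)\<^sup>2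
    \<le> exp_coef1 K t * T t (Gamma b m f) x - exp_coef2 K t * inv_dim n * (T t (L f) x)\<^sup>2"
proof -
  let ?A = "inv_dim n * (T t (L f) x)\<^sup>2" and ?G = "T t (Gamma b m f) x"
  \<comment> \<open>A primitive of the resulting upper bound for the integrand; it vanishes at s =
    t.\<close>
  let ?F = "\<lambda>s. ?A * exp_coef2 K (t - s) - exp_coef1 K (t - s) * ?G"
  have "((\<lambda>s. 2 * exp (2 * K * (t - s)) * ?G - 2 * ?A * exp_coef1 K (t - s)) has_integral (?F t - ?F 0)) {0..t}"
  proof (rule fundamental_theorem_of_calculus[OF t])
    fix s
    have 1: "((\<lambda>s. exp_coef1 K (t - s)) has_real_derivative 2 * exp (2 * K * (t - s)) * (0 - 1)) (at s within {0..t})"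
      by (rule DERIV_chain2[OF exp_coef1_deriv]) (intro derivative_intros)
    have 2: "((\<lambda>s. exp_coef2 K (t - s)) has_real_derivative 2 * exp_coef1 K (t - s) * (0 - 1)) (at s within {0..t})"
      by (rule DERIV_chain2[OF exp_coef2_deriv]) (intro derivative_intros)
    have "(?F has_real_derivative ?A * (2 * exp_coef1 K (t - s) * (0 - 1)) - 2 * exp (2 * K * (t - s)) * (0 - 1) * ?G) (at s within {0..t})"
      by (intro DERIV_diff DERIV_cmult DERIV_cmult_right 1 2)
    then show "(?F has_vector_derivative 2 * exp (2 * K * (t - s)) * ?G - 2 * ?A * exp_coef1 K (t - s)) (at s within {0..t})"
      by (simp add: has_real_derivative_iff_has_vector_derivative[symmetric] algebra_simps del: Gam.simps)
  qed
  then have "T t (\<lambda>y. (T (t - t) f y)\<^sup>2) x - (T t f x)\<^sup>2 \<le> ?F t - ?F 0"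
  proof (rule has_integral_le[OF variance_integral[OF f t order_refl]])
    fix s assume s: "s \<in> {0..t}"
    let ?H = "T s (Gamma b m (T (t - s) f)) x"
    have "?A * (exp_coef1 K t - exp_coef1 K s) \<le> exp (2 * K * t) * ?G - exp (2 * K * s) * ?H"
      using CD_flow'[OF cd n f, of s t t x] s by (simp add: T_fun_zero del: Gam.simps)
    from mult_left_mono[OF this, of "exp (- 2 * K * s)"]
    have "?A * (exp (- 2 * K * s) * (exp_coef1 K t - exp_coef1 K s))
        \<le> (exp (- 2 * K * s) * exp (2 * K * t)) * ?G - (exp (- 2 * K * s) * exp (2 * K * s)) * ?H"
      by (simp only: right_diff_distrib mult.assoc mult.left_commute exp_ge_zero)
    moreover have "exp (- 2 * K * s) * exp (2 * K * t) = exp (2 * K * (t - s))" "exp (- 2 * K * s) * exp (2 * K * s) = 1"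
      by (simp_all add: exp_add[symmetric] algebra_simps)
    ultimately have "?A * exp_coef1 K (t - s) \<le> exp (2 * K * (t - s)) * ?G - ?H"
      unfolding exp_coef1_shift by simp
    then show "2 * ?H \<le> 2 * exp (2 * K * (t - s)) * ?G - 2 * ?A * exp_coef1 K (t - s)"
      by linarith
  qed
  then show ?thesis by (simp add: T_fun_zero exp_coef_zero algebra_simps del: Gam.simps)
qed

text \<open>Dual to the upper bound: the flow inequality on [0,s] compares T_s Gamma(u_s) from below
  with Gamma(T_t f), which turns K into -K in the coefficients.\<close>

lemma CD_imp_variance_lower:
  assumes cd: "CD b m (- K) n" and n: "0 \<le> inv_dim n" and f: "f \<in> Cc" and t: "0 \<le> t"
  shows "exp_coef1 (- K) t * Gamma b m (T t f) x + exp_coef2 (- K) t * inv_dim n * (T t (L f) x)\<^sup>2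
    \<le> T t (\<lambda>y. (f y)\<^sup>2) x - (T t f x)\<^sup>2"
proof -
  let ?A = "inv_dim n * (T t (L f) x)\<^sup>2" and ?G = "Gamma b m (T t f) x"
  let ?F = "\<lambda>s. exp_coef1 (- K) s * ?G + ?A * exp_coef2 (- K) s"
  have "((\<lambda>s. 2 * exp (2 * - K * s) * ?G + ?A * (2 * exp_coef1 (- K) s)) has_integral (?F t - ?F 0)) {0..t}"
    by (rule fundamental_theorem_of_calculus[OF t], unfold has_real_derivative_iff_has_vector_derivative[symmetric])
       (intro DERIV_add DERIV_cmult DERIV_cmult_right exp_coef1_deriv exp_coef2_deriv)
  then have "?F t - ?F 0 \<le> T t (\<lambda>y. (T (t - t) f y)\<^sup>2) x - (T t f x)\<^sup>2"
  proof (rule has_integral_le[OF _ variance_integral[OF f t order_refl]])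
    fix s assume s: "s \<in> {0..t}"
    let ?H = "T s (Gamma b m (T (t - s) f)) x"
    have "?A * exp_coef1 K s \<le> exp (2 * K * s) * ?H - ?G"
      using CD_flow'[OF cd n f, of 0 s t x] s by (simp add: T_fun_zero exp_coef_zero del: Gam.simps)
    from mult_left_mono[OF this, of "exp (- 2 * K * s)"]
    have "?A * (exp (- 2 * K * s) * exp_coef1 K s)
        \<le> (exp (- 2 * K * s) * exp (2 * K * s)) * ?H - exp (- 2 * K * s) * ?G"
      by (simp only: right_diff_distrib mult.assoc mult.left_commute exp_ge_zero)
    moreover have "exp (- 2 * K * s) * exp (2 * K * s) = 1" by (simp add: exp_add[symmetric])
    ultimately have "?A * exp_coef1 (- K) s \<le> ?H - exp (- 2 * K * s) * ?G"
      unfolding exp_coef1_neg by simp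
    then show "2 * exp (2 * - K * s) * ?G + ?A * (2 * exp_coef1 (- K) s) \<le> 2 * ?H"
      by simp
  qed
  then show ?thesis by (simp add: T_fun_zero exp_coef_zero algebra_simps del: Gam.simps)
qed

section \<open>From the estimates back to the curvature dimension condition\<close>

lemma Cc_mult: "f \<in> Cc \<Longrightarrow> (\<lambda>x. f x * g x) \<in> Cc"
  unfolding Cc_def mem_Collect_eq by (rule finite_subset[of _ "{x. f x \<noteq> 0}"]) auto

lemma Gamma_Cc:
  assumes "f \<in> Cc" shows "Gamma b m f \<in> Cc"
proof -
  have "{x. Gamma b m f x \<noteq> 0} \<subseteq> {x. L (\<lambda>x. f x * f x) x \<noteq> 0} \<union> {x. f x \<noteq> 0}" by auto
  moreover have "finite ({x. L (\<lambda>x. f x * f x) x \<noteq> 0} \<union> {x. f x \<noteq> 0})"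
    using assms laplacian_Cc[OF Cc_mult[OF assms, of f]] by (auto simp: Cc_def)
  ultimately show ?thesis unfolding Cc_def mem_Collect_eq by (rule finite_subset)
qed

lemma Gamma_T_deriv:
  assumes f: "f \<in> Cc" and g: "g \<in> Cc" and t: "0 \<le> t"
  shows "((\<lambda>t. Gam b m 1 (T t f) (T t g) x) has_real_derivative
    Gam b m 1 (T t (L f)) (T t g) x + Gam b m 1 (T t f) (T t (L g)) x) (at t within {0..})"
proof -
  have "((\<lambda>t. \<Sum>y\<in>nbh x. b x y * ((T t f y - T t f x) * (T t g y - T t g x))) has_real_derivative
      (\<Sum>y\<in>nbh x. b x y * ((T t (L f) y - T t (L f) x) * (T t g y - T t g x)) + b x y * ((T t f y - T t f x) * (T t (L g) y - T t (L g) x)))) (at t within {0..})"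
  proof (rule DERIV_sum)
    fix y
    have "((\<lambda>t. T t f y - T t f x) has_real_derivative T t (L f) y - T t (L f) x) (at t within {0..})"
      "((\<lambda>t. T t g y - T t g x) has_real_derivative T t (L g) y - T t (L g) x) (at t within {0..})"
      by (intro DERIV_diff T_deriv_Cc' f g t)+
    from DERIV_cmult[OF DERIV_mult[OF this], of "b x y"]
    show "((\<lambda>t. b x y * ((T t f y - T t f x) * (T t g y - T t g x))) has_real_derivative
      b x y * ((T t (L f) y - T t (L f) x) * (T t g y - T t g x)) + b x y * ((T t f y - T t f x) * (T t (L g) y - T t (L g) x))) (at t within {0..})"
      by (simp add: algebra_simps)
  qed
  from DERIV_cdivide[OF this, of "2 * m x"] show ?thesis
    unfolding Gam_one sum.distrib add_divide_distrib .
qed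

text \<open>The left-hand side is the second time derivative at 0 of T_t(f^2) - (T_t f)^2; the
  product rule for the Laplacian is applied twice.\<close>

lemma laplacian_laplacian_square:
  "L (L (\<lambda>y. (f y)\<^sup>2)) x - 2 * (L f x)\<^sup>2 - 2 * f x * L (L f) x = 2 * L (Gamma b m f) x + 4 * Gam b m 1 f (L f) x"
proof -
  have p: "L (\<lambda>y. u y * v y) x = 2 * Gam b m 1 u v x + u x * L v x + v x * L u x" for u v x
    by (simp add: field_simps)
  have "L (\<lambda>y. (f y)\<^sup>2) = (\<lambda>y. 2 * Gamma b m f y + 2 * (f y * L f y))"
    using p[of f f] by (auto simp: power2_eq_square simp del: Gam.simps)
  then have "L (L (\<lambda>y. (f y)\<^sup>2)) x = 2 * L (Gamma b m f) x + 2 * L (\<lambda>y. f y * L f y) x"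
    by (simp add: laplacian_add laplacian_scale del: Gam.simps)
  then show ?thesis using p[of f "L f" x] by (simp add: power2_eq_square algebra_simps del: Gam.simps)
qed

text \<open>Both sides coincide at t = 0, so their difference has a nonnegative right derivative
  there, namely twice Gamma_2(f) + K Gamma(f) - \<open>\<nu>\<close> (L f)^2.\<close>

lemma gradient_estimate_imp_Gam_two:
  assumes f: "f \<in> Cc"
    and est: "\<And>t. 0 \<le> t \<Longrightarrow> Gamma b m (T t f) x
      \<le> exp (2 * K * t) * T t (Gamma b m f) x - exp_coef1 K t * \<nu> * (T t (L f) x)\<^sup>2"
  shows "\<nu> * (L f x)\<^sup>2 - K * Gamma b m f x \<le> Gam b m 2 f f x"
proof -
  note Lf = laplacian_Cc[OF f]
  let ?h = "\<lambda>t. exp (2 * K * t) * T t (Gamma b m f) x - exp_coef1 K t * \<nu> * (T t (L f) x)\<^sup>2 - Gamma b m (T t f) x"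
  have e: "((\<lambda>t. exp (2 * K * t)) has_real_derivative exp (2 * K * 0) * (2 * K)) (at 0 within {0..})"
    by (auto intro!: derivative_eq_intros)
  note d1 = DERIV_mult[OF e T_deriv_Cc'[OF Gamma_Cc[OF f] order_refl, of x]]
  note d2 = DERIV_mult[OF DERIV_cmult_right[OF exp_coef1_deriv] DERIV_power[OF T_deriv_Cc'[OF Lf order_refl, of x], of 2]]
  from DERIV_diff[OF DERIV_diff[OF d1 d2] Gamma_T_deriv[OF f f order_refl]]
  have "0 \<le> exp (2 * K * 0) * (2 * K) * T 0 (Gamma b m f) x + T 0 (L (Gamma b m f)) x * exp (2 * K * 0)
     - (2 * exp (2 * K * 0) * \<nu> * (T 0 (L f) x)\<^sup>2 + real 2 * (T 0 (L (L f)) x * T 0 (L f) x ^ (2 - Suc 0)) * (exp_coef1 K 0 * \<nu>))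
     - (Gam b m 1 (T 0 (L f)) (T 0 f) x + Gam b m 1 (T 0 f) (T 0 (L f)) x)"
    by (rule deriv_nonneg_at_zero) (use est in \<open>auto simp: T_fun_zero exp_coef_zero simp del: Gam.simps\<close>)
  then show ?thesis
    using Gam_two[of f x] Gam_commute[of "L f" f x] by (simp add: T_fun_zero exp_coef_zero del: Gam.simps)
qed

text \<open>Both sides of the variance estimates agree to first order at \<open>t = 0\<close>, so their second
  derivatives are compared.\<close>

lemma variance_upper_imp_Gam_two:
  assumes f: "f \<in> Cc"
    and est: "\<And>t. 0 \<le> t \<Longrightarrow> T t (\<lambda>y. (f y)\<^sup>2) x - (T t f x)\<^sup>2
      \<le> exp_coef1 K t * T t (Gamma b m f) x - exp_coef2 K t * \<nu> * (T t (L f) x)\<^sup>2"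
  shows "\<nu> * (L f x)\<^sup>2 - K * Gamma b m f x \<le> Gam b m 2 f f x"
proof -
  note Lf = laplacian_Cc[OF f] note LLf = laplacian_Cc[OF Lf] note G = Gamma_Cc[OF f] note LG = laplacian_Cc[OF G]
  have sq: "(\<lambda>y. (f y)\<^sup>2) \<in> Cc" unfolding power2_eq_square by (rule Cc_mult[OF f])
  note Lsq = laplacian_Cc[OF sq]
  let ?h = "\<lambda>t. exp_coef1 K t * T t (Gamma b m f) x - exp_coef2 K t * \<nu> * (T t (L f) x)\<^sup>2 - T t (\<lambda>y. (f y)\<^sup>2) x + (T t f x)\<^sup>2"
  let ?k = "\<lambda>t. 2 * exp (2 * K * t) * T t (Gamma b m f) x + exp_coef1 K t * T t (L (Gamma b m f)) x
    - (2 * exp_coef1 K t * \<nu> * (T t (L f) x)\<^sup>2 + exp_coef2 K t * \<nu> * (2 * T t (L f) x * T t (L (L f)) x))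
    - T t (L (\<lambda>y. (f y)\<^sup>2)) x + 2 * T t f x * T t (L f) x"
  \<comment> \<open>By \<open>laplacian_laplacian_square\<close> and \<open>Gam_two\<close> this is
    four times Gamma_2(f) + K Gamma(f) - \<open>\<nu>\<close> (L f)^2.\<close>
  let ?D = "4 * K * Gamma b m f x + 4 * L (Gamma b m f) x - 4 * \<nu> * (L f x)\<^sup>2
    - L (L (\<lambda>y. (f y)\<^sup>2)) x + 2 * (L f x)\<^sup>2 + 2 * f x * L (L f) x"
  have "0 \<le> ?D"
  proof (rule second_deriv_nonneg_at_zero[of ?h ?k])
    show "(?h has_real_derivative ?k t) (at t within {0..})" if "0 \<le> t" for t
      by (rule derivative_eq_intros exp_coef1_deriv exp_coef2_deriv T_deriv_Cc'[OF f that] T_deriv_Cc'[OF Lf that]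
            T_deriv_Cc'[OF G that] T_deriv_Cc'[OF sq that] refl)+
         (simp add: algebra_simps power2_eq_square del: Gam.simps)
    show "(?k has_real_derivative ?D) (at 0 within {0..})"
      by (rule derivative_eq_intros exp_coef1_deriv exp_coef2_deriv T_deriv_Cc'[OF f order_refl] T_deriv_Cc'[OF Lf order_refl]
            T_deriv_Cc'[OF LLf order_refl] T_deriv_Cc'[OF G order_refl] T_deriv_Cc'[OF LG order_refl] T_deriv_Cc'[OF Lsq order_refl] refl)+
         (simp add: T_fun_zero exp_coef_zero algebra_simps power2_eq_square del: Gam.simps)
    \<comment> \<open>First order agreement is the definition of Gamma: L(f^2) = 2 Gamma(f) + 2 f L
      f.\<close>
    show "?k 0 = 0"
    proof -
      have "L (\<lambda>y. f y * f y) x = 2 * Gamma b m f x + 2 * (f x * L f x)" by (simp add: field_simps)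
      then show ?thesis by (simp add: T_fun_zero exp_coef_zero power2_eq_square del: Gam.simps)
    qed
    show "0 \<le> ?h t" if "0 \<le> t" for t using est[OF that] by linarith
  qed (simp add: T_fun_zero exp_coef_zero del: Gam.simps)
  then show ?thesis using laplacian_laplacian_square[of f x] Gam_two[of f x] by linarith
qed

lemma variance_lower_imp_Gam_two:
  assumes f: "f \<in> Cc"
    and est: "\<And>t. 0 \<le> t \<Longrightarrow> exp_coef1 (- K) t * Gamma b m (T t f) x + exp_coef2 (- K) t * \<nu> * (T t (L f) x)\<^sup>2
      \<le> T t (\<lambda>y. (f y)\<^sup>2) x - (T t f x)\<^sup>2"
  shows "\<nu> * (L f x)\<^sup>2 - K * Gamma b m f x \<le> Gam b m 2 f f x"
proof -
  note Lf = laplacian_Cc[OF f] note LLf = laplacian_Cc[OF Lf]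
  have sq: "(\<lambda>y. (f y)\<^sup>2) \<in> Cc" unfolding power2_eq_square by (rule Cc_mult[OF f])
  note Lsq = laplacian_Cc[OF sq]
  have G: "((\<lambda>t. Gamma b m (T t f) x) has_real_derivative 2 * Gam b m 1 (T t f) (T t (L f)) x) (at t within {0..})" if "0 \<le> t" for t
    using Gamma_T_deriv[OF f f that, of x] Gam_commute[of "T t (L f)" "T t f" x] by (simp del: Gam.simps)
  let ?h = "\<lambda>t. T t (\<lambda>y. (f y)\<^sup>2) x - (T t f x)\<^sup>2 - exp_coef1 (- K) t * Gamma b m (T t f) x - exp_coef2 (- K) t * \<nu> * (T t (L f) x)\<^sup>2"
  let ?k = "\<lambda>t. T t (L (\<lambda>y. (f y)\<^sup>2)) x - 2 * T t f x * T t (L f) x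
    - (2 * exp (2 * - K * t) * Gamma b m (T t f) x + exp_coef1 (- K) t * (2 * Gam b m 1 (T t f) (T t (L f)) x))
    - (2 * exp_coef1 (- K) t * \<nu> * (T t (L f) x)\<^sup>2 + exp_coef2 (- K) t * \<nu> * (2 * T t (L f) x * T t (L (L f)) x))"
  \<comment> \<open>Again four times the curvature defect. The term with factor 8 stems from
    differentiating Gamma(T_t f), and it flips the sign of the mixed term 4 Gamma(f, L f).\<close>
  let ?D = "L (L (\<lambda>y. (f y)\<^sup>2)) x - 2 * (L f x)\<^sup>2 - 2 * f x * L (L f) x
    + 4 * K * Gamma b m f x - 8 * Gam b m 1 f (L f) x - 4 * \<nu> * (L f x)\<^sup>2"
  have "0 \<le> ?D"
  proof (rule second_deriv_nonneg_at_zero[of ?h ?k])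
    show "(?h has_real_derivative ?k t) (at t within {0..})" if "0 \<le> t" for t
      by (rule derivative_eq_intros exp_coef1_deriv exp_coef2_deriv T_deriv_Cc'[OF f that] T_deriv_Cc'[OF Lf that]
            G[OF that] T_deriv_Cc'[OF sq that] refl)+
         (simp add: algebra_simps power2_eq_square del: Gam.simps)
    show "(?k has_real_derivative ?D) (at 0 within {0..})"
      by (rule derivative_eq_intros exp_coef1_deriv exp_coef2_deriv T_deriv_Cc'[OF f order_refl] T_deriv_Cc'[OF Lf order_refl]
            T_deriv_Cc'[OF LLf order_refl] G[OF order_refl] Gamma_T_deriv[OF f Lf order_refl] T_deriv_Cc'[OF Lsq order_refl] refl)+
         (simp add: T_fun_zero exp_coef_zero algebra_simps power2_eq_square del: Gam.simps)
    show "?k 0 = 0"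
    proof -
      have "L (\<lambda>y. f y * f y) x = 2 * Gamma b m f x + 2 * (f x * L f x)" by (simp add: field_simps)
      then show ?thesis by (simp add: T_fun_zero exp_coef_zero power2_eq_square del: Gam.simps)
    qed
    show "0 \<le> ?h t" if "0 \<le> t" for t using est[OF that] by linarith
  qed (simp add: T_fun_zero exp_coef_zero del: Gam.simps)
  then show ?thesis using laplacian_laplacian_square[of f x] Gam_two[of f x] by linarith
qed

end

lemma exp_coef_minus:
  "exp_coef1 (- K) t = (if K = 0 then 2 * t else (1 - exp (- 2 * K * t)) / K)"
  "exp_coef2 (- K) t = (if K = 0 then 2 * t\<^sup>2 else (exp (- 2 * K * t) - 1 + 2 * K * t) / K\<^sup>2)"
  by (simp_all add: exp_coef1_def exp_coef2_def field_simps)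

theorem theorem1p1:
  fixes b :: "'a::countable \<Rightarrow> 'a \<Rightarrow> real" and m :: "'a \<Rightarrow> real"
    and n :: ereal and K :: real
  assumes "\<forall>x. 0 < m x"
    and "locally_finite_graph b"
    and "ellipticity b m"
    and "0 < n"
  shows
    "(CD b m (- K) n \<longleftrightarrow>
       (\<forall>f\<in>Cc_plus. \<forall>t\<ge>0. \<forall>x.
          Gamma b m (heat b m t f) x
          \<le> exp (2 * K * t) * heat b m t (Gamma b m f) x
            - 2 * inv_dim n *
              integral {0..t} (\<lambda>s. exp (2 * K * s) *
                heat b m s (\<lambda>y. (heat b m (t - s) (laplacian b m f) y)\<^sup>2) x)))
   \<and> (CD b m (- K) n \<longleftrightarrow>
       (\<forall>f\<in>Cc_plus. \<forall>t\<ge>0. \<forall>x.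
          Gamma b m (heat b m t f) x
          \<le> exp (2 * K * t) * heat b m t (Gamma b m f) x
            - (if K = 0 then 2 * t else (exp (2 * K * t) - 1) / K) * inv_dim n
              * (heat b m t (laplacian b m f) x)\<^sup>2))
   \<and> (CD b m (- K) n \<longleftrightarrow>
       (\<forall>f\<in>Cc_plus. \<forall>t\<ge>0. \<forall>x.
          heat b m t (\<lambda>y. (f y)\<^sup>2) x - (heat b m t f x)\<^sup>2
          \<le> (if K = 0 then 2 * t else (exp (2 * K * t) - 1) / K)
              * heat b m t (Gamma b m f) x
            - (if K = 0 then 2 * t\<^sup>2 else (exp (2 * K * t) - 1 - 2 * K * t) / K\<^sup>2) * inv_dim n
              * (heat b m t (laplacian b m f) x)\<^sup>2))
   \<and> (CD b m (- K) n \<longleftrightarrow>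
       (\<forall>f\<in>Cc_plus. \<forall>t\<ge>0. \<forall>x.
          heat b m t (\<lambda>y. (f y)\<^sup>2) x - (heat b m t f x)\<^sup>2
          \<ge> (if K = 0 then 2 * t else (1 - exp (- 2 * K * t)) / K)
              * Gamma b m (heat b m t f) x
            + (if K = 0 then 2 * t\<^sup>2 else (exp (- 2 * K * t) - 1 + 2 * K * t) / K\<^sup>2) * inv_dim n
              * (heat b m t (laplacian b m f) x)\<^sup>2))"
proof -
  obtain C where C: "0 < C" "\<forall>x y. b x y \<le> C * m x * m y"
    using assms(3) unfolding ellipticity_def by blast
  interpret elliptic_graph b m C
    using assms(1,2) C by unfold_locales (auto simp: locally_finite_graph_def)
  have \<nu>: "0 \<le> inv_dim n"
    using assms(4) by (cases n) (auto simp: inv_dim_def one_ereal_def)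
  have H: "heat b m t f = T t f" if "0 \<le> t" for t f
    using heat_eq_T[OF that] by auto
  have Cc: "f \<in> Cc" if "f \<in> Cc_plus" for f using that by (simp add: Cc_plus_def)
  \<comment> \<open>On [0,t] both s and t - s are nonnegative, so \<open>heat\<close> may be
    replaced by \<open>T\<close> under the integral.\<close>
  have I: "integral {0..t} (\<lambda>s. exp (2 * K * s) * heat b m s (\<lambda>y. (heat b m (t - s) (L f) y)\<^sup>2) x)
      = integral {0..t} (\<lambda>s. exp (2 * K * s) * T s (\<lambda>y. (T (t - s) (L f) y)\<^sup>2) x)" for t x and f :: "'a \<Rightarrow> real"
    by (rule integral_cong) (simp add: H)
  have CDI: "CD b m (- K) n" if "\<And>(f :: 'a \<Rightarrow> real) x. f \<in> Cc_plus \<Longrightarrow> inv_dim n * (L f x)\<^sup>2 - K * Gamma b m f x \<le> Gam b m 2 f f x"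
    unfolding CD_iff_Cc_plus using that by blast
  show ?thesis
  proof (intro conjI iffI ballI allI impI, goal_cases)
    case (1 f t x)
    then show ?case
      using CD_flow[OF 1(1) \<nu> Cc[OF 1(2)] order_refl 1(3) order_refl, of x]
      unfolding H[OF 1(3)] I by (simp add: T_fun_zero del: Gam.simps)
  next
    case 2
    show ?case
    proof (rule CDI, rule gradient_estimate_imp_Gam_two[OF Cc])
      fix f :: "'a \<Rightarrow> real" and t x assume f: "f \<in> Cc_plus" and t: "(0::real) \<le> t"
      \<comment> \<open>The time integral is first weakened by Jensen, after which the derivative
        test for the estimate without the integral applies.\<close>
      have "inv_dim n * (exp_coef1 K t * (T t (L f) x)\<^sup>2)
          \<le> inv_dim n * (2 * integral {0..t} (\<lambda>s. exp (2 * K * s) * T s (\<lambda>y. (T (t - s) (L f) y)\<^sup>2) x))"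
        using square_flow_integral_ge[OF laplacian_Cc[OF Cc[OF f]] order_refl t order_refl, of K x]
        by (intro mult_left_mono \<nu>) (simp add: exp_coef_zero)
      then show "Gamma b m (T t f) x \<le> exp (2 * K * t) * T t (Gamma b m f) x - exp_coef1 K t * inv_dim n * (T t (L f) x)\<^sup>2"
        using 2[rule_format, OF f t, of x] unfolding H[OF t] I by (simp add: mult_ac del: Gam.simps)
    qed
  next
    case (3 f t x)
    then show ?case
      using CD_flow'[OF 3(1) \<nu> Cc[OF 3(2)] order_refl 3(3) order_refl, of x]
      unfolding H[OF 3(3)] exp_coef1_def[symmetric] by (simp add: T_fun_zero exp_coef_zero mult_ac del: Gam.simps)
  next
    case 4
    show ?case
    proof (rule CDI, rule gradient_estimate_imp_Gam_two[OF Cc])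
      fix f :: "'a \<Rightarrow> real" and t x assume f: "f \<in> Cc_plus" and t: "(0::real) \<le> t"
      show "Gamma b m (T t f) x \<le> exp (2 * K * t) * T t (Gamma b m f) x - exp_coef1 K t * inv_dim n * (T t (L f) x)\<^sup>2"
        using 4[rule_format, OF f t, of x] unfolding H[OF t] exp_coef1_def[symmetric] .
    qed
  next
    case (5 f t x)
    then show ?case
      using CD_imp_variance_upper[OF 5(1) \<nu> Cc[OF 5(2)] 5(3), of x]
      unfolding H[OF 5(3)] exp_coef1_def[symmetric] exp_coef2_def[symmetric] by blast
  next
    case 6
    show ?case
    proof (rule CDI, rule variance_upper_imp_Gam_two[OF Cc])
      fix f :: "'a \<Rightarrow> real" and t x assume f: "f \<in> Cc_plus" and t: "(0::real) \<le> t"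
      show "T t (\<lambda>y. (f y)\<^sup>2) x - (T t f x)\<^sup>2
          \<le> exp_coef1 K t * T t (Gamma b m f) x - exp_coef2 K t * inv_dim n * (T t (L f) x)\<^sup>2"
        using 6[rule_format, OF f t, of x] unfolding H[OF t] exp_coef1_def[symmetric] exp_coef2_def[symmetric] .
    qed
  next
    case (7 f t x)
    then show ?case
      using CD_imp_variance_lower[OF 7(1) \<nu> Cc[OF 7(2)] 7(3), of x]
      unfolding H[OF 7(3)] exp_coef_minus[symmetric] by blast
  next
    case 8
    show ?case
    proof (rule CDI, rule variance_lower_imp_Gam_two[OF Cc])
      fix f :: "'a \<Rightarrow> real" and t x assume f: "f \<in> Cc_plus" and t: "(0::real) \<le> t"
      show "exp_coef1 (- K) t * Gamma b m (T t f) x + exp_coef2 (- K) t * inv_dim n * (T t (L f) x)\<^sup>2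
          \<le> T t (\<lambda>y. (f y)\<^sup>2) x - (T t f x)\<^sup>2"
        using 8[rule_format, OF f t, of x] unfolding H[OF t] exp_coef_minus[symmetric] .
    qed
  qed
qed

end
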